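(* Let $X \subset \mathbb{Z}^d$ be a finite set of nonzero integer vectors. Then (i) $\mathsf{M}_0(X) \le r(X) + \lfloor \log(H(X)) \rfloor$, and (ii) $\mathsf{M}_0(X) \le \lfloor 2d \log(2\sqrt{d}\,\|X\|_\infty) \rfloor$.
   Context: Here $\log$ is the base-two logarithm. Write $X=\{\boldsymbol{x}_1,\ldots,\boldsymbol{x}_t\}\subset\mathbb{Z}^d$ with $t=|X|\ge 1$. The semigroup of $X$ is $\mathrm{Sg}(X)=\{\lambda_1\boldsymbol{x}_1+\cdots+\lambda_t\boldsymbol{x}_t:\lambda_1,\ldots,\lambda_t\in\mathbb{Z}_{\ge 0}\}$. For $\boldsymbol{\lambda}\in\mathbb{Z}^t$, $\|\boldsymbol{\lambda}\|_0$ denotes the number of nonzero entries of $\boldsymbol{\lambda}$. For $\boldsymbol{b}\in\mathrm{Sg}(X)$ put $\mathsf{P}_X(\boldsymbol{b})=\{\boldsymbol{\lambda}\in\mathbb{Z}_{\ge0}^t:\lambda_1\boldsymbol{x}_1+\cdots+\lambda_t\boldsymbol{x}_t=\boldsymbol{b}\}$, $\mathsf{m}_0(\boldsymbol{b})=\min\{\|\boldsymbol{\lambda}\|_0:\boldsymbol{\lambda}\in\mathsf{P}_X(\boldsymbol{b})\}$, and $\mathsf{M}_0(X)=\max\{\mathsf{m}_0(\boldsymbol{b}):\boldsymbol{b}\in\mathrm{Sg}(X)\}$. Also $\|X\|_\infty=\max_{\boldsymbol{x}\in X}\|\boldsymbol{x}\|_\infty$, where $\|\boldsymbol{x}\|_\infty=\max_i|x_i|$.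 Let $W=W(X)$ be the $t\times d$ matrix with rows $\boldsymbol{x}_1^T,\ldots,\boldsymbol{x}_t^T$, and let $r(X)$ be the rank of $W$. Let $\Lambda(X)=\mathrm{span}_{\mathbb{R}}(W)\cap\mathbb{Z}^t$, where $\mathrm{span}_{\mathbb{R}}(W)\subset\mathbb{R}^t$ is the linear span of the columns of $W$; it is a lattice of rank $r(X)$. Let $H(X)=\det(\Lambda(X))$, where the determinant of a lattice with basis $\boldsymbol{v}_1,\ldots,\boldsymbol{v}_r$ is $(\det(\boldsymbol{v}_i\cdot\boldsymbol{v}_j)_{1\le i,j\le r})^{1/2}$. *)

theory Defs
  imports "Jordan_Normal_Form.Determinant" "HOL-Analysis.Analysis"
begin

no_notation Matrix.vec_index (infixl "$" 100)
no_notation Matrix.scalar_prod (infix "\<bullet>" 70)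

text \<open>
  A finite set \<open>X = {x\<^sub>1, \<dots>, x\<^sub>t}\<close> of integer vectors is given by an injective enumeration
  \<open>x\<close> over a finite index type \<open>'t\<close>, so that \<open>t = CARD('t)\<close> and \<open>d = CARD('d)\<close>.
\<close>

definition int_comb :: "('t::finite \<Rightarrow> int ^ 'd) \<Rightarrow> int ^ 't \<Rightarrow> int ^ 'd" where
  "int_comb x l = (\<Sum>i\<in>UNIV. (l $ i) *s x i)"

definition Sg :: "('t::finite \<Rightarrow> int ^ 'd) \<Rightarrow> (int ^ 'd) set" where
  "Sg x = {int_comb x l | l. \<forall>i. 0 \<le> l $ i}"

definition norm0 :: "int ^ 't::finite \<Rightarrow> nat" where
  "norm0 l = card {i. l $ i \<noteq> 0}"

definition PX :: "('t::finite \<Rightarrow> int ^ 'd) \<Rightarrow> int ^ 'd \<Rightarrow> (int ^ 't) set" where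
  "PX x b = {l. (\<forall>i. 0 \<le> l $ i) \<and> int_comb x l = b}"

text \<open>
  The sets \<open>PX x b\<close> and \<open>Sg x\<close> may be infinite, but \<open>norm0\<close> is bounded by \<open>CARD('t)\<close>, so the
  minimum and the maximum below range over finite sets; both are nonempty.
\<close>

definition m0 :: "('t::finite \<Rightarrow> int ^ 'd) \<Rightarrow> int ^ 'd \<Rightarrow> nat" where
  "m0 x b = Min (norm0 ` PX x b)"

definition M0 :: "('t::finite \<Rightarrow> int ^ 'd) \<Rightarrow> nat" where
  "M0 x = Max (m0 x ` Sg x)"

definition linf :: "int ^ 'd::finite \<Rightarrow> int" where
  "linf v = Max (range (\<lambda>j. \<bar>v $ j\<bar>))"

definition linf_set :: "(int ^ 'd::finite) set \<Rightarrow> int" where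
  "linf_set X = Max (linf ` X)"

definition Wmat :: "('t::finite \<Rightarrow> int ^ 'd::finite) \<Rightarrow> real ^ 'd ^ 't" where
  "Wmat x = (\<chi> i j. real_of_int (x i $ j))"

definition Lat :: "('t::finite \<Rightarrow> int ^ 'd::finite) \<Rightarrow> (real ^ 't) set" where
  "Lat x = span (columns (Wmat x)) \<inter> {v. \<forall>i. v $ i \<in> \<int>}"

definition is_lattice_basis :: "(real ^ 't::finite) set \<Rightarrow> (real ^ 't) list \<Rightarrow> bool" where
  "is_lattice_basis L vs \<longleftrightarrow>
     distinct vs \<and> independent (set vs) \<and>
     L = {\<Sum>i<length vs. of_int (c i) *\<^sub>R vs ! i | c :: nat \<Rightarrow> int. True}"

definition gram :: "(real ^ 't::finite) list \<Rightarrow> real mat" where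
  "gram vs = Matrix.mat (length vs) (length vs) (\<lambda>(i, j). (vs ! i) \<bullet> (vs ! j))"

text \<open>
  Two bases of a lattice differ by a unimodular transformation, so the value does not depend on
  the basis chosen.
\<close>

definition lattice_det :: "(real ^ 't::finite) set \<Rightarrow> real" where
  "lattice_det L = sqrt (Determinant.det (gram (SOME vs. is_lattice_basis L vs)))"

definition Hdet :: "('t::finite \<Rightarrow> int ^ 'd::finite) \<Rightarrow> real" where
  "Hdet x = lattice_det (Lat x)"

end

theory Submission
  imports Defs "HOL-Probability.Probability"
begin

hide_const (open) Determinant.det Matrix.mat Matrix.vec Matrix.row Matrix.rows Matrix.col Matrix.cols

text \<open>
  Let \<open>S\<close> be a support of minimal size among the representations of a vector \<open>b\<close>. No nonzero
  \<open>y \<in> {-1, 0, 1}\<^sup>t\<close> supported on \<open>S\<close> is a linear relation between the \<open>x\<^sub>i\<close>, since subtracting a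
  suitable multiple of \<open>y\<close> would shrink the support. Let \<open>A\<close> be an integer matrix with \<open>r\<close>
  independent rows which have this property in place of the columns of \<open>W\<close>; the claim is
  \<open>2\<^bsup>|S|\<^esup> \<le> 2\<^sup>r det(A A\<^sup>T)\<^bsup>1/2\<^esup>\<close>. Two estimates of the volume of the part of the box
  \<open>[-1, 1]\<^sup>S \<times> [-1/2, 1/2]\<^bsup>t - S\<^esup>\<close> where all \<open>|(A x)\<^sub>i| \<le> \<epsilon>\<close> are compared as \<open>\<epsilon> \<rightarrow> 0\<close>. By pigeonhole
  on a fine grid, reduced modulo its mesh, the volume is at most \<open>(2\<epsilon>)\<^sup>r\<close>. Conversely, as in
  Vaaler's cube slicing theorem, uniform distributions are more peaked than the Gaussian density
  \<open>exp (-\<pi> s\<^sup>2 / 4) / 2\<close>, so that the volume divided by \<open>2\<^bsup>|S|\<^esup>\<close> is at least the Gaussian measure of the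
  strip, which is about \<open>\<epsilon>\<^sup>r det(A A\<^sup>T)\<^bsup>-1/2\<^esup>\<close>.
  Part (i) takes for \<open>A\<close> a basis of the lattice. Part (ii) takes independent columns of \<open>W\<close>,
  restricted to \<open>S\<close>, and bounds the determinant by Hadamard's inequality.
\<close>

section \<open>The one-dimensional Prekopa--Leindler inequality\<close>

text \<open>The Gaussian is chosen because it is both a product measure and rotation invariant. As a
  product it can be compared with uniform densities one coordinate at a time; by invariance its mass
  on a strip sees the rows of \<open>A\<close> only through their Gram matrix. The obstacle is that
  a strip is oblique to the axes, so a coordinatewise comparison of densities alone says nothing
  about it. What helps is that integrating the indicator of a symmetric convex set over all
  coordinates but one leaves an even log-concave function, which decreases away from 0.
  Prekopa--Leindler is proved for this purpose. The two half-widths of the box have different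
  origins. On \<open>S\<close>, half-width 1 keeps differences below 2, leaving the values -1, 0, 1.
  Off \<open>S\<close>, half-width 1/2 forces differences to vanish and gives side length 1, so
  these coordinates contribute no factor to the volume. Both uniform densities have height at least
  1/2, the peak of the Gaussian. Strips of positive thickness stand in for sections, so only
  full-dimensional Lebesgue measure occurs; the powers of the thickness cancel between the two
  estimates.\<close>

definition log_conc_real :: "(real \<Rightarrow> real) \<Rightarrow> bool" where
  "log_conc_real f \<longleftrightarrow> (\<forall>x. 0 \<le> f x) \<and>
    (\<forall>x y l. 0 < l \<longrightarrow> l < 1 \<longrightarrow> f x powr l * f y powr (1 - l) \<le> f (l * x + (1 - l) * y))"

lemma weighted_am_gm:
  fixes a b l :: real
  assumes "0 \<le> a" "0 \<le> b" "0 < l" "l < 1"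
  shows "a powr l * b powr (1 - l) \<le> l * a + (1 - l) * b"
proof (cases "a = 0 \<or> b = 0")
  case False
  then have "a > 0" "b > 0" using assms by auto
  then have "a powr l * b powr (1 - l) = exp (l * ln a + (1 - l) * ln b)"
    by (simp add: powr_def exp_add)
  also have "\<dots> \<le> l * exp (ln a) + (1 - l) * exp (ln b)"
    using convex_onD[OF exp_convex, of "1 - l" "ln a" "ln b"] assms by simp
  finally show ?thesis using \<open>a > 0\<close> \<open>b > 0\<close> by simp
qed (use assms in auto)

text \<open>One-dimensional Brunn--Minkowski. Convexity of \<open>C\<close> makes it elementary:
  \<open>C\<close> contains the whole interval between two of the convex combinations, so its
  measure bounds even the weighted sum of the diameters of \<open>A\<close> and
  \<open>B\<close>.\<close>

lemma emeasure_convex_combination_ge: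
  fixes A B C :: "real set"
  assumes "convex C" "A \<noteq> {}" "B \<noteq> {}" "0 < l" "l < 1"
    and C: "\<And>x y. x \<in> A \<Longrightarrow> y \<in> B \<Longrightarrow> l * x + (1 - l) * y \<in> C"
  shows "ennreal l * emeasure lborel A + ennreal (1 - l) * emeasure lborel B \<le> emeasure lborel C"
proof (cases "emeasure lborel C = \<infinity>")
  case False
  define c where "c = enn2real (emeasure lborel C)"
  have eC: "emeasure lborel C = ennreal c"
    using False by (simp add: c_def less_top)
  have Cm: "C \<in> sets lborel"
    using \<open>convex C\<close> by (simp add: real_interval_borel_measurable is_interval_convex_1)
  have key: "l * (x2 - x1) + (1 - l) * (y2 - y1) \<le> c"
    if "x1 \<in> A" "x2 \<in> A" "y1 \<in> B" "y2 \<in> B" for x1 x2 y1 y2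
  proof (cases "l * x1 + (1 - l) * y1 \<le> l * x2 + (1 - l) * y2")
    case True
    have "{l * x1 + (1 - l) * y1 .. l * x2 + (1 - l) * y2} \<subseteq> C"
    proof
      fix z assume "z \<in> {l * x1 + (1 - l) * y1 .. l * x2 + (1 - l) * y2}"
      moreover have "is_interval C" using \<open>convex C\<close> by (simp only: is_interval_convex_1)
      ultimately show "z \<in> C"
        using mem_is_interval_1_I[OF _ C[OF that(1,3)] C[OF that(2,4)]] by simp
    qed
    then have "emeasure lborel {l * x1 + (1 - l) * y1 .. l * x2 + (1 - l) * y2} \<le> ennreal c"
      unfolding eC [symmetric] by (rule emeasure_mono) (rule Cm)
    then have "ennreal ((l * x2 + (1 - l) * y2) - (l * x1 + (1 - l) * y1)) \<le> ennreal c"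
      using True by simp
    then show ?thesis
      using True by (simp add: c_def algebra_simps split: if_splits)
  next
    case False
    then have "l * (x2 - x1) + (1 - l) * (y2 - y1) \<le> 0" by (simp add: algebra_simps)
    also have "0 \<le> c" by (simp add: c_def)
    finally show ?thesis .
  qed
  obtain a where a: "a \<in> A" using assms by auto
  obtain b where b: "b \<in> B" using assms by auto
  \<comment> \<open>Freezing the point of \<open>B\<close> in \<open>key\<close> bounds
    \<open>A\<close>, and vice versa; this makes the suprema and infima below meaningful.\<close>
  have bddA: "\<bar>x - a\<bar> \<le> c / l" if "x \<in> A" for x
  proof -
    have "l * (x - a) \<le> c" "l * (a - x) \<le> c"
      using key[OF a that b b] key[OF that a b b] by simp_all
    then show ?thesis using \<open>0 < l\<close> by (simp add: field_simps abs_le_iff)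
  qed
  have bddB: "\<bar>x - b\<bar> \<le> c / (1 - l)" if "x \<in> B" for x
  proof -
    have "(1 - l) * (x - b) \<le> c" "(1 - l) * (b - x) \<le> c"
      using key[OF a a b that] key[OF a a that b] by simp_all
    then show ?thesis using \<open>l < 1\<close> by (simp add: field_simps abs_le_iff)
  qed
  have bdd: "bdd_above T \<and> bdd_below T" if "\<And>x. x \<in> T \<Longrightarrow> \<bar>x - m\<bar> \<le> r" for T :: "real set" and m r
  proof
    show "bdd_above T" by (rule bdd_aboveI[of _ "m + r"]) (use that in \<open>smt (verit)\<close>)
    show "bdd_below T" by (rule bdd_belowI[of _ "m - r"]) (use that in \<open>smt (verit)\<close>)
  qed
  have A1: "bdd_above A" "bdd_below A" using bdd[of A, OF bddA] by simp_all
  have B1: "bdd_above B" "bdd_below B" using bdd[of B, OF bddB] by simp_all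
  have s1: "l * (Sup A - Inf A) + (1 - l) * (Sup B - Inf B) \<le> c"
  proof (rule field_le_epsilon)
    fix e :: real assume "e > 0"
    then have e2: "e / 2 > 0" by simp
    obtain x2 where x2: "x2 \<in> A" "Sup A - e/2 < x2"
      using less_cSup_iff[OF \<open>A \<noteq> {}\<close> A1(1), of "Sup A - e/2"] e2 by auto
    obtain x1 where x1: "x1 \<in> A" "x1 < Inf A + e/2"
      using cInf_less_iff[OF \<open>A \<noteq> {}\<close> A1(2), of "Inf A + e/2"] e2 by auto
    obtain y2 where y2: "y2 \<in> B" "Sup B - e/2 < y2"
      using less_cSup_iff[OF \<open>B \<noteq> {}\<close> B1(1), of "Sup B - e/2"] e2 by auto
    obtain y1 where y1: "y1 \<in> B" "y1 < Inf B + e/2"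
      using cInf_less_iff[OF \<open>B \<noteq> {}\<close> B1(2), of "Inf B + e/2"] e2 by auto
    have "l * (Sup A - Inf A) \<le> l * (x2 - x1 + e)" "(1 - l) * (Sup B - Inf B) \<le> (1 - l) * (y2 - y1 + e)"
      using x1 x2 y1 y2 assms(4,5) by (intro mult_left_mono; simp)+
    then show "l * (Sup A - Inf A) + (1 - l) * (Sup B - Inf B) \<le> c + e"
      using key[OF x1(1) x2(1) y1(1) y2(1)] by (simp add: algebra_simps)
  qed
  have iA: "Inf A \<le> Sup A" and iB: "Inf B \<le> Sup B"
    using A1 B1 a b by (meson cInf_lower cSup_upper order_trans)+
  have "emeasure lborel A \<le> emeasure lborel {Inf A .. Sup A}"
    using A1 by (intro emeasure_mono) (auto intro: cInf_lower cSup_upper)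
  then have eA: "emeasure lborel A \<le> ennreal (Sup A - Inf A)" using iA by simp
  have "emeasure lborel B \<le> emeasure lborel {Inf B .. Sup B}"
    using B1 by (intro emeasure_mono) (auto intro: cInf_lower cSup_upper)
  then have eB: "emeasure lborel B \<le> ennreal (Sup B - Inf B)" using iB by simp
  have "ennreal l * emeasure lborel A + ennreal (1 - l) * emeasure lborel B
     \<le> ennreal l * ennreal (Sup A - Inf A) + ennreal (1 - l) * ennreal (Sup B - Inf B)"
    using eA eB by (intro add_mono mult_left_mono) auto
  also have "\<dots> = ennreal (l * (Sup A - Inf A) + (1 - l) * (Sup B - Inf B))"
    using iA iB assms(4,5)
    by (simp only: ennreal_mult [symmetric] ennreal_plus [symmetric] mult_nonneg_nonneg add_nonneg_nonneg
        less_imp_le diff_ge_0_iff_ge)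
  also have "\<dots> \<le> emeasure lborel C"
    unfolding eC using s1 by (rule ennreal_leI)
  finally show ?thesis .
qed auto

lemma log_conc_real_min:
  assumes "log_conc_real f" "0 \<le> l" "l \<le> 1"
  shows "min (f x) (f y) \<le> f (l * x + (1 - l) * y)"
proof (cases "l = 0 \<or> l = 1")
  case False
  then have l: "0 < l" "l < 1" using assms by auto
  have nn: "\<And>x. 0 \<le> f x" using assms by (simp add: log_conc_real_def)
  define m where "m = min (f x) (f y)"
  have "m = m powr l * m powr (1 - l)"
    using nn by (cases "m = 0") (auto simp: powr_add [symmetric] m_def)
  also have "\<dots> \<le> f x powr l * f y powr (1 - l)"
    using l nn by (intro mult_mono powr_mono2) (auto simp: m_def)
  also have "\<dots> \<le> f (l * x + (1 - l) * y)" using assms l by (simp add: log_conc_real_def)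
  finally show ?thesis by (simp add: m_def)
qed auto

lemma convex_log_conc_superlevel:
  assumes "log_conc_real f"
  shows "convex {x. t < f x}"
proof (rule convexI)
  fix x y u v :: real
  assume *: "x \<in> {x. t < f x}" "y \<in> {x. t < f x}" "0 \<le> u" "0 \<le> v" "u + v = 1"
  then have "min (f x) (f y) \<le> f (u * x + (1 - u) * y)"
    by (intro log_conc_real_min assms) auto
  moreover have "1 - u = v" using * by auto
  ultimately show "u *\<^sub>R x + v *\<^sub>R y \<in> {x. t < f x}" using * by auto
qed

text \<open>Superlevel sets are convex, hence intervals, so log-concavity alone supplies
  measurability.\<close>

lemma borel_measurable_log_conc_real:
  assumes "log_conc_real f"
  shows "f \<in> borel_measurable borel"
  using convex_log_conc_superlevel[OF assms]
  by (subst borel_measurable_iff_greater) (simp add: real_interval_borel_measurable is_interval_convex_1)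

lemma ennreal_eq_divideI:
  assumes "ennreal p = ennreal a * F" "0 < a" "0 \<le> p"
  shows "F = ennreal (p / a)"
proof (cases F rule: ennreal_cases)
  case (real r)
  then have "ennreal p = ennreal (a * r)" using assms by (simp add: ennreal_mult)
  then have "p = a * r" using assms real by (subst (asm) ennreal_inj) auto
  then show ?thesis using real assms by simp
next
  case top
  then show ?thesis using assms by (simp add: ennreal_mult_top)
qed

text \<open>Layer-cake formula with the levels measured in units of \<open>a\<close>. Functions with
  different suprema can then be compared at the same relative level \<open>t\<close>.\<close>

lemma nn_integral_layer:
  fixes f :: "real \<Rightarrow> real"
  assumes [measurable]: "f \<in> borel_measurable borel" and "\<And>x. 0 \<le> f x" "\<And>x. f x \<le> a" "0 < a"
  shows "(\<integral>\<^sup>+x. f x \<partial>lborel) = ennreal a * (\<integral>\<^sup>+t. indicator {0<..<1} t * emeasure lborel {x. t * a < f x} \<partial>lborel)"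
proof -
  have "(\<integral>\<^sup>+x. f x \<partial>lborel) = (\<integral>\<^sup>+x. \<integral>\<^sup>+t. ennreal a * indicator {(x, t). 0 < t \<and> t < 1 \<and> t * a < f x} (x, t) \<partial>lborel \<partial>lborel)"
  proof (rule nn_integral_cong)
    fix x :: real
    have "(\<integral>\<^sup>+t. ennreal a * indicator {(x, t). 0 < t \<and> t < 1 \<and> t * a < f x} (x, t) \<partial>lborel)
       = (\<integral>\<^sup>+t. ennreal a * indicator {0<..<f x / a} t \<partial>lborel)"
      using assms(2)[of x] assms(3)[of x] assms(4)
    proof (intro nn_integral_cong)
      fix t :: real
      have "t < 1" if "t * a < f x"
      proof (rule ccontr)
        assume "\<not> t < 1"
        then have "1 * a \<le> t * a" using assms(4) by (intro mult_right_mono) auto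
        then show False using that assms(3)[of x] by simp
      qed
      then show "ennreal a * indicator {(x, t). 0 < t \<and> t < 1 \<and> t * a < f x} (x, t) = ennreal a * indicator {0<..<f x / a} t"
        using assms(4) by (auto simp: indicator_def field_simps)
    qed
    also have "\<dots> = ennreal a * ennreal (f x / a)"
      using assms(2)[of x] assms(4) by (subst nn_integral_cmult) auto
    also have "\<dots> = f x" using assms(2)[of x] assms(4) by (simp add: ennreal_mult' [symmetric])
    finally show "ennreal (f x) = (\<integral>\<^sup>+t. ennreal a * indicator {(x, t). 0 < t \<and> t < 1 \<and> t * a < f x} (x, t) \<partial>lborel)"
      by simp
  qed
  also have "\<dots> = (\<integral>\<^sup>+t. \<integral>\<^sup>+x. ennreal a * indicator {(x, t). 0 < t \<and> t < 1 \<and> t * a < f x} (x, t) \<partial>lborel \<partial>lborel)"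
    by (rule lborel_pair.Fubini') measurable
  also have "\<dots> = (\<integral>\<^sup>+t. ennreal a * (indicator {0<..<1} t * emeasure lborel {x. t * a < f x}) \<partial>lborel)"
  proof (rule nn_integral_cong)
    fix t :: real
    have "(\<integral>\<^sup>+x. ennreal a * indicator {(x, t). 0 < t \<and> t < 1 \<and> t * a < f x} (x, t) \<partial>lborel)
       = (\<integral>\<^sup>+x. ennreal a * indicator {0<..<1} t * indicator {x. t * a < f x} x \<partial>lborel)"
      by (intro nn_integral_cong) (auto simp: indicator_def)
    also have "\<dots> = ennreal a * indicator {0<..<1} t * emeasure lborel {x. t * a < f x}"
      by (rule nn_integral_cmult_indicator) measurable
    finally show "(\<integral>\<^sup>+x. ennreal a * indicator {(x, t). 0 < t \<and> t < 1 \<and> t * a < f x} (x, t) \<partial>lborel)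
       = ennreal a * (indicator {0<..<1} t * emeasure lborel {x. t * a < f x})"
      by (simp add: mult.assoc)
  qed
  also have "\<dots> = ennreal a * (\<integral>\<^sup>+t. indicator {0<..<1} t * emeasure lborel {x. t * a < f x} \<partial>lborel)"
    by (rule nn_integral_cmult) measurable
  finally show ?thesis .
qed

text \<open>
  After rescaling \<open>f\<close> and \<open>g\<close> to supremum 1, the superlevel sets of \<open>h\<close> contain the convex
  combinations of those of \<open>f\<close> and \<open>g\<close>.
\<close>

lemma Prekopa_Leindler_1:
  fixes f g h :: "real \<Rightarrow> real"
  assumes lc: "log_conc_real f" "log_conc_real g" "log_conc_real h"
    and l: "0 < l" "l < 1"
    and bd: "\<And>x. f x \<le> 1" "\<And>x. g x \<le> 1" "\<And>x. h x \<le> 1"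
    and int: "integrable lborel f" "integrable lborel g" "integrable lborel h"
    and le: "\<And>x y. f x powr l * g y powr (1 - l) \<le> h (l * x + (1 - l) * y)"
  shows "(LINT x|lborel. f x) powr l * (LINT x|lborel. g x) powr (1 - l) \<le> (LINT x|lborel. h x)"
proof -
  have nn: "\<And>x. 0 \<le> f x" "\<And>x. 0 \<le> g x" "\<And>x. 0 \<le> h x" using lc by (auto simp: log_conc_real_def)
  note [measurable] = lc[THEN borel_measurable_log_conc_real]
  define p q w where "p = (LINT x|lborel. f x)" and "q = (LINT x|lborel. g x)" and "w = (LINT x|lborel. h x)"
  have pos: "0 \<le> p" "0 \<le> q" "0 \<le> w" unfolding p_def q_def w_def using nn by (auto intro: integral_nonneg_AE)
  have ef: "(\<integral>\<^sup>+x. f x \<partial>lborel) = p" and eg: "(\<integral>\<^sup>+x. g x \<partial>lborel) = q" and eh: "(\<integral>\<^sup>+x. h x \<partial>lborel) = w"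
    unfolding p_def q_def w_def using nn int by (auto intro!: nn_integral_eq_integral)
  show ?thesis
  proof (cases "p = 0 \<or> q = 0")
    case True
    then show ?thesis using pos l unfolding p_def [symmetric] q_def [symmetric] w_def [symmetric] by auto
  next
    case False
    then have pq: "p > 0" "q > 0" using pos by auto
    define a b where "a = (SUP x. f x)" and "b = (SUP x. g x)"
    have bda: "bdd_above (range f)" and bdb: "bdd_above (range g)"
      using bd by (auto intro!: bdd_aboveI[of _ 1])
    have fa: "f x \<le> a" for x unfolding a_def using bda by (rule cSUP_upper[rotated]) simp
    have gb: "g x \<le> b" for x unfolding b_def using bdb by (rule cSUP_upper[rotated]) simp
    have "a > 0"
    proof (rule ccontr)
      assume "\<not> a > 0"
      then have "f = (\<lambda>x. 0)" using fa nn by (meson antisym ext not_le order_trans)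
      then show False using pq by (simp add: p_def)
    qed
    have "b > 0"
    proof (rule ccontr)
      assume "\<not> b > 0"
      then have "g = (\<lambda>x. 0)" using gb nn by (meson antisym ext not_le order_trans)
      then show False using pq by (simp add: q_def)
    qed
    define c where "c = a powr l * b powr (1 - l)"
    have "c > 0" using \<open>a > 0\<close> \<open>b > 0\<close> by (simp add: c_def)
    have "c \<le> 1"
    proof -
      have "a \<le> 1" "b \<le> 1" unfolding a_def b_def using bd by (auto intro: cSUP_least)
      then have "a powr l * b powr (1 - l) \<le> 1 * 1"
        using l \<open>a > 0\<close> \<open>b > 0\<close> by (intro mult_mono powr_le1) auto
      then show ?thesis by (simp add: c_def)
    qed
    \<comment> \<open>\<open>nn_integral_layer\<close> asks for an upper bound, and the relative
      levels of \<open>h\<close> must refer to \<open>c\<close>, the geometric mean of the suprema.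
      Truncating at \<open>c\<close> does not affect the levels below \<open>c\<close> and can only
      lower the integral.\<close>
    define h' where "h' = (\<lambda>x. min (h x) c)"
    have h'm[measurable]: "h' \<in> borel_measurable borel" unfolding h'_def by measurable
    define FA where "FA = (\<integral>\<^sup>+t. indicator {0<..<1} t * emeasure lborel {x. t * a < f x} \<partial>lborel)"
    define FB where "FB = (\<integral>\<^sup>+t. indicator {0<..<1} t * emeasure lborel {x. t * b < g x} \<partial>lborel)"
    define FC where "FC = (\<integral>\<^sup>+t. indicator {0<..<1} t * emeasure lborel {x. t * c < h' x} \<partial>lborel)"
    have lvl: "ennreal l * emeasure lborel {x. t * a < f x} + ennreal (1 - l) * emeasure lborel {x. t * b < g x}
         \<le> emeasure lborel {x. t * c < h' x}" if t: "0 < t" "t < 1" for t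
    proof -
      have eq: "{x. t * c < h' x} = {x. t * c < h x}"
        using t \<open>c > 0\<close> by (auto simp: h'_def)
      show ?thesis unfolding eq
      proof (rule emeasure_convex_combination_ge)
        show "convex {x. t * c < h x}" by (rule convex_log_conc_superlevel) fact
        have "t * a < a" using t \<open>a > 0\<close> by simp
        then show "{x. t * a < f x} \<noteq> {}"
          unfolding a_def using less_cSUP_iff[OF _ bda] by auto
        have "t * b < b" using t \<open>b > 0\<close> by simp
        then show "{x. t * b < g x} \<noteq> {}"
          unfolding b_def using less_cSUP_iff[OF _ bdb] by auto
        fix x y assume xy: "x \<in> {x. t * a < f x}" "y \<in> {x. t * b < g x}"
        have "t * c = (t * a) powr l * (t * b) powr (1 - l)"
        proof -
          have "t powr l * t powr (1 - l) = t" using t by (simp add: powr_add [symmetric])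
          then show ?thesis using t \<open>a > 0\<close> \<open>b > 0\<close> by (simp add: c_def powr_mult ac_simps)
        qed
        also have "\<dots> < f x powr l * g y powr (1 - l)"
          using xy t \<open>a > 0\<close> \<open>b > 0\<close> l
          by (intro mult_strict_mono powr_less_mono2) (auto simp: mult_less_0_iff intro: order.strict_trans1[of 0 "t * a"])
        also have "\<dots> \<le> h (l * x + (1 - l) * y)" by (rule le)
        finally show "l * x + (1 - l) * y \<in> {x. t * c < h x}" by simp
      qed (use l in auto)
    qed
    have "ennreal l * FA + ennreal (1 - l) * FB = (\<integral>\<^sup>+t. ennreal l * (indicator {0<..<1} t * emeasure lborel {x. t * a < f x})
        + ennreal (1 - l) * (indicator {0<..<1} t * emeasure lborel {x. t * b < g x}) \<partial>lborel)"
      unfolding FA_def FB_def by (subst nn_integral_add) (auto simp: nn_integral_cmult)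
    also have "\<dots> \<le> FC"
      unfolding FC_def using lvl by (intro nn_integral_mono) (auto simp: indicator_def)
    finally have main: "ennreal l * FA + ennreal (1 - l) * FB \<le> FC" .
    have "ennreal p = ennreal a * FA"
      unfolding FA_def ef [symmetric] using nn fa \<open>a > 0\<close> by (intro nn_integral_layer) auto
    then have FA: "FA = ennreal (p / a)"
      using \<open>a > 0\<close> pos by (intro ennreal_eq_divideI) auto
    have "ennreal q = ennreal b * FB"
      unfolding FB_def eg [symmetric] using nn gb \<open>b > 0\<close> by (intro nn_integral_layer) auto
    then have FB: "FB = ennreal (q / b)"
      using \<open>b > 0\<close> pos by (intro ennreal_eq_divideI) auto
    have "ennreal c * FC = (\<integral>\<^sup>+x. h' x \<partial>lborel)"
      unfolding FC_def using nn \<open>c > 0\<close> by (intro nn_integral_layer [symmetric]) (auto simp: h'_def)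
    also have "\<dots> \<le> ennreal w" unfolding eh [symmetric] by (intro nn_integral_mono ennreal_leI) (auto simp: h'_def)
    finally have FC: "ennreal c * FC \<le> ennreal w" .
    have r: "0 \<le> p / a" "0 \<le> q / b" "0 \<le> l" "0 \<le> 1 - l" using l pos \<open>a > 0\<close> \<open>b > 0\<close> by auto
    have "ennreal (c * (l * (p / a) + (1 - l) * (q / b))) = ennreal c * (ennreal l * FA + ennreal (1 - l) * FB)"
      unfolding FA FB using r \<open>c > 0\<close>
      by (simp only: ennreal_mult [symmetric] ennreal_plus [symmetric] mult_nonneg_nonneg add_nonneg_nonneg less_imp_le)
    also have "\<dots> \<le> ennreal c * FC" using main by (rule mult_left_mono) simp
    also have "\<dots> \<le> ennreal w" by (rule FC)
    finally have fin: "c * (l * (p / a) + (1 - l) * (q / b)) \<le> w"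
      using pos by (simp add: ennreal_le_iff)
    \<comment> \<open>Brunn--Minkowski produced an arithmetic mean of the rescaled integrals, which
      dominates their geometric mean; the factor \<open>c\<close> undoes the rescaling exactly in
      the geometric mean.\<close>
    have "p powr l * q powr (1 - l) = c * ((p / a) powr l * (q / b) powr (1 - l))"
      using pos \<open>a > 0\<close> \<open>b > 0\<close> by (simp add: c_def powr_divide)
    also have "\<dots> \<le> c * (l * (p / a) + (1 - l) * (q / b))"
      using pos \<open>a > 0\<close> \<open>b > 0\<close> \<open>c > 0\<close> l by (intro mult_left_mono weighted_am_gm) auto
    finally show ?thesis using fin unfolding p_def q_def w_def by simp
  qed
qed

section \<open>Peakedness of product measures\<close>

text \<open>The model case is the indicator of a symmetric convex set. The bound by 1 makes
  \<open>F\<close> integrable against every product of probability measures. In the inequality zeros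
  of \<open>F\<close> are harmless, since \<open>0 powr l = 0\<close>.\<close>

definition sym_log_conc :: "(('t \<Rightarrow> real) \<Rightarrow> real) \<Rightarrow> bool" where
  "sym_log_conc F \<longleftrightarrow> F \<in> borel_measurable (PiM UNIV (\<lambda>_. borel)) \<and>
    (\<forall>f. 0 \<le> F f \<and> F f \<le> 1 \<and> F (\<lambda>i. - f i) = F f) \<and>
    (\<forall>f g l. 0 < l \<longrightarrow> l < 1 \<longrightarrow> F f powr l * F g powr (1 - l) \<le> F (\<lambda>i. l * f i + (1 - l) * g i))"

text \<open>Even log-concave probability densities. The bound by 1 is the one that
  \<open>Prekopa_Leindler_1\<close> asks of its integrands.\<close>

definition sym_kernel :: "(real \<Rightarrow> real) \<Rightarrow> bool" where
  "sym_kernel k \<longleftrightarrow> log_conc_real k \<and> (\<forall>s. k s \<le> 1 \<and> k (- s) = k s) \<and>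
    integrable lborel k \<and> (LINT s|lborel. k s) = 1"

lemma sym_log_concD:
  assumes "sym_log_conc F"
  shows "F \<in> borel_measurable (PiM UNIV (\<lambda>_. borel))" "0 \<le> F f" "F f \<le> 1" "F (\<lambda>i. - f i) = F f"
    "0 < l \<Longrightarrow> l < 1 \<Longrightarrow> F f powr l * F g powr (1 - l) \<le> F (\<lambda>i. l * f i + (1 - l) * g i)"
  using assms by (auto simp: sym_log_conc_def)

lemma sym_kernelD:
  assumes "sym_kernel k"
  shows "log_conc_real k" "0 \<le> k s" "k s \<le> 1" "k (- s) = k s" "integrable lborel k" "(LINT s|lborel. k s) = 1"
    "k \<in> borel_measurable borel"
  using assms borel_measurable_log_conc_real by (auto simp: sym_kernel_def log_conc_real_def)

lemma prob_space_sym_kernel: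
  assumes "sym_kernel k"
  shows "prob_space (density lborel k)"
proof
  note [measurable] = sym_kernelD(7)[OF assms]
  have "emeasure (density lborel k) (space (density lborel k)) = (\<integral>\<^sup>+s. k s \<partial>lborel)"
    by (simp add: emeasure_density cong: nn_integral_cong)
  also have "\<dots> = 1"
    using sym_kernelD[OF assms] by (subst nn_integral_eq_integral) auto
  finally show "emeasure (density lborel k) (space (density lborel k)) = 1" .
qed

text \<open>The marginal over coordinate \<open>i\<close>, kept as a function of all coordinates
  although it is constant in the \<open>i\<close>-th; repeated marginals thus stay within one
  type.\<close>

definition smear :: "(real \<Rightarrow> real) \<Rightarrow> 't \<Rightarrow> (('t \<Rightarrow> real) \<Rightarrow> real) \<Rightarrow> ('t \<Rightarrow> real) \<Rightarrow> real" where
  "smear k i F f = (LINT s|lborel. F (f(i := s)) * k s)"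

text \<open>Along coordinate \<open>i\<close>, the products of \<open>F\<close> with
  \<open>k\<close> over the fibres through \<open>f\<close>, \<open>g\<close> and their convex
  combination satisfy the pointwise hypothesis of Prekopa--Leindler (\<open>key\<close>), whose
  conclusion is log-concavity of the marginal.\<close>

lemma sym_log_conc_smear:
  fixes F :: "('t \<Rightarrow> real) \<Rightarrow> real"
  assumes k: "sym_kernel k" and F: "sym_log_conc F"
  shows "sym_log_conc (smear k i F)"
proof -
  note [measurable] = sym_kernelD(7)[OF k] sym_log_concD(1)[OF F]
  note kD = sym_kernelD[OF k] and FD = sym_log_concD[OF F]
  have upd[measurable]: "(\<lambda>(f, s). f(i := s)) \<in> PiM UNIV (\<lambda>_. borel) \<Otimes>\<^sub>M borel \<rightarrow>\<^sub>M PiM UNIV (\<lambda>_::'t. borel::real measure)"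
    unfolding case_prod_beta by (rule measurable_fun_upd[where J = UNIV]) auto
  have upd1[measurable]: "(\<lambda>s. f(i := s)) \<in> borel \<rightarrow>\<^sub>M PiM UNIV (\<lambda>_::'t. borel::real measure)" for f :: "'t \<Rightarrow> real"
    by (rule measurable_fun_upd[where J = UNIV]) (auto simp: space_PiM)
  have m1[measurable]: "(\<lambda>s. F (f(i := s)) * k s) \<in> borel_measurable borel" for f
    by measurable
  have bnd: "0 \<le> F (f(i := s)) * k s" "F (f(i := s)) * k s \<le> k s" for f s
    using FD(2,3) kD(2) by (auto intro: mult_left_le_one_le)
  have int: "integrable lborel (\<lambda>s. F (f(i := s)) * k s)" for f
    by (rule Bochner_Integration.integrable_bound[OF kD(5)]) (use bnd kD(2) in auto)
  have key: "(F (f(i := x)) * k x) powr l * (F (g(i := y)) * k y) powr (1 - l)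
      \<le> F ((\<lambda>j. l * f j + (1 - l) * g j)(i := l * x + (1 - l) * y)) * k (l * x + (1 - l) * y)"
    if l: "0 < l" "l < 1" for f g x y l
  proof -
    have "(F (f(i := x)) * k x) powr l * (F (g(i := y)) * k y) powr (1 - l)
       = (F (f(i := x)) powr l * F (g(i := y)) powr (1 - l)) * (k x powr l * k y powr (1 - l))"
      using FD(2) kD(2) by (simp add: powr_mult)
    also have "\<dots> \<le> F (\<lambda>j. l * (f(i := x)) j + (1 - l) * (g(i := y)) j) * k (l * x + (1 - l) * y)"
    proof (rule mult_mono)
      show "F (f(i := x)) powr l * F (g(i := y)) powr (1 - l) \<le> F (\<lambda>j. l * (f(i := x)) j + (1 - l) * (g(i := y)) j)"
        by (rule FD(5)[OF l])
      show "k x powr l * k y powr (1 - l) \<le> k (l * x + (1 - l) * y)"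
        using kD(1) l by (simp add: log_conc_real_def)
    qed (use FD(2) in auto)
    also have "(\<lambda>j. l * (f(i := x)) j + (1 - l) * (g(i := y)) j) = (\<lambda>j. l * f j + (1 - l) * g j)(i := l * x + (1 - l) * y)"
      by auto
    finally show ?thesis .
  qed
  have lc: "log_conc_real (\<lambda>s. F (f(i := s)) * k s)" for f
    unfolding log_conc_real_def
  proof (intro conjI allI impI)
    fix x y l :: real assume l: "0 < l" "l < 1"
    have "(\<lambda>j. l * f j + (1 - l) * f j) = f" by (auto simp: algebra_simps)
    with key[OF l, of f x f y]
    show "(F (f(i := x)) * k x) powr l * (F (f(i := y)) * k y) powr (1 - l)
      \<le> F (f(i := l * x + (1 - l) * y)) * k (l * x + (1 - l) * y)" by simp
  qed (rule bnd)
  show ?thesis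
    unfolding sym_log_conc_def
  proof (intro conjI allI impI)
    show "smear k i F \<in> borel_measurable (PiM UNIV (\<lambda>_. borel))"
      unfolding smear_def [abs_def] by measurable
  next
    fix f show "0 \<le> smear k i F f" unfolding smear_def by (rule integral_nonneg_AE) (use bnd in auto)
    have "smear k i F f \<le> (LINT s|lborel. k s)"
      unfolding smear_def by (rule integral_mono[OF int kD(5)]) (rule bnd)
    then show "smear k i F f \<le> 1" by (simp add: kD)
    \<comment> \<open>Reflecting the integration variable combines the evenness of \<open>k\<close>
      with the symmetry of \<open>F\<close>.\<close>
    have "(LINT s|lborel. F ((\<lambda>j. - f j)(i := s)) * k s) = (LINT s|lborel. F ((\<lambda>j. - f j)(i := - s)) * k (- s))"
      using lborel_integral_real_affine[of "-1" "\<lambda>s. F ((\<lambda>j. - f j)(i := s)) * k s" 0] by simp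
    also have "\<dots> = (LINT s|lborel. F (\<lambda>j. - (f(i := s)) j) * k s)"
      by (intro Bochner_Integration.integral_cong refl arg_cong2[where f = "(*)"] arg_cong[where f = F])
        (auto simp: kD)
    also have "\<dots> = (LINT s|lborel. F (f(i := s)) * k s)"
      by (simp only: FD(4))
    finally show "smear k i F (\<lambda>j. - f j) = smear k i F f" unfolding smear_def .
  next
    fix f g :: "'t \<Rightarrow> real" and l :: real assume l: "0 < l" "l < 1"
    show "smear k i F f powr l * smear k i F g powr (1 - l) \<le> smear k i F (\<lambda>j. l * f j + (1 - l) * g j)"
      unfolding smear_def
      by (rule Prekopa_Leindler_1[OF lc lc lc l _ _ _ int int int key[OF l]])
        (use bnd kD(3) in \<open>meson order_trans\<close>)+
  qed
qed

lemma override_on_insert_upd: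
  "override_on f (x(i := y)) (insert i I) = (override_on f x I)(i := y)"
  by (auto simp: override_on_def)

lemma measurable_override_on [measurable]:
  fixes f :: "'t \<Rightarrow> real"
  assumes "\<And>i. sets (M i) = sets borel"
  shows "(\<lambda>x. override_on f x I) \<in> PiM I M \<rightarrow>\<^sub>M PiM UNIV (\<lambda>_. borel)"
proof (rule measurable_PiM_single')
  fix i :: 't
  show "(\<lambda>x. override_on f x I i) \<in> borel_measurable (PiM I M)"
  proof (cases "i \<in> I")
    case True
    then have "(\<lambda>x. x i) \<in> PiM I M \<rightarrow>\<^sub>M M i" by (rule measurable_component_singleton)
    then show ?thesis using True assms[of i] by (simp add: override_on_def cong: measurable_cong_sets)
  qed (simp add: override_on_def)
qed auto

text \<open>The coordinates in \<open>I\<close> are integrated out one by one, each by a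
  \<open>smear\<close>. \<open>override_on f x I\<close> takes the coordinates in \<open>I\<close>
  from the integration variable and the others from \<open>f\<close>.\<close>

lemma sym_log_conc_marginal:
  fixes F :: "('t \<Rightarrow> real) \<Rightarrow> real"
  assumes k: "\<And>i. sym_kernel (k i)" and "finite I" and "sym_log_conc F"
  shows "sym_log_conc (\<lambda>f. LINT x|PiM I (\<lambda>i. density lborel (k i)). F (override_on f x I))"
  using assms(2,3)
proof (induction I arbitrary: F rule: finite_induct)
  case empty
  interpret product_sigma_finite "\<lambda>i. density lborel (k i)"
    by (simp add: k product_sigma_finite.intro prob_space_imp_sigma_finite prob_space_sym_kernel)
  show ?case using empty by (simp add: PiM_empty lebesgue_integral_count_space_finite)
next
  case (insert i I)
  interpret product_sigma_finite "\<lambda>i. density lborel (k i)"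
    by (simp add: k product_sigma_finite.intro prob_space_imp_sigma_finite prob_space_sym_kernel)
  have P: "prob_space (PiM (insert i I) (\<lambda>i. density lborel (k i)))"
    by (intro prob_space_PiM prob_space_sym_kernel k)
  note FD = sym_log_concD[OF insert.prems]
  note [measurable] = FD(1) sym_kernelD(7)[OF k]
  have upd1[measurable]: "(\<lambda>s. f(i := s)) \<in> borel \<rightarrow>\<^sub>M PiM UNIV (\<lambda>_::'t. borel::real measure)" for f :: "'t \<Rightarrow> real"
    by (rule measurable_fun_upd[where J = UNIV]) (auto simp: space_PiM)
  have "(LINT x|PiM (insert i I) (\<lambda>i. density lborel (k i)). F (override_on f x (insert i I)))
     = (LINT x|PiM I (\<lambda>i. density lborel (k i)). smear (k i) i F (override_on f x I))" for f
  proof -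
    have int: "integrable (PiM (insert i I) (\<lambda>i. density lborel (k i))) (\<lambda>x. F (override_on f x (insert i I)))"
      using FD(2,3) P
      by (intro finite_measure.integrable_const_bound[where B = 1] prob_space.finite_measure)
        (auto intro!: measurable_compose[OF measurable_override_on FD(1)])
    have "(LINT x|PiM (insert i I) (\<lambda>i. density lborel (k i)). F (override_on f x (insert i I)))
       = (LINT x|PiM I (\<lambda>i. density lborel (k i)). LINT y|density lborel (k i). F (override_on f (x(i := y)) (insert i I)))"
      by (rule product_integral_insert) fact+
    also have "\<dots> = (LINT x|PiM I (\<lambda>i. density lborel (k i)). smear (k i) i F (override_on f x I))"
    proof (rule Bochner_Integration.integral_cong[OF refl])
      fix x
      have "(LINT y|density lborel (k i). F ((override_on f x I)(i := y))) = (LINT y|lborel. k i y * F ((override_on f x I)(i := y)))"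
        using sym_kernelD(2)[OF k] by (intro integral_real_density) auto
      then show "(LINT y|density lborel (k i). F (override_on f (x(i := y)) (insert i I))) = smear (k i) i F (override_on f x I)"
        unfolding override_on_insert_upd smear_def by (simp add: mult.commute)
    qed
    finally show ?thesis .
  qed
  then show ?case using insert.IH[OF sym_log_conc_smear[OF k insert.prems]] by simp
qed

text \<open>Moving mass towards 0 increases the integral of a function decreasing in the absolute
  value. Pointwise, \<open>p s - p a\<close> and \<open>u s - g s\<close> have the same sign;
  integrating their product gives the claim, because the constant \<open>p a\<close> meets two
  densities of equal total mass.\<close>

lemma single_crossing:
  fixes p :: "real \<Rightarrow> real"
  assumes u: "sym_kernel u" and g: "sym_kernel g"
    and cross: "\<And>s. \<bar>s\<bar> < a \<Longrightarrow> g s \<le> u s" "\<And>s. a \<le> \<bar>s\<bar> \<Longrightarrow> u s \<le> g s" "0 \<le> a"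
    and p: "p \<in> borel_measurable borel" "\<And>s. 0 \<le> p s" "\<And>s. p s \<le> 1"
    and mono: "\<And>s t. \<bar>s\<bar> \<le> \<bar>t\<bar> \<Longrightarrow> p t \<le> p s"
  shows "(LINT s|density lborel g. p s) \<le> (LINT s|density lborel u. p s)"
proof -
  note [measurable] = sym_kernelD(7)[OF u] sym_kernelD(7)[OF g] p(1)
  have int: "integrable lborel (\<lambda>s. k s * p s)" if k: "sym_kernel k" for k
  proof (rule Bochner_Integration.integrable_bound[OF sym_kernelD(5)[OF k]])
    show "(\<lambda>s. k s * p s) \<in> borel_measurable lborel" using sym_kernelD(7)[OF k] by measurable
    show "AE s in lborel. norm (k s * p s) \<le> norm (k s)"
      using p sym_kernelD(2)[OF k] by (intro AE_I2) (auto simp: abs_mult intro: mult_left_le)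
  qed
  note iu = int[OF u] and ig = int[OF g]
  have "(LINT s|lborel. g s * p s + p a * u s) \<le> (LINT s|lborel. u s * p s + p a * g s)"
  proof (rule integral_mono)
    show "integrable lborel (\<lambda>s. g s * p s + p a * u s)" "integrable lborel (\<lambda>s. u s * p s + p a * g s)"
      using iu ig sym_kernelD(5)[OF u] sym_kernelD(5)[OF g] by auto
    fix s :: real
    have "0 \<le> (p s - p a) * (u s - g s)"
    proof (cases "\<bar>s\<bar> < a")
      case True
      then have "p a \<le> p s" "g s \<le> u s" using mono[of s a] cross by auto
      then show ?thesis by simp
    next
      case False
      then have "p s \<le> p a" "u s \<le> g s" using mono[of a s] cross by auto
      then show ?thesis by (simp add: mult_nonpos_nonpos)
    qed
    then show "g s * p s + p a * u s \<le> u s * p s + p a * g s" by (simp add: algebra_simps)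
  qed
  then have "(LINT s|lborel. g s * p s) \<le> (LINT s|lborel. u s * p s)"
    using iu ig sym_kernelD(5,6)[OF u] sym_kernelD(5,6)[OF g] by simp
  then show ?thesis
    using sym_kernelD(2)[OF u] sym_kernelD(2)[OF g] by (subst (1 2) integral_real_density) auto
qed

text \<open>Integrating out all coordinates but \<open>i\<close> leaves a function \<open>p\<close>
  of one variable that is even and log-concave, hence decreasing in the absolute value, so
  \<open>single_crossing\<close> applies in coordinate \<open>i\<close>.\<close>

lemma PiM_swap_coordinate:
  fixes F :: "('t::finite \<Rightarrow> real) \<Rightarrow> real"
  assumes k: "\<And>j. sym_kernel (k j)" and g: "sym_kernel g" and F: "sym_log_conc F"
    and cross: "\<And>s. \<bar>s\<bar> < a \<Longrightarrow> g s \<le> k i s" "\<And>s. a \<le> \<bar>s\<bar> \<Longrightarrow> k i s \<le> g s" "0 \<le> a"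
  shows "(LINT x|PiM UNIV (\<lambda>j. density lborel ((k(i := g)) j)). F x) \<le> (LINT x|PiM UNIV (\<lambda>j. density lborel (k j)). F x)"
proof -
  define I where "I = UNIV - {i}"
  have I: "insert i I = UNIV" "i \<notin> I" "finite I" by (auto simp: I_def)
  note FD = sym_log_concD[OF F]
  note [measurable] = FD(1)
  define \<Phi> where "\<Phi> f = (LINT x|PiM I (\<lambda>j. density lborel (k j)). F (override_on f x I))" for f
  have \<Phi>: "sym_log_conc \<Phi>"
    unfolding \<Phi>_def [abs_def] by (rule sym_log_conc_marginal) fact+
  note \<Phi>D = sym_log_concD[OF \<Phi>]
  note [measurable] = \<Phi>D(1)
  \<comment> \<open>\<open>\<Phi>\<close> reads only the \<open>i\<close>-th coordinate of its
    argument; the 0 elsewhere is a filler.\<close>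
  define p where "p s = \<Phi> ((\<lambda>_. 0)(i := s))" for s
  have upd1[measurable]: "(\<lambda>s. f(i := s)) \<in> borel \<rightarrow>\<^sub>M PiM UNIV (\<lambda>_::'t. borel::real measure)" for f :: "'t \<Rightarrow> real"
    by (rule measurable_fun_upd[where J = UNIV]) (auto simp: space_PiM)
  have pm: "p \<in> borel_measurable borel" unfolding p_def [abs_def] by measurable
  \<comment> \<open>Stated for any \<open>m\<close> agreeing with \<open>k\<close> off
    \<open>i\<close>, so that it rewrites the integrals before and after the swap with the same
    \<open>p\<close>.\<close>
  have main: "(LINT x|PiM UNIV (\<lambda>j. density lborel (m j)). F x) = (LINT s|density lborel (m i). p s)"
    if m: "\<And>j. sym_kernel (m j)" and eq: "\<And>j. j \<in> I \<Longrightarrow> m j = k j" for m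
  proof -
    interpret product_sigma_finite "\<lambda>i. density lborel (m i)"
      by (simp add: m product_sigma_finite.intro prob_space_imp_sigma_finite prob_space_sym_kernel)
    have PI: "prob_space (PiM J (\<lambda>i. density lborel (m i)))" for J
      by (intro prob_space_PiM prob_space_sym_kernel m)
    interpret pair_sigma_finite "PiM I (\<lambda>i. density lborel (m i))" "density lborel (m i)"
      by (intro pair_sigma_finite.intro prob_space_imp_sigma_finite PI prob_space_sym_kernel m)
    interpret pair_prob_space "PiM I (\<lambda>i. density lborel (m i))" "density lborel (m i)"
      by (intro pair_prob_space.intro pair_sigma_finite.intro prob_space_imp_sigma_finite PI prob_space_sym_kernel m)
    have Pk: "PiM I (\<lambda>j. density lborel (m j)) = PiM I (\<lambda>j. density lborel (k j))"
      by (intro PiM_cong) (auto simp: eq)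
    have sb: "sets (PiM UNIV (\<lambda>j. density lborel (m j))) = sets (PiM UNIV (\<lambda>_. borel))"
      by (intro sets_PiM_cong) auto
    have Fm: "F \<in> borel_measurable (PiM UNIV (\<lambda>j. density lborel (m j)))"
      using FD(1) by (simp cong: measurable_cong_sets add: measurable_cong_sets[OF sb refl])
    have int: "integrable (PiM (insert i I) (\<lambda>i. density lborel (m i))) F"
      using FD(2,3) PI Fm unfolding I
      by (intro finite_measure.integrable_const_bound[where B = 1] prob_space.finite_measure) auto
    have "(\<lambda>z. (fst z)(i := snd z)) \<in> PiM I (\<lambda>i. density lborel (m i)) \<Otimes>\<^sub>M density lborel (m i)
        \<rightarrow>\<^sub>M PiM UNIV (\<lambda>j. density lborel (m j))"
      by (rule measurable_fun_upd[where J = I]) (use I in auto)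
    from measurable_compose[OF this Fm]
    have m2: "(\<lambda>z. F ((fst z)(i := snd z))) \<in> borel_measurable (PiM I (\<lambda>i. density lborel (m i)) \<Otimes>\<^sub>M density lborel (m i))" .
    have int2: "integrable (PiM I (\<lambda>i. density lborel (m i)) \<Otimes>\<^sub>M density lborel (m i)) (\<lambda>(x, y). F (x(i := y)))"
      using FD(2,3) m2
      by (intro P.integrable_const_bound[where B = 1]) (auto simp: case_prod_beta)
    have "(LINT x|PiM UNIV (\<lambda>j. density lborel (m j)). F x)
       = (LINT x|PiM I (\<lambda>j. density lborel (m j)). LINT y|density lborel (m i). F (x(i := y)))"
      using product_integral_insert[OF I(3,2) int] unfolding I .
    also have "\<dots> = (LINT y|density lborel (m i). LINT x|PiM I (\<lambda>j. density lborel (m j)). F (x(i := y)))"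
      by (rule Fubini_integral[symmetric, OF int2])
    also have "\<dots> = (LINT s|density lborel (m i). p s)"
      unfolding p_def \<Phi>_def Pk
      by (intro Bochner_Integration.integral_cong refl arg_cong[where f = F]) (auto simp: override_on_def I_def)
    finally show ?thesis .
  qed
  have even: "p (- s) = p s" for s
  proof -
    have "(\<lambda>_. 0)(i := - s) = (\<lambda>j. - ((\<lambda>_. 0)(i := s)) j)" by auto
    then show ?thesis unfolding p_def by (metis \<Phi>D(4))
  qed
  have mono: "p t \<le> p s" if "\<bar>s\<bar> \<le> \<bar>t\<bar>" for s t
  proof (cases "\<bar>s\<bar> = \<bar>t\<bar>")
    case True
    then have "s = t \<or> s = - t" by auto
    then show ?thesis using even by auto
  next
    case False
    then have st: "\<bar>s\<bar> < \<bar>t\<bar>" using that by simp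
    \<comment> \<open>This weight makes \<open>s\<close> the convex combination of \<open>t\<close>
      and \<open>- t\<close>, at which \<open>p\<close> takes equal values.\<close>
    define l where "l = (s / t + 1) / 2"
    have "\<bar>s / t\<bar> < 1" using st by (simp add: abs_divide)
    then have "- 1 < s / t \<and> s / t < 1" by linarith
    then have l: "0 < l" "l < 1" by (auto simp: l_def)
    have ls: "l * t + (1 - l) * (- t) = s" using st by (simp add: l_def field_simps)
    have pt: "0 \<le> p t" unfolding p_def by (rule \<Phi>D)
    have "p t = p t powr l * p t powr (1 - l)" using pt by (cases "p t = 0") (auto simp: powr_add [symmetric])
    also have "\<dots> = p t powr l * p (- t) powr (1 - l)" by (simp add: even)
    also have "\<dots> \<le> \<Phi> (\<lambda>j. l * ((\<lambda>_. 0)(i := t)) j + (1 - l) * ((\<lambda>_. 0)(i := - t)) j)"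
      unfolding p_def by (rule \<Phi>D(5)) fact+
    also have "(\<lambda>j. l * ((\<lambda>_. 0)(i := t)) j + (1 - l) * ((\<lambda>_. 0)(i := - t)) j) = (\<lambda>_. 0)(i := s)"
      using ls by auto
    finally show ?thesis by (simp only: p_def)
  qed
  have "(LINT x|PiM UNIV (\<lambda>j. density lborel ((k(i := g)) j)). F x) = (LINT s|density lborel g. p s)"
  proof -
    have "(LINT x|PiM UNIV (\<lambda>j. density lborel ((k(i := g)) j)). F x) = (LINT s|density lborel ((k(i := g)) i). p s)"
      by (rule main) (use k g I in auto)
    then show ?thesis by (simp only: fun_upd_same)
  qed
  also have "\<dots> \<le> (LINT s|density lborel (k i). p s)"
    by (rule single_crossing[OF k g cross pm _ _ mono]) (auto simp: p_def \<Phi>D)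
  also have "\<dots> = (LINT x|PiM UNIV (\<lambda>j. density lborel (k j)). F x)"
    using main[of k] k by simp
  finally show ?thesis .
qed

text \<open>Kernels are exchanged one coordinate at a time. Every intermediate measure is again a
  product of symmetric log-concave kernels, as the next swap requires; the crossing point may depend
  on the coordinate.\<close>

lemma Kanter_comparison:
  fixes F :: "('t::finite \<Rightarrow> real) \<Rightarrow> real"
  assumes u: "\<And>j. sym_kernel (u j)" and g: "sym_kernel g" and F: "sym_log_conc F"
    and cross: "\<And>j s. \<bar>s\<bar> < a j \<Longrightarrow> g s \<le> u j s" "\<And>j s. a j \<le> \<bar>s\<bar> \<Longrightarrow> u j s \<le> g s" "\<And>j. 0 \<le> a j"
  shows "(LINT x|PiM UNIV (\<lambda>j. density lborel g). F x) \<le> (LINT x|PiM UNIV (\<lambda>j. density lborel (u j)). F x)"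
proof -
  have "(LINT x|PiM UNIV (\<lambda>j. density lborel (if j \<in> R then g else u j)). F x)
      \<le> (LINT x|PiM UNIV (\<lambda>j. density lborel (u j)). F x)" for R :: "'t set"
    using finite[of R]
  proof (induction R rule: finite_induct)
    case (insert i R)
    define k where "k = (\<lambda>j. if j \<in> R then g else u j)"
    have "(LINT x|PiM UNIV (\<lambda>j. density lborel ((k(i := g)) j)). F x) \<le> (LINT x|PiM UNIV (\<lambda>j. density lborel (k j)). F x)"
      by (rule PiM_swap_coordinate[where a = "a i"]) (use u g F cross insert in \<open>auto simp: k_def\<close>)
    moreover have "(k(i := g)) = (\<lambda>j. if j \<in> insert i R then g else u j)" by (auto simp: k_def)
    ultimately have "(LINT x|PiM UNIV (\<lambda>j. density lborel (if j \<in> insert i R then g else u j)). F x)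
        \<le> (LINT x|PiM UNIV (\<lambda>j. density lborel (if j \<in> R then g else u j)). F x)" unfolding k_def by metis
    then show ?case using insert.IH by (rule order_trans)
  qed simp
  from this[of UNIV] show ?thesis by simp
qed

section \<open>Product measures on functions and Lebesgue measure on vectors\<close>

lemma borel_measurable_vec_lambda:
  assumes "\<And>i. sets (M i) = sets borel"
  shows "(\<lambda>f. \<chi> i. f i) \<in> borel_measurable (PiM (UNIV::'t::finite set) M :: ('t \<Rightarrow> real) measure)"
proof (subst borel_measurable_euclidean_space, rule ballI)
  fix b :: "real^'t" assume "b \<in> Basis"
  then obtain i where b: "b = axis i 1" by (auto simp: Basis_vec_def)
  have "(\<lambda>f. f i) \<in> PiM UNIV M \<rightarrow>\<^sub>M M i" by (rule measurable_component_singleton) simp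
  then show "(\<lambda>f. (\<chi> i. f i) \<bullet> b) \<in> borel_measurable (PiM UNIV M)"
    using assms[of i] by (simp add: b inner_axis cong: measurable_cong_sets)
qed

lemma prod_Basis_vec: "(\<Prod>b\<in>Basis. h ((x::real^'t::finite) \<bullet> b)) = (\<Prod>i\<in>UNIV. h (x $ i))"
  by (rule prod.reindex_cong[of "\<lambda>i. axis i 1"])
    (auto simp: inj_on_def axis_eq_axis inner_axis Basis_vec_def)

lemma lborel_vec: "(lborel :: (real^'t::finite) measure) = distr (PiM UNIV (\<lambda>_. lborel)) borel (\<lambda>f. \<chi> i. f i)"
proof (rule lborel_eqI)
  interpret product_sigma_finite "\<lambda>_::'t. lborel::real measure"
    by standard
  fix l u :: "real^'t"
  assume le: "\<And>b. b \<in> Basis \<Longrightarrow> l \<bullet> b \<le> u \<bullet> b"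
  have le': "l $ i \<le> u $ i" for i using le[of "axis i 1"] by (simp add: inner_axis axis_in_Basis_iff)
  have m: "(\<lambda>f. \<chi> i. f i) \<in> borel_measurable (PiM (UNIV::'t set) (\<lambda>_. lborel) :: ('t \<Rightarrow> real) measure)"
    by (rule borel_measurable_vec_lambda) simp
  have "emeasure (distr (PiM UNIV (\<lambda>_. lborel)) borel (\<lambda>f. \<chi> i. f i)) (box l u)
      = emeasure (PiM UNIV (\<lambda>_. lborel)) (PiE UNIV (\<lambda>i. {l $ i <..< u $ i}))"
    by (subst emeasure_distr[OF m])
      (auto simp: space_PiM mem_box_cart PiE_def Pi_def intro!: arg_cong[where f = "emeasure _"])
  also have "\<dots> = (\<Prod>i\<in>UNIV. ennreal (u $ i - l $ i))"
    using le' by (subst emeasure_PiM) auto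
  also have "\<dots> = (\<Prod>b\<in>Basis. ennreal ((u - l) \<bullet> b))"
    using prod_Basis_vec[of ennreal "u - l"] by simp
  also have "\<dots> = ennreal (\<Prod>b\<in>Basis. (u - l) \<bullet> b)"
    using le by (intro prod_ennreal) (auto simp: inner_diff_left)
  finally show "emeasure (distr (PiM UNIV (\<lambda>_. lborel)) borel (\<lambda>f. \<chi> i. f i)) (box l u) = (\<Prod>b\<in>Basis. (u - l) \<bullet> b)" .
qed simp

lemma PiM_density_lborel:
  fixes k :: "'t::finite \<Rightarrow> real \<Rightarrow> real"
  assumes k: "\<And>i. sym_kernel (k i)"
  shows "PiM UNIV (\<lambda>i. density lborel (k i)) = density (PiM UNIV (\<lambda>_. lborel)) (\<lambda>f. \<Prod>i\<in>UNIV. ennreal (k i (f i)))"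
proof -
  note [measurable] = sym_kernelD(7)[OF k]
  interpret P: product_sigma_finite "\<lambda>i. density lborel (k i)"
    by (simp add: k product_sigma_finite.intro prob_space_imp_sigma_finite prob_space_sym_kernel)
  interpret L: product_sigma_finite "\<lambda>_::'t. lborel::real measure"
    by standard
  have "density (PiM UNIV (\<lambda>_. lborel)) (\<lambda>f. \<Prod>i\<in>UNIV. ennreal (k i (f i))) = PiM UNIV (\<lambda>i. density lborel (k i))"
  proof (rule P.PiM_eqI)
    show "sets (density (PiM UNIV (\<lambda>_. lborel)) (\<lambda>f. \<Prod>i\<in>UNIV. ennreal (k i (f i)))) = sets (PiM UNIV (\<lambda>i. density lborel (k i)))"
      by (simp, intro sets_PiM_cong) auto
    fix A :: "'t \<Rightarrow> real set" assume "\<And>i. i \<in> UNIV \<Longrightarrow> A i \<in> sets (density lborel (k i))"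
    then have A[measurable]: "\<And>i. A i \<in> sets borel" by simp
    have "Pi\<^sub>E UNIV A \<in> sets (PiM UNIV (\<lambda>_. lborel))" by (rule sets_PiM_I_finite) (auto simp: A)
    then have "emeasure (density (PiM UNIV (\<lambda>_. lborel)) (\<lambda>f. \<Prod>i\<in>UNIV. ennreal (k i (f i)))) (Pi\<^sub>E UNIV A)
      = (\<integral>\<^sup>+f. (\<Prod>i\<in>UNIV. ennreal (k i (f i))) * indicator (Pi\<^sub>E UNIV A) f \<partial>PiM UNIV (\<lambda>_. lborel))"
      by (intro emeasure_density) auto
    also have "\<dots> = (\<integral>\<^sup>+f. (\<Prod>i\<in>UNIV. ennreal (k i (f i)) * indicator (A i) (f i)) \<partial>PiM UNIV (\<lambda>_. lborel))"
    proof (rule nn_integral_cong)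
      fix f
      have "indicator (Pi\<^sub>E UNIV A) f = (\<Prod>i\<in>UNIV. indicator (A i) (f i) :: ennreal)"
        by (auto simp: indicator_def PiE_def Pi_def prod_zero_iff)
      then show "(\<Prod>i\<in>UNIV. ennreal (k i (f i))) * indicator (Pi\<^sub>E UNIV A) f = (\<Prod>i\<in>UNIV. ennreal (k i (f i)) * indicator (A i) (f i))"
        by (simp add: prod.distrib)
    qed
    also have "\<dots> = (\<Prod>i\<in>UNIV. \<integral>\<^sup>+s. ennreal (k i s) * indicator (A i) s \<partial>lborel)"
      by (rule L.product_nn_integral_prod) auto
    also have "\<dots> = (\<Prod>i\<in>UNIV. emeasure (density lborel (k i)) (A i))"
      by (intro prod.cong refl emeasure_density[symmetric]) auto
    finally show "emeasure (density (PiM UNIV (\<lambda>_. lborel)) (\<lambda>f. \<Prod>i\<in>UNIV. ennreal (k i (f i)))) (Pi\<^sub>E UNIV A)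
      = (\<Prod>i\<in>UNIV. emeasure (density lborel (k i)) (A i))" .
  qed simp
  then show ?thesis by simp
qed

lemma PiM_integral_indicator_vec:
  fixes k :: "'t::finite \<Rightarrow> real \<Rightarrow> real"
  assumes k: "\<And>i. sym_kernel (k i)" and K[measurable]: "K \<in> sets borel"
  shows "ennreal (LINT f|PiM UNIV (\<lambda>i. density lborel (k i)). indicator K (\<chi> i. f i))
    = (\<integral>\<^sup>+x. indicator K x * (\<Prod>i\<in>UNIV. ennreal (k i (x $ i))) \<partial>lborel)"
proof -
  note [measurable] = sym_kernelD(7)[OF k]
  have m[measurable]: "(\<lambda>f. \<chi> i. f i) \<in> borel_measurable (PiM (UNIV::'t set) (\<lambda>_. lborel) :: ('t \<Rightarrow> real) measure)"
    by (rule borel_measurable_vec_lambda) simp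
  have m'[measurable]: "(\<lambda>f. \<chi> i. f i) \<in> borel_measurable (PiM (UNIV::'t set) (\<lambda>i. density lborel (k i)) :: ('t \<Rightarrow> real) measure)"
    by (rule borel_measurable_vec_lambda) simp
  interpret prob_space "PiM UNIV (\<lambda>i. density lborel (k i))"
    by (intro prob_space_PiM prob_space_sym_kernel k)
  have "ennreal (LINT f|PiM UNIV (\<lambda>i. density lborel (k i)). indicator K (\<chi> i. f i))
    = (\<integral>\<^sup>+f. ennreal (indicator K (\<chi> i. f i)) \<partial>PiM UNIV (\<lambda>i. density lborel (k i)))"
    by (intro nn_integral_eq_integral[symmetric] integrable_const_bound[where B = 1]) (auto simp: indicator_def)
  also have "\<dots> = (\<integral>\<^sup>+f. (\<Prod>i\<in>UNIV. ennreal (k i (f i))) * ennreal (indicator K (\<chi> i. f i)) \<partial>PiM UNIV (\<lambda>_. lborel))"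
    unfolding PiM_density_lborel[OF k] by (rule nn_integral_density) measurable
  also have "\<dots> = (\<integral>\<^sup>+f. indicator K (\<chi> i. f i) * (\<Prod>i\<in>UNIV. ennreal (k i ((\<chi> i. f i) $ i))) \<partial>PiM UNIV (\<lambda>_. lborel))"
    by (intro nn_integral_cong) (auto simp: indicator_def)
  also have "\<dots> = (\<integral>\<^sup>+x. indicator K x * (\<Prod>i\<in>UNIV. ennreal (k i (x $ i))) \<partial>lborel)"
    by (subst lborel_vec, subst nn_integral_distr[OF m]) auto
  finally show ?thesis .
qed

lemma sym_log_conc_indicator:
  fixes K :: "(real^'t::finite) set"
  assumes K[measurable]: "K \<in> sets borel" and "convex K" and sym: "\<And>x. x \<in> K \<Longrightarrow> - x \<in> K"
  shows "sym_log_conc (\<lambda>f. indicator K (\<chi> i. f i))"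
  unfolding sym_log_conc_def
proof (intro conjI allI impI)
  have [measurable]: "(\<lambda>f. \<chi> i. f i) \<in> borel_measurable (PiM (UNIV::'t set) (\<lambda>_. borel) :: ('t \<Rightarrow> real) measure)"
    by (rule borel_measurable_vec_lambda) simp
  show "(\<lambda>f. indicator K (\<chi> i. f i) :: real) \<in> borel_measurable (PiM UNIV (\<lambda>_. borel))"
    by measurable
  fix f :: "'t \<Rightarrow> real"
  have eq: "(\<chi> i. - f i) = - (\<chi> i. f i)" by (simp add: vec_eq_iff)
  have "(\<chi> i. - f i) \<in> K \<longleftrightarrow> (\<chi> i. f i) \<in> K"
    unfolding eq using sym[of "\<chi> i. f i"] sym[of "- (\<chi> i. f i)"] by auto
  then show "(indicator K (\<chi> i. - f i) :: real) = indicator K (\<chi> i. f i)" by (simp add: indicator_def)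
next
  fix f g :: "'t \<Rightarrow> real" and l :: real assume l: "0 < l" "l < 1"
  have eq: "(\<chi> i. l * f i + (1 - l) * g i) = l *\<^sub>R (\<chi> i. f i) + (1 - l) *\<^sub>R (\<chi> i. g i)" by (simp add: vec_eq_iff)
  have "(\<chi> i. l * f i + (1 - l) * g i) \<in> K" if "(\<chi> i. f i) \<in> K" "(\<chi> i. g i) \<in> K"
    unfolding eq using l by (intro convexD[OF \<open>convex K\<close>] that) auto
  then show "indicator K (\<chi> i. f i) powr l * indicator K (\<chi> i. g i) powr (1 - l) \<le> (indicator K (\<chi> i. l * f i + (1 - l) * g i) :: real)"
    by (auto simp: indicator_def)
qed (auto simp: indicator_def)

text \<open>
  The variance \<open>2/\<pi>\<close> makes the value at 0 equal to the height 1/2 of the uniform density on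
  \<open>[-1, 1]\<close>, so the two densities cross only once.
\<close>

definition gauss_kernel :: "real \<Rightarrow> real" where
  "gauss_kernel s = exp (- (pi / 4) * s\<^sup>2) / 2"

definition unif_kernel :: "real \<Rightarrow> real \<Rightarrow> real" where
  "unif_kernel a s = indicator {- a <..< a} s / (2 * a)"

lemma gauss_kernel_eq_normal_density: "gauss_kernel = normal_density 0 (sqrt (2 / pi))"
proof
  fix s :: real
  have "sqrt (2 * pi * (2 / pi)) = 2" by (simp add: real_sqrt_unique)
  then show "gauss_kernel s = normal_density 0 (sqrt (2 / pi)) s"
    by (simp add: gauss_kernel_def normal_density_def field_simps)
qed

lemma sym_kernel_gauss: "sym_kernel gauss_kernel"
  unfolding sym_kernel_def
proof (intro conjI allI)
  show "log_conc_real gauss_kernel"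
    unfolding log_conc_real_def
  proof (intro conjI allI impI)
    fix x y l :: real assume l: "0 < l" "l < 1"
    \<comment> \<open>This quantity is exactly the gap in the convexity inequality for the
      square.\<close>
    have "0 \<le> l * (1 - l) * (x - y)\<^sup>2" using l by simp
    then have sq: "(l * x + (1 - l) * y)\<^sup>2 \<le> l * x\<^sup>2 + (1 - l) * y\<^sup>2"
      by (simp add: power2_eq_square algebra_simps)
    have half: "(1 / 2 :: real) powr l * (1 / 2) powr (1 - l) = 1 / 2" by (simp add: powr_add [symmetric])
    have "gauss_kernel x powr l * gauss_kernel y powr (1 - l)
        = (exp (- (pi / 4) * x\<^sup>2) * (1 / 2)) powr l * (exp (- (pi / 4) * y\<^sup>2) * (1 / 2)) powr (1 - l)"
      by (simp add: gauss_kernel_def)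
    also have "\<dots> = (exp (- (pi / 4) * x\<^sup>2) powr l * exp (- (pi / 4) * y\<^sup>2) powr (1 - l)) * ((1 / 2) powr l * (1 / 2) powr (1 - l))"
      by (subst (1 2) powr_mult) auto
    also have "\<dots> = exp (- (pi / 4) * (l * x\<^sup>2 + (1 - l) * y\<^sup>2)) / 2"
    proof -
      have "- (pi / 4) * x\<^sup>2 * l + - (pi / 4) * y\<^sup>2 * (1 - l) = - (pi / 4) * (l * x\<^sup>2 + (1 - l) * y\<^sup>2)"
        by (simp only: distrib_left ac_simps)
      then show ?thesis unfolding half by (simp only: exp_powr_real mult_exp_exp)
    qed
    also have "\<dots> \<le> gauss_kernel (l * x + (1 - l) * y)"
      unfolding gauss_kernel_def using sq by (simp add: mult_left_mono)
    finally show "gauss_kernel x powr l * gauss_kernel y powr (1 - l) \<le> gauss_kernel (l * x + (1 - l) * y)" .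
  qed (simp add: gauss_kernel_def)
  fix s :: real
  have "exp (- (pi / 4) * s\<^sup>2) \<le> 1" by simp
  then show "gauss_kernel s \<le> 1" unfolding gauss_kernel_def by linarith
  show "gauss_kernel (- s) = gauss_kernel s" by (simp add: gauss_kernel_def)
  show "integrable lborel gauss_kernel" "(LINT s|lborel. gauss_kernel s) = 1"
    unfolding gauss_kernel_eq_normal_density by simp_all
qed

text \<open>\<open>1 / 2 \<le> a\<close> keeps the height \<open>1 / (2 * a)\<close> within the
  bound 1 of \<open>sym_kernel\<close>; the half-width 1/2 used off \<open>S\<close> is the extreme
  case.\<close>

lemma sym_kernel_unif:
  assumes "1 / 2 \<le> a"
  shows "sym_kernel (unif_kernel a)"
  unfolding sym_kernel_def
proof (intro conjI allI)
  show "log_conc_real (unif_kernel a)"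
    unfolding log_conc_real_def
  proof (intro conjI allI impI)
    fix x y l :: real assume l: "0 < l" "l < 1"
    have "l * x + (1 - l) * y \<in> {- a <..< a}" if "x \<in> {- a <..< a}" "y \<in> {- a <..< a}"
      using convexD[OF convex_real_interval(8) that, of l "1 - l"] l by simp
    moreover have "(1 / (2 * a)) powr l * (1 / (2 * a)) powr (1 - l) = 1 / (2 * a)"
      using assms by (simp add: powr_add [symmetric])
    ultimately show "unif_kernel a x powr l * unif_kernel a y powr (1 - l) \<le> unif_kernel a (l * x + (1 - l) * y)"
      using assms by (auto simp: unif_kernel_def indicator_def)
  qed (use assms in \<open>simp add: unif_kernel_def\<close>)
  fix s :: real
  show "unif_kernel a s \<le> 1" using assms by (simp add: unif_kernel_def indicator_def)
  show "unif_kernel a (- s) = unif_kernel a s" by (auto simp: unif_kernel_def indicator_def)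
  show "integrable lborel (unif_kernel a)" "(LINT s|lborel. unif_kernel a s) = 1"
    using assms by (simp_all add: unif_kernel_def [abs_def])
qed

text \<open>The crossing points are the half-widths: inside, the uniform density is at least 1/2,
  the maximum of the Gaussian; outside, it is 0. Only coordinates in \<open>S\<close> contribute a
  density 1/2, the others having density 1 on their interval, whence the factor
  \<open>1 / 2 ^ card S\<close>.\<close>

lemma gauss_le_box_section:
  fixes K :: "(real^'t::finite) set"
  assumes K: "K \<in> sets borel" "convex K" "\<And>x. x \<in> K \<Longrightarrow> - x \<in> K"
  shows "(\<integral>\<^sup>+x. indicator K x * (\<Prod>i\<in>UNIV. ennreal (gauss_kernel (x $ i))) \<partial>lborel)
    \<le> ennreal (1 / 2 ^ card S) * emeasure lborel (K \<inter> {x. \<forall>i. \<bar>x $ i\<bar> < (if i \<in> S then 1 else 1 / 2)})"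
proof -
  define a where "a i = (if i \<in> S then 1 else 1 / 2 :: real)" for i :: 't
  define Q where "Q = {x :: real^'t. \<forall>i. \<bar>x $ i\<bar> < a i}"
  have Q[measurable]: "Q \<in> sets borel"
  proof -
    have "Q = box (\<chi> i. - a i) (\<chi> i. a i)" by (auto simp: Q_def mem_box_cart abs_less_iff) (smt (verit))+
    then show ?thesis by simp
  qed
  note [measurable] = K(1)
  have u: "sym_kernel (unif_kernel (a i))" for i by (rule sym_kernel_unif) (simp add: a_def)
  have g: "gauss_kernel s \<le> 1 / 2" for s by (simp add: gauss_kernel_def)
  have "(LINT x|PiM UNIV (\<lambda>j. density lborel gauss_kernel). indicator K (\<chi> i. x i))
     \<le> (LINT x|PiM UNIV (\<lambda>j. density lborel (unif_kernel (a j))). indicator K (\<chi> i. x i) :: real)"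
  proof (rule Kanter_comparison[OF u sym_kernel_gauss sym_log_conc_indicator, where a = a])
    fix j s
    show "gauss_kernel s \<le> unif_kernel (a j) s" if "\<bar>s\<bar> < a j"
      using that g[of s] by (auto simp: unif_kernel_def indicator_def a_def split: if_splits)
    show "unif_kernel (a j) s \<le> gauss_kernel s" if "a j \<le> \<bar>s\<bar>"
      using that by (auto simp: unif_kernel_def indicator_def gauss_kernel_def)
    show "0 \<le> a j" by (simp add: a_def)
  qed (use K in auto)
  then have "(\<integral>\<^sup>+x. indicator K x * (\<Prod>i\<in>UNIV. ennreal (gauss_kernel (x $ i))) \<partial>lborel)
     \<le> (\<integral>\<^sup>+x. indicator K x * (\<Prod>i\<in>UNIV. ennreal (unif_kernel (a i) (x $ i))) \<partial>lborel)"
    unfolding PiM_integral_indicator_vec[OF u K(1), symmetric] PiM_integral_indicator_vec[OF sym_kernel_gauss K(1), symmetric]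
    by (rule ennreal_leI)
  also have "\<dots> = (\<integral>\<^sup>+x. ennreal (1 / 2 ^ card S) * indicator (K \<inter> Q) x \<partial>lborel)"
  proof (rule nn_integral_cong)
    fix x :: "real^'t"
    have "(\<Prod>i\<in>UNIV. ennreal (unif_kernel (a i) (x $ i))) = ennreal (\<Prod>i\<in>UNIV. unif_kernel (a i) (x $ i))"
      by (rule prod_ennreal) (auto simp: unif_kernel_def a_def)
    also have "(\<Prod>i\<in>UNIV. unif_kernel (a i) (x $ i)) = (\<Prod>i\<in>UNIV. indicator {- a i <..< a i} (x $ i)) * (\<Prod>i\<in>UNIV. 1 / (2 * a i))"
      by (simp add: unif_kernel_def prod.distrib [symmetric] del: prod_dividef)
    also have "(\<Prod>i\<in>UNIV. indicator {- a i <..< a i} (x $ i)) = (indicator Q x :: real)"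
    proof (cases "x \<in> Q")
      case True
      then have "x $ i \<in> {- a i <..< a i}" for i by (auto simp: Q_def abs_less_iff minus_less_iff)
      then show ?thesis using True by (simp del: greaterThanLessThan_iff)
    next
      case False
      then obtain i where "x $ i \<notin> {- a i <..< a i}" by (auto simp: Q_def abs_less_iff minus_less_iff)
      then have "(\<Prod>i\<in>UNIV. indicator {- a i <..< a i} (x $ i)) = (0::real)"
        by (intro prod_zero) (auto intro!: bexI[of _ i] simp: indicator_def)
      then show ?thesis using False by simp
    qed
    also have "(\<Prod>i\<in>UNIV. 1 / (2 * a i)) = (\<Prod>i\<in>UNIV. if i \<in> S then 1 / 2 else 1)"
      by (intro prod.cong) (auto simp: a_def)
    also have "\<dots> = 1 / 2 ^ card S"
      by (simp add: prod.If_cases power_one_over)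
    finally show "indicator K x * (\<Prod>i\<in>UNIV. ennreal (unif_kernel (a i) (x $ i))) = ennreal (1 / 2 ^ card S) * indicator (K \<inter> Q) x"
      by (simp add: indicator_def)
  qed
  also have "\<dots> = ennreal (1 / 2 ^ card S) * emeasure lborel (K \<inter> Q)"
    by (rule nn_integral_cmult_indicator) simp
  finally show ?thesis unfolding Q_def a_def .
qed

section \<open>Pigeonhole bound for sections of a box\<close>

lemma det_in_Ints:
  fixes A :: "real^'n^'n"
  assumes "\<And>i j. A $ i $ j \<in> \<int>"
  shows "det A \<in> \<int>"
  unfolding det_def by (intro Ints_sum Ints_mult Ints_prod) (auto simp: assms)

text \<open>By Cramer's rule, multiplication by \<open>det M\<close> clears the denominators of
  \<open>g / N\<close>. These denominators divide \<open>N\<close>, which is coprime to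
  \<open>det M\<close>, so there are none.\<close>

lemma Ints_divide_of_mult_coprime:
  fixes M :: "real^'n^'n" and g :: "real^'n"
  assumes M: "\<And>i j. M $ i $ j \<in> \<int>" and D: "det M = of_int D" and cop: "coprime N D" and "N \<noteq> 0"
    and g: "\<And>i. g $ i \<in> \<int>" and Mg: "\<And>i. (M *v g) $ i / of_int N \<in> \<int>"
  shows "g $ k / of_int N \<in> \<int>"
proof -
  define x where "x = (1 / of_int N) *\<^sub>R g"
  have "(M *v x) $ i \<in> \<int>" for i
    using Mg[of i] by (simp add: x_def matrix_vector_mult_scaleR)
  then have "det (\<chi> i j. if j = k then (M *v x) $ i else M $ i $ j) \<in> \<int>"
    by (intro det_in_Ints) (auto simp: M)
  then have "x $ k * det M \<in> \<int>" by (simp only: cramer_lemma)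
  then obtain m where m: "x $ k * det M = of_int m" by (elim Ints_cases)
  obtain c where c: "g $ k = of_int c" using g[of k] by (elim Ints_cases)
  have "of_int (c * D) = (of_int (m * N) :: real)"
    using m \<open>N \<noteq> 0\<close> by (simp add: x_def c D field_simps)
  then have "c * D = m * N" by (simp only: of_int_eq_iff)
  then have "N dvd c * D" by simp
  then have "N dvd c" using cop by (simp add: coprime_dvd_mult_left_iff)
  then obtain e where "c = N * e" by (elim dvdE)
  then show ?thesis using \<open>N \<noteq> 0\<close> by (simp add: c)
qed

lemma card_int_interval_le:
  fixes z R :: real
  assumes "0 \<le> R"
  shows "real (card {\<lceil>z - R\<rceil> .. \<lfloor>z + R\<rfloor>}) \<le> 2 * R + 1"
proof -
  have "real_of_int (\<lfloor>z + R\<rfloor> - \<lceil>z - R\<rceil> + 1) \<le> 2 * R + 1" by linarith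
  then show ?thesis using assms by (simp add: of_nat_nat)
qed

text \<open>
  Since \<open>N\<close> is coprime to \<open>det M\<close>, the vector \<open>M q\<close> modulo \<open>N\<close> determines \<open>q\<close> modulo \<open>N\<close>. Two points of
  \<open>G\<close> with equal coordinates of \<open>M q\<close> in \<open>I\<close>, and congruent ones elsewhere, thus differ by
  \<open>N\<close> times one of the excluded relations \<open>y\<close>.
\<close>

lemma card_strip_grid_le:
  fixes M :: "real^'t^'t" and N :: int and z :: "'t \<Rightarrow> real"
  assumes M: "\<And>i j. M $ i $ j \<in> \<int>" and D: "det M = of_int D" and cop: "coprime N D" and N: "N > 0"
    and inj: "\<And>y :: real^'t. (\<And>i. y $ i \<in> {-1, 0, 1}) \<Longrightarrow> (\<And>i. i \<notin> S \<Longrightarrow> y $ i = 0) \<Longrightarrow>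
      (\<And>i. i \<in> I \<Longrightarrow> (M *v y) $ i = 0) \<Longrightarrow> y = 0"
    and R: "0 \<le> R"
    and G: "G \<subseteq> {q. \<forall>i. 0 \<le> q i \<and> q i < (if i \<in> S then 2 else 1) * N}"
      "\<And>q i. q \<in> G \<Longrightarrow> i \<in> I \<Longrightarrow> \<bar>(M *v (\<chi> j. of_int (q j))) $ i - z i\<bar> \<le> R"
  shows "finite G" "real (card G) \<le> (2 * R + 1) ^ card I * of_int N ^ (CARD('t) - card I)"
proof -
  have Mq: "(M *v (\<chi> j. of_int (q j))) $ i \<in> \<int>" for q :: "'t \<Rightarrow> int" and i
    unfolding matrix_vector_mult_def by (auto intro!: Ints_sum Ints_mult M)
  define w where "w q i = \<lfloor>(M *v (\<chi> j. of_int (q j))) $ i\<rfloor>" for q :: "'t \<Rightarrow> int" and i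
  have w: "of_int (w q i) = (M *v (\<chi> j. of_int (q j))) $ i" for q i
    using Mq[of q i] by (auto simp: w_def elim: Ints_cases)
  define T where "T i = (if i \<in> I then {\<lceil>z i - R\<rceil> .. \<lfloor>z i + R\<rfloor>} else {0..<N})" for i
  define \<Phi> where "\<Phi> q = (\<lambda>i. if i \<in> I then w q i else w q i mod N)" for q
  have "inj_on \<Phi> G"
  proof (rule inj_onI)
    fix q q' assume q: "q \<in> G" "q' \<in> G" and eq: "\<Phi> q = \<Phi> q'"
    define g :: "real^'t" where "g = (\<chi> j. of_int (q j)) - (\<chi> j. of_int (q' j))"
    have Mg: "(M *v g) $ i = of_int (w q i - w q' i)" for i
      by (simp add: g_def matrix_vector_mult_diff_distrib w)
    have dvd: "N dvd w q i - w q' i" for i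
      using fun_cong[OF eq, of i] by (auto simp: \<Phi>_def mod_eq_dvd_iff split: if_splits)
    have "(M *v g) $ i / of_int N \<in> \<int>" for i
    proof -
      obtain e where "w q i - w q' i = N * e" using dvd[of i] by (elim dvdE)
      then have "(M *v g) $ i / of_int N = of_int e" using N by (simp only: Mg) simp
      then show ?thesis by simp
    qed
    from Ints_divide_of_mult_coprime[OF M D cop _ _ this]
    have gN: "g $ k / of_int N \<in> \<int>" for k using N by (simp add: g_def)
    define y where "y = (1 / of_int N) *\<^sub>R g"
    have bound: "\<bar>g $ i\<bar> < (if i \<in> S then 2 else 1) * of_int N" for i
    proof -
      have "\<bar>q i - q' i\<bar> < (if i \<in> S then 2 else 1) * N"
      proof -
        have "0 \<le> q i" "q i < (if i \<in> S then 2 else 1) * N" "0 \<le> q' i" "q' i < (if i \<in> S then 2 else 1) * N"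
          using q G(1) by blast+
        then show ?thesis by linarith
      qed
      then have "real_of_int \<bar>q i - q' i\<bar> < of_int ((if i \<in> S then 2 else 1) * N)" by (simp only: of_int_less_iff)
      then show ?thesis by (simp add: g_def split: if_splits)
    qed
    \<comment> \<open>The ranges of \<open>q\<close> are half-open, so the bounds are strict: an
      integer of absolute value below 2 is -1, 0 or 1, and one below 1 is 0.\<close>
    have yb: "y $ i \<in> \<int>" "\<bar>y $ i\<bar> < (if i \<in> S then 2 else 1)" for i
      using gN[of i] bound[of i] N by (auto simp: y_def abs_mult field_simps split: if_splits)
    have "y = 0"
    proof (rule inj)
      fix i
      obtain c where c: "y $ i = of_int c" using yb(1)[of i] by (elim Ints_cases)
      have "\<bar>c\<bar> < (if i \<in> S then 2 else 1)"
      proof -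
        have "real_of_int \<bar>c\<bar> < of_int (if i \<in> S then 2 else 1)" using yb(2)[of i] c by (simp split: if_splits)
        then show ?thesis by (simp only: of_int_less_iff)
      qed
      then have "c \<in> {-1, 0, 1}" "i \<notin> S \<longrightarrow> c = 0" by (auto split: if_splits)
      then show "y $ i \<in> {-1, 0, 1}" and "i \<notin> S \<Longrightarrow> y $ i = 0" using c by auto
    next
      fix i assume "i \<in> I"
      then have "w q i = w q' i" using fun_cong[OF eq, of i] by (simp add: \<Phi>_def)
      then show "(M *v y) $ i = 0" by (simp add: y_def matrix_vector_mult_scaleR Mg)
    qed
    then have "g = 0" using N by (simp add: y_def)
    then show "q = q'" by (auto simp: g_def vec_eq_iff)
  qed
  moreover have "\<Phi> ` G \<subseteq> PiE UNIV T"
  proof (rule image_subsetI, rule PiE_I)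
    fix q i assume q: "q \<in> G"
    show "\<Phi> q i \<in> T i"
    proof (cases "i \<in> I")
      case True
      then have "\<bar>of_int (w q i) - z i\<bar> \<le> R" using G(2)[OF q True] by (simp add: w)
      then have "z i - R \<le> of_int (w q i)" "of_int (w q i) \<le> z i + R" by (auto simp: abs_le_iff)
      then have "\<lceil>z i - R\<rceil> \<le> w q i" "w q i \<le> \<lfloor>z i + R\<rfloor>" by (simp_all add: ceiling_le_iff le_floor_iff)
      then show ?thesis using True by (simp add: \<Phi>_def T_def)
    next
      case False
      then show ?thesis using N by (simp add: \<Phi>_def T_def)
    qed
  qed auto
  moreover have fT: "finite (PiE UNIV T)" by (intro finite_PiE) (auto simp: T_def)
  ultimately have "finite G" "card G \<le> card (PiE UNIV T)"
    by (metis finite_imageD finite_subset, metis card_inj_on_le)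
  then show "finite G" by simp
  have "real (card (PiE UNIV T)) = (\<Prod>i\<in>UNIV. real (card (T i)))"
    by (simp add: card_PiE)
  also have "\<dots> \<le> (\<Prod>i\<in>UNIV. if i \<in> I then 2 * R + 1 else of_int N)"
    using N card_int_interval_le[OF R] by (intro prod_mono) (auto simp: T_def)
  also have "\<dots> = (2 * R + 1) ^ card I * of_int N ^ (CARD('t) - card I)"
    by (simp add: prod.If_cases card_Diff_subset Compl_eq_Diff_UNIV)
  finally show "real (card G) \<le> (2 * R + 1) ^ card I * of_int N ^ (CARD('t) - card I)"
    using \<open>card G \<le> card (PiE UNIV T)\<close> by linarith
qed

text \<open>The set is covered by cubes of side \<open>1 / N\<close> whose lower corners, scaled by
  \<open>N\<close>, are counted by \<open>card_strip_grid_le\<close>. Rounding a point to its corner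
  moves each coordinate of the scaled image by at most \<open>C\<close>, so the strip of radius
  \<open>N * \<epsilon>\<close> is widened to \<open>N * \<epsilon> + C\<close>. After division by
  the number of cubes per unit volume, this costs only a term of order \<open>1 / N\<close>.\<close>

lemma measure_strip_le_grid:
  fixes M :: "real^'t^'t" and N :: int and z :: "'t \<Rightarrow> real"
  assumes M: "\<And>i j. M $ i $ j \<in> \<int>" and D: "det M = of_int D" and cop: "coprime N D" and N: "N > 0"
    and inj: "\<And>y :: real^'t. (\<And>i. y $ i \<in> {-1, 0, 1}) \<Longrightarrow> (\<And>i. i \<notin> S \<Longrightarrow> y $ i = 0) \<Longrightarrow>
      (\<And>i. i \<in> I \<Longrightarrow> (M *v y) $ i = 0) \<Longrightarrow> y = 0"
    and \<epsilon>: "0 \<le> \<epsilon>" and C: "C = (\<Sum>i\<in>UNIV. \<Sum>j\<in>UNIV. \<bar>M $ i $ j\<bar>)"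
  shows "emeasure lborel {x. (\<forall>i. 0 \<le> x $ i \<and> x $ i < (if i \<in> S then 2 else 1)) \<and> (\<forall>i\<in>I. \<bar>(M *v x) $ i - z i\<bar> \<le> \<epsilon>)}
    \<le> ennreal ((2 * \<epsilon> + (2 * C + 1) / of_int N) ^ card I)"
proof -
  define X where "X = {x. (\<forall>i. 0 \<le> x $ i \<and> x $ i < (if i \<in> S then 2 else 1)) \<and> (\<forall>i\<in>I. \<bar>(M *v x) $ i - z i\<bar> \<le> \<epsilon>)}"
  define G where "G = {q. (\<forall>i. 0 \<le> q i \<and> q i < (if i \<in> S then 2 else 1) * N) \<and>
    (\<forall>i\<in>I. \<bar>(M *v (\<chi> j. of_int (q j))) $ i - of_int N * z i\<bar> \<le> of_int N * \<epsilon> + C)}"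
  have C0: "0 \<le> C" unfolding C by (intro sum_nonneg) auto
  have R: "0 \<le> of_int N * \<epsilon> + C" using N \<epsilon> C0 by simp
  have Gsub: "G \<subseteq> {q. \<forall>i. 0 \<le> q i \<and> q i < (if i \<in> S then 2 else 1) * N}"
    unfolding G_def by blast
  have Gstrip: "\<bar>(M *v (\<chi> j. of_int (q j))) $ i - of_int N * z i\<bar> \<le> of_int N * \<epsilon> + C" if "q \<in> G" "i \<in> I" for q i
    using that unfolding G_def by blast
  note G = card_strip_grid_le[OF M D cop N inj R Gsub Gstrip]
  define Q :: "('t \<Rightarrow> int) \<Rightarrow> (real^'t) set" where
    "Q q = cbox (\<chi> i. of_int (q i) / of_int N) (\<chi> i. (of_int (q i) + 1) / of_int N)" for q
  have "X \<subseteq> (\<Union>q\<in>G. Q q)"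
  proof
    fix x assume x: "x \<in> X"
    define q where "q i = \<lfloor>of_int N * x $ i\<rfloor>" for i
    have fl: "of_int (q i) \<le> of_int N * x $ i" "of_int N * x $ i < of_int (q i) + 1" for i
      unfolding q_def by linarith+
    have "q \<in> G"
      unfolding G_def
    proof (intro CollectI conjI allI ballI)
      fix i
      have xi: "0 \<le> x $ i" "x $ i < (if i \<in> S then 2 else 1)" using x by (auto simp: X_def)
      show "0 \<le> q i" unfolding q_def using xi N by simp
      have "of_int N * x $ i < of_int N * (if i \<in> S then 2 else 1)" using xi N by (intro mult_strict_left_mono) auto
      then have "real_of_int (q i) < of_int ((if i \<in> S then 2 else 1) * N)"
        using fl(1)[of i] by (simp split: if_splits)
      then show "q i < (if i \<in> S then 2 else 1) * N" by (simp only: of_int_less_iff)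
    next
      fix i assume i: "i \<in> I"
      have "\<bar>(M *v (\<chi> j. of_int (q j))) $ i - of_int N * (M *v x) $ i\<bar> = \<bar>\<Sum>j\<in>UNIV. M $ i $ j * (of_int (q j) - of_int N * x $ j)\<bar>"
        by (simp add: matrix_vector_mult_def sum_distrib_left sum_subtractf [symmetric] algebra_simps)
      also have "\<dots> \<le> (\<Sum>j\<in>UNIV. \<bar>M $ i $ j * (of_int (q j) - of_int N * x $ j)\<bar>)" by (rule sum_abs)
      also have "\<dots> \<le> (\<Sum>j\<in>UNIV. \<bar>M $ i $ j\<bar>)"
      proof (rule sum_mono)
        fix j
        have "\<bar>of_int (q j) - of_int N * x $ j\<bar> \<le> 1" using fl[of j] by linarith
        then show "\<bar>M $ i $ j * (of_int (q j) - of_int N * x $ j)\<bar> \<le> \<bar>M $ i $ j\<bar>"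
          by (simp add: abs_mult mult_left_le)
      qed
      also have "\<dots> \<le> C" unfolding C by (rule member_le_sum) (auto intro: sum_nonneg)
      finally have 1: "\<bar>(M *v (\<chi> j. of_int (q j))) $ i - of_int N * (M *v x) $ i\<bar> \<le> C" .
      have "\<bar>of_int N * (M *v x) $ i - of_int N * z i\<bar> = of_int N * \<bar>(M *v x) $ i - z i\<bar>"
        using N by (simp add: abs_mult flip: right_diff_distrib)
      also have "\<dots> \<le> of_int N * \<epsilon>" using x i N by (intro mult_left_mono) (auto simp: X_def)
      finally show "\<bar>(M *v (\<chi> j. of_int (q j))) $ i - of_int N * z i\<bar> \<le> of_int N * \<epsilon> + C" using 1 by linarith
    qed
    moreover have "x \<in> Q q"
      using fl N by (auto simp: Q_def mem_box_cart field_simps less_imp_le)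
    ultimately show "x \<in> (\<Union>q\<in>G. Q q)" by auto
  qed
  moreover have Qm: "Q q \<in> sets lborel" for q by (simp add: Q_def)
  ultimately have "emeasure lborel X \<le> emeasure lborel (\<Union>q\<in>G. Q q)"
    by (intro emeasure_mono sets.finite_UN[OF G(1)])
  also have "\<dots> \<le> (\<Sum>q\<in>G. emeasure lborel (Q q))"
    by (rule emeasure_subadditive_finite[OF G(1)]) (use Qm in auto)
  also have "\<dots> = (\<Sum>q\<in>G. ennreal ((1 / of_int N) ^ CARD('t)))"
  proof (rule sum.cong[OF refl])
    fix q assume "q \<in> G"
    have "(\<chi> i. of_int (q i) / of_int N) \<in> Q q" using N by (simp add: Q_def mem_box_cart divide_right_mono)
    then have ne: "Q q \<noteq> {}" by auto
    have "emeasure lborel (Q q) = ennreal (measure lborel (Q q))"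
      unfolding Q_def by (rule emeasure_eq_ennreal_measure) (simp add: emeasure_lborel_cbox_eq)
    also have "measure lborel (Q q) = (\<Prod>i\<in>UNIV. (of_int (q i) + 1) / of_int N - of_int (q i) / of_int N)"
      using content_cbox_cart[OF ne[unfolded Q_def]] unfolding Q_def by simp
    also have "\<dots> = (1 / of_int N) ^ CARD('t)" by (simp add: diff_divide_distrib [symmetric])
    finally show "emeasure lborel (Q q) = ennreal ((1 / of_int N) ^ CARD('t))" .
  qed
  also have "\<dots> = ennreal (real (card G)) * ennreal ((1 / of_int N) ^ CARD('t))"
    by (subst sum_constant, subst ennreal_of_nat_eq_real_of_nat) (rule refl)
  also have "\<dots> = ennreal (real (card G) * (1 / of_int N) ^ CARD('t))"
    by (rule ennreal_mult'[symmetric]) (rule of_nat_0_le_iff)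
  also have "\<dots> \<le> ennreal ((2 * (of_int N * \<epsilon> + C) + 1) ^ card I * of_int N ^ (CARD('t) - card I) * (1 / of_int N) ^ CARD('t))"
  proof (rule ennreal_leI, rule mult_right_mono[OF G(2)])
    have "0 \<le> 1 / real_of_int N" using N by simp
    then show "0 \<le> (1 / real_of_int N) ^ CARD('t)" by (rule zero_le_power)
  qed
  also have "(2 * (of_int N * \<epsilon> + C) + 1) ^ card I * of_int N ^ (CARD('t) - card I) * (1 / of_int N) ^ CARD('t)
     = (2 * \<epsilon> + (2 * C + 1) / of_int N) ^ card I"
  proof -
    have cI: "card I \<le> CARD('t)" by (rule card_mono) auto
    define n where "n = (of_int N :: real)"
    have n: "n > 0" using N by (simp add: n_def)
    have e: "(1 / n) ^ CARD('t) = (1 / n) ^ card I * (1 / n) ^ (CARD('t) - card I)"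
      using cI by (simp add: power_add [symmetric])
    have "(2 * (n * \<epsilon> + C) + 1) ^ card I * n ^ (CARD('t) - card I) * (1 / n) ^ CARD('t)
      = ((2 * (n * \<epsilon> + C) + 1) ^ card I * (1 / n) ^ card I) * (n ^ (CARD('t) - card I) * (1 / n) ^ (CARD('t) - card I))"
      unfolding e by (simp only: ac_simps)
    also have "\<dots> = ((2 * (n * \<epsilon> + C) + 1) * (1 / n)) ^ card I * (n * (1 / n)) ^ (CARD('t) - card I)"
      by (simp only: power_mult_distrib)
    also have "(2 * (n * \<epsilon> + C) + 1) * (1 / n) = 2 * \<epsilon> + (2 * C + 1) / n" using n by (simp add: field_simps)
    finally show ?thesis using n by (simp add: n_def)
  qed
  finally show ?thesis unfolding X_def .
qed

text \<open>The grid estimate is used with mesh tending to 0. It is stated for a box with corner 0,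
  so the symmetric box is first translated by its half-widths \<open>c\<close>, which moves the
  centre of the strip to \<open>M *v c\<close>.\<close>

lemma measure_strip_le:
  fixes M :: "real^'t^'t" and z :: "'t \<Rightarrow> real"
  assumes M: "\<And>i j. M $ i $ j \<in> \<int>" and D: "det M \<noteq> 0"
    and inj: "\<And>y :: real^'t. (\<And>i. y $ i \<in> {-1, 0, 1}) \<Longrightarrow> (\<And>i. i \<notin> S \<Longrightarrow> y $ i = 0) \<Longrightarrow>
      (\<And>i. i \<in> I \<Longrightarrow> (M *v y) $ i = 0) \<Longrightarrow> y = 0"
    and \<epsilon>: "0 \<le> \<epsilon>"
  shows "emeasure lborel ({x. \<forall>i\<in>I. \<bar>(M *v x) $ i\<bar> \<le> \<epsilon>} \<inter> {x. \<forall>i. \<bar>x $ i\<bar> < (if i \<in> S then 1 else 1 / 2)})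
    \<le> ennreal ((2 * \<epsilon>) ^ card I)"
proof -
  define c :: "real^'t" where "c = (\<chi> i. if i \<in> S then 1 else 1 / 2)"
  define C where "C = (\<Sum>i\<in>UNIV. \<Sum>j\<in>UNIV. \<bar>M $ i $ j\<bar>)"
  define X where "X = {x. (\<forall>i. 0 \<le> x $ i \<and> x $ i < (if i \<in> S then 2 else 1)) \<and> (\<forall>i\<in>I. \<bar>(M *v x) $ i - (M *v c) $ i\<bar> \<le> \<epsilon>)}"
  define Y where "Y = {x. \<forall>i\<in>I. \<bar>(M *v x) $ i\<bar> \<le> \<epsilon>} \<inter> {x :: real^'t. \<forall>i. \<bar>x $ i\<bar> < (if i \<in> S then 1 else 1 / 2)}"
  obtain D where D': "det M = of_int D" using det_in_Ints[OF M] by (elim Ints_cases)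
  have "D \<noteq> 0" using D D' by auto
  have cont: "continuous_on UNIV (\<lambda>x::real^'t. (M *v x) $ i)" for i
    by (intro linear_continuous_on bounded_linear_compose[OF bounded_linear_vec_nth matrix_vector_mul_bounded_linear])
  have Xm: "X \<in> sets borel"
  proof -
    have eq: "X = (\<Inter>i\<in>UNIV. {x. 0 \<le> x $ i \<and> x $ i < (if i \<in> S then 2 else 1)}) \<inter> (\<Inter>i\<in>I. {x. \<bar>(M *v x) $ i - (M *v c) $ i\<bar> \<le> \<epsilon>})"
      unfolding X_def by blast
    have m[measurable]: "(\<lambda>x::real^'t. x $ i) \<in> borel_measurable borel" "(\<lambda>x::real^'t. (M *v x) $ i) \<in> borel_measurable borel" for i
      by (intro borel_measurable_continuous_onI continuous_intros cont)+
    have 1: "{x::real^'t. 0 \<le> x $ i \<and> x $ i < r} \<in> sets borel" for i r by measurable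
    have 2: "{x::real^'t. \<bar>(M *v x) $ i - r\<bar> \<le> \<epsilon>} \<in> sets borel" for i r by measurable
    have 3: "(\<Inter>i\<in>I. {x::real^'t. \<bar>(M *v x) $ i - (M *v c) $ i\<bar> \<le> \<epsilon>}) \<in> sets borel"
      by (cases "I = {}") (auto intro!: sets.finite_INT 2)
    show ?thesis unfolding eq by (intro sets.Int 3 sets.finite_INT 1) auto
  qed
  have "Y \<subseteq> (\<lambda>x. c + x) -` X"
  proof
    fix x assume x: "x \<in> Y"
    have "0 \<le> (c + x) $ i \<and> (c + x) $ i < (if i \<in> S then 2 else 1)" for i
    proof -
      have "\<bar>x $ i\<bar> < (if i \<in> S then 1 else 1 / 2)" using x by (simp add: Y_def)
      then show ?thesis by (auto simp: c_def abs_less_iff split: if_splits)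
    qed
    moreover have "\<bar>(M *v (c + x)) $ i - (M *v c) $ i\<bar> \<le> \<epsilon>" if "i \<in> I" for i
      using x that by (simp add: Y_def matrix_vector_right_distrib)
    ultimately show "x \<in> (\<lambda>x. c + x) -` X" by (simp add: X_def)
  qed
  moreover have "(\<lambda>x. c + x) -` X \<in> sets lborel"
    using Xm measurable_sets[of "(+) c" borel borel X] by simp
  ultimately have "emeasure lborel Y \<le> emeasure lborel ((\<lambda>x. c + x) -` X)"
    by (rule emeasure_mono)
  also have "\<dots> = emeasure (distr lborel borel ((+) c)) X"
    using Xm by (subst emeasure_distr) auto
  also have "\<dots> = emeasure lborel X" by (simp add: lborel_distr_plus)
  finally have YX: "emeasure lborel Y \<le> emeasure lborel X" .
  \<comment> \<open>One more than a multiple of \<open>D\<close> is coprime to \<open>D\<close>,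
    which gives arbitrarily large admissible values of \<open>N\<close>.\<close>
  have bd: "emeasure lborel X \<le> ennreal ((2 * \<epsilon> + (2 * C + 1) / of_int (\<bar>D\<bar> * int n + 1)) ^ card I)" for n
    unfolding X_def
  proof (rule measure_strip_le_grid[OF M D' _ _ inj \<epsilon> C_def])
    show "coprime (\<bar>D\<bar> * int n + 1) D"
    proof (rule coprimeI)
      fix c assume c: "c dvd \<bar>D\<bar> * int n + 1" "c dvd D"
      then have "c dvd \<bar>D\<bar> * int n" by simp
      with c(1) show "is_unit c" using dvd_add_right_iff by blast
    qed
    have "0 \<le> \<bar>D\<bar> * int n" by simp
    then show "\<bar>D\<bar> * int n + 1 > 0" by linarith
  qed
  have "filterlim (\<lambda>n. real_of_int (\<bar>D\<bar> * int n + 1)) at_top sequentially"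
  proof (rule filterlim_at_top_mono[OF filterlim_real_sequentially])
    have "int n \<le> \<bar>D\<bar> * int n + 1" for n
    proof -
      have "1 * int n \<le> \<bar>D\<bar> * int n" using \<open>D \<noteq> 0\<close> by (intro mult_right_mono) auto
      then show ?thesis by linarith
    qed
    then show "\<forall>\<^sub>F n in sequentially. real n \<le> real_of_int (\<bar>D\<bar> * int n + 1)"
      by (intro always_eventually allI) (metis of_int_le_iff of_int_of_nat_eq)
  qed
  then have "(\<lambda>n. (2 * C + 1) / of_int (\<bar>D\<bar> * int n + 1)) \<longlonglongrightarrow> 0"
    by (rule tendsto_divide_0[OF tendsto_const filterlim_at_top_imp_at_infinity])
  then have "(\<lambda>n. (2 * \<epsilon> + (2 * C + 1) / of_int (\<bar>D\<bar> * int n + 1)) ^ card I) \<longlonglongrightarrow> (2 * \<epsilon> + 0) ^ card I"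
    by (intro tendsto_intros)
  then have "(\<lambda>n. ennreal ((2 * \<epsilon> + (2 * C + 1) / of_int (\<bar>D\<bar> * int n + 1)) ^ card I)) \<longlonglongrightarrow> ennreal ((2 * \<epsilon>) ^ card I)"
    by (intro tendsto_ennrealI) simp
  then have "emeasure lborel X \<le> ennreal ((2 * \<epsilon>) ^ card I)"
    by (rule LIMSEQ_le_const) (use bd in auto)
  then show ?thesis using YX unfolding Y_def by (rule order_trans[rotated])
qed

section \<open>Gaussian measure of a strip\<close>

text \<open>Leibniz sums over index sets in bijection agree. This serves twice: to rename the index
  type of \<open>det\<close>, and to identify \<open>det\<close> with
  \<open>Determinant.det\<close>, whose indices are natural numbers.\<close>

lemma sum_permutes_reindex:
  fixes a :: "'b \<Rightarrow> 'b \<Rightarrow> 'c::comm_ring_1"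
  assumes e: "bij_betw e S T" and fin: "finite S"
  shows "(\<Sum>p | p permutes S. of_int (sign p) * (\<Prod>i\<in>S. a (e i) (e (p i))))
    = (\<Sum>q | q permutes T. of_int (sign q) * (\<Prod>j\<in>T. a j (q j)))"
proof -
  have inj: "inj_on e S" using e by (rule bij_betw_imp_inj_on)
  have img: "e ` S = T" using e by (rule bij_betw_imp_surj_on)
  have "bij_betw (map_permutation S e) {p. p permutes S} {q. q permutes T}"
  proof (rule bij_betw_byWitness[where f' = "map_permutation T (inv_into S e)"])
    show "\<forall>p\<in>{p. p permutes S}. map_permutation T (inv_into S e) (map_permutation S e p) = p"
      using map_permutation_compose_inv[OF e] inj by (auto simp: inv_into_f_f)
    show "\<forall>q\<in>{q. q permutes T}. map_permutation S e (map_permutation T (inv_into S e) q) = q"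
      using map_permutation_compose_inv[OF bij_betw_inv_into[OF e]] img by (auto simp: f_inv_into_f)
    show "map_permutation S e ` {p. p permutes S} \<subseteq> {q. q permutes T}"
      using map_permutation_permutes[OF e] by auto
    show "map_permutation T (inv_into S e) ` {q. q permutes T} \<subseteq> {p. p permutes S}"
      using map_permutation_permutes[OF bij_betw_inv_into[OF e]] by auto
  qed
  then have "(\<Sum>q | q permutes T. of_int (sign q) * (\<Prod>j\<in>T. a j (q j)))
    = (\<Sum>p | p permutes S. of_int (sign (map_permutation S e p)) * (\<Prod>j\<in>T. a j (map_permutation S e p j)))"
    by (rule sum.reindex_bij_betw[symmetric])
  also have "\<dots> = (\<Sum>p | p permutes S. of_int (sign p) * (\<Prod>i\<in>S. a (e i) (e (p i))))"
  proof (rule sum.cong[OF refl])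
    fix p assume "p \<in> {p. p permutes S}"
    then have p: "p permutes S" by simp
    have "(\<Prod>j\<in>T. a j (map_permutation S e p j)) = (\<Prod>i\<in>S. a (e i) (map_permutation S e p (e i)))"
      by (rule prod.reindex_bij_betw[OF e, symmetric])
    also have "\<dots> = (\<Prod>i\<in>S. a (e i) (e (p i)))"
      using map_permutation_apply[OF inj] by (intro prod.cong refl) simp
    moreover have "sign (map_permutation S e p) = sign p"
      using sign_map_permutation[OF inj p fin] by simp
    ultimately show "of_int (sign (map_permutation S e p)) * (\<Prod>j\<in>T. a j (map_permutation S e p j))
      = of_int (sign p) * (\<Prod>i\<in>S. a (e i) (e (p i)))" by simp
  qed
  finally show ?thesis by simp
qed

section \<open>Linear change of variables for Lebesgue measure\<close>

lemma det_reindex: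
  fixes A :: "'c::comm_ring_1^'n^'n" and e :: "'m::finite \<Rightarrow> 'n"
  assumes "bij e"
  shows "det (\<chi> i j. A $ e i $ e j) = det A"
  using sum_permutes_reindex[of e UNIV UNIV "\<lambda>i j. A $ i $ j"] assms by (simp add: det_def)

lemma lborel_vec_reindex:
  fixes e :: "'m::finite \<Rightarrow> 'n::finite"
  assumes "bij e"
  shows "(lborel :: (real^'m) measure) = distr (lborel :: (real^'n) measure) borel (\<lambda>x. \<chi> i. x $ e i)"
proof (rule lborel_eqI)
  have m[measurable]: "(\<lambda>x::real^'n. \<chi> i. x $ e i) \<in> borel_measurable borel"
    by (intro borel_measurable_continuous_onI continuous_on_vec_lambda continuous_intros)
  fix l u :: "real^'m"
  assume le: "\<And>b. b \<in> Basis \<Longrightarrow> l \<bullet> b \<le> u \<bullet> b"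
  have le': "l $ i \<le> u $ i" for i using le[of "axis i 1"] by (simp add: inner_axis axis_in_Basis_iff)
  define l' u' :: "real^'n" where "l' = (\<chi> j. l $ (inv_into UNIV e j))" and "u' = (\<chi> j. u $ (inv_into UNIV e j))"
  have ei: "inv_into UNIV e (e i) = i" "e (inv_into UNIV e j) = j" for i j
    using assms by (simp_all add: bij_is_inj bij_is_surj surj_f_inv_f)
  have "(\<lambda>x::real^'n. \<chi> i. x $ e i) -` box l u = box l' u'"
    by (auto simp: mem_box_cart l'_def u'_def) (metis ei)+
  then have "emeasure (distr lborel borel (\<lambda>x::real^'n. \<chi> i. x $ e i)) (box l u) = emeasure lborel (box l' u')"
    by (subst emeasure_distr) auto
  also have "\<dots> = (\<Prod>b\<in>Basis. (u' - l') \<bullet> b)"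
  proof (rule emeasure_lborel_box)
    fix b :: "real^'n" assume "b \<in> Basis"
    then show "l' \<bullet> b \<le> u' \<bullet> b" using le' by (auto simp: Basis_vec_def inner_axis l'_def u'_def)
  qed
  also have "(\<Prod>b\<in>Basis. (u' - l') \<bullet> b) = (\<Prod>j\<in>UNIV. u $ (inv_into UNIV e j) - l $ (inv_into UNIV e j))"
    using prod_Basis_vec[of "\<lambda>s. s" "u' - l'"] by (simp add: l'_def u'_def)
  also have "\<dots> = (\<Prod>i\<in>UNIV. u $ i - l $ i)"
    using prod.reindex_bij_betw[of "inv_into UNIV e" UNIV UNIV "\<lambda>i. u $ i - l $ i"] assms by (simp add: bij_imp_bij_inv)
  also have "\<dots> = (\<Prod>b\<in>Basis. (u - l) \<bullet> b)"
    using prod_Basis_vec[of "\<lambda>s. s" "u - l"] by simp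
  finally show "emeasure (distr lborel borel (\<lambda>x::real^'n. \<chi> i. x $ e i)) (box l u) = (\<Prod>b\<in>Basis. (u - l) \<bullet> b)" .
qed simp

text \<open>
  The library computes the measure of a linear image only for well-ordered index types.
\<close>

typedef (overloaded) 'a ordered_copy = "{..<CARD('a::finite)}"
  by (rule exI[of _ 0]) simp

instance ordered_copy :: (finite) finite
proof
  have "(UNIV :: 'a ordered_copy set) \<subseteq> Abs_ordered_copy ` {..<CARD('a)}"
    by (metis Abs_ordered_copy_cases image_eqI subsetI)
  then show "finite (UNIV :: 'a ordered_copy set)" by (rule finite_subset) simp
qed

instantiation ordered_copy :: (finite) wellorder
begin

definition less_eq_ordered_copy :: "'a ordered_copy \<Rightarrow> 'a ordered_copy \<Rightarrow> bool" where
  "less_eq_ordered_copy x y \<longleftrightarrow> Rep_ordered_copy x \<le> Rep_ordered_copy y"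

definition less_ordered_copy :: "'a ordered_copy \<Rightarrow> 'a ordered_copy \<Rightarrow> bool" where
  "less_ordered_copy x y \<longleftrightarrow> Rep_ordered_copy x < Rep_ordered_copy y"

instance
proof
  fix P :: "'a ordered_copy \<Rightarrow> bool" and a
  assume step: "\<And>x. (\<And>y. y < x \<Longrightarrow> P y) \<Longrightarrow> P x"
  show "P a"
    by (induction a rule: measure_induct_rule[of Rep_ordered_copy]) (auto simp: less_ordered_copy_def intro: step)
qed (auto simp: less_eq_ordered_copy_def less_ordered_copy_def Rep_ordered_copy_inject)

end

lemma card_ordered_copy: "CARD('a::finite ordered_copy) = CARD('a)"
  using type_definition.card[OF type_definition_ordered_copy] by simp

lemma nn_integral_prod_vec:
  fixes h :: "'t::finite \<Rightarrow> real \<Rightarrow> ennreal"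
  assumes [measurable]: "\<And>i. h i \<in> borel_measurable borel"
  shows "(\<integral>\<^sup>+x. (\<Prod>i\<in>UNIV. h i (x $ i)) \<partial>lborel) = (\<Prod>i\<in>UNIV. \<integral>\<^sup>+s. h i s \<partial>lborel)"
proof -
  interpret L: product_sigma_finite "\<lambda>_::'t. lborel::real measure"
    by standard
  have m[measurable]: "(\<lambda>f. \<chi> i. f i) \<in> borel_measurable (PiM (UNIV::'t set) (\<lambda>_. lborel) :: ('t \<Rightarrow> real) measure)"
    by (rule borel_measurable_vec_lambda) simp
  have "(\<integral>\<^sup>+x. (\<Prod>i\<in>UNIV. h i (x $ i)) \<partial>lborel) = (\<integral>\<^sup>+f. (\<Prod>i\<in>UNIV. h i (f i)) \<partial>PiM UNIV (\<lambda>_. lborel))"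
    by (subst lborel_vec, subst nn_integral_distr[OF m]) auto
  also have "\<dots> = (\<Prod>i\<in>UNIV. \<integral>\<^sup>+s. h i s \<partial>lborel)"
    by (rule L.product_nn_integral_prod) auto
  finally show ?thesis .
qed

text \<open>The transformed measure is recognised as \<open>lborel\<close> by its values on boxes.
  The preimage of a box under \<open>A\<close> is its image under the inverse \<open>B\<close>,
  whose measure carries the factor \<open>\<bar>det B\<bar>\<close>; the density
  \<open>\<bar>det A\<bar>\<close> cancels it.\<close>

lemma nn_integral_lborel_matrix_wellorder:
  fixes A :: "real^'n::{finite,wellorder}^'n::{finite,wellorder}"
  assumes A: "det A \<noteq> 0" and [measurable]: "h \<in> borel_measurable borel"
  shows "(\<integral>\<^sup>+x. h x \<partial>lborel) = ennreal \<bar>det A\<bar> * (\<integral>\<^sup>+y. h (A *v y) \<partial>lborel)"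
proof -
  obtain B where AB: "A ** B = mat 1" "B ** A = mat 1"
    using A by (auto simp: invertible_det_nz [symmetric] invertible_def)
  have m[measurable]: "(\<lambda>y. A *v y) \<in> borel_measurable borel"
    by (intro borel_measurable_continuous_onI linear_continuous_on matrix_vector_mul_bounded_linear)
  have dAB: "\<bar>det A\<bar> * \<bar>det B\<bar> = 1" using AB(1) by (metis abs_1 abs_mult det_I det_mul)
  have "lborel = density (distr lborel borel (\<lambda>y. A *v y)) (\<lambda>_. ennreal \<bar>det A\<bar>)"
  proof (rule lborel_eqI)
    fix l u :: "real^'n::{finite,wellorder}"
    assume le: "\<And>b. b \<in> Basis \<Longrightarrow> l \<bullet> b \<le> u \<bullet> b"
    have pre: "(\<lambda>y. A *v y) -` box l u = (\<lambda>x. B *v x) ` box l u"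
    proof
      show "(\<lambda>y. A *v y) -` box l u \<subseteq> (\<lambda>x. B *v x) ` box l u"
        using AB by (auto intro!: image_eqI[of _ _ "A *v _"] simp: matrix_vector_mul_assoc)
      show "(\<lambda>x. B *v x) ` box l u \<subseteq> (\<lambda>y. A *v y) -` box l u"
        using AB by (auto simp: matrix_vector_mul_assoc)
    qed
    have meas: "measure lebesgue ((\<lambda>x. B *v x) ` box l u) = \<bar>det B\<bar> * measure lebesgue (box l u)"
      using measure_linear_image[of "\<lambda>x. B *v x" "box l u"] by simp
    have lm: "(\<lambda>x. B *v x) ` box l u \<in> lmeasurable"
      by (rule measurable_linear_image) auto
    have sb: "(\<lambda>x. B *v x) ` box l u \<in> sets borel"
      using measurable_sets[OF m, of "box l u"] pre by simp
    have "emeasure lborel ((\<lambda>x. B *v x) ` box l u) = emeasure lebesgue ((\<lambda>x. B *v x) ` box l u)"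
      using sb by simp
    also have "\<dots> = ennreal (\<bar>det B\<bar> * measure lebesgue (box l u))"
      unfolding meas[symmetric] using lm by (simp add: emeasure_eq_measure2)
    finally have eB: "emeasure lborel ((\<lambda>x. B *v x) ` box l u) = ennreal (\<bar>det B\<bar> * measure lebesgue (box l u))" .
    have "emeasure (density (distr lborel borel (\<lambda>y. A *v y)) (\<lambda>_. ennreal \<bar>det A\<bar>)) (box l u)
      = ennreal \<bar>det A\<bar> * emeasure (distr lborel borel (\<lambda>y. A *v y)) (box l u)"
      by (subst emeasure_density_const) auto
    also have "emeasure (distr lborel borel (\<lambda>y. A *v y)) (box l u) = emeasure lborel ((\<lambda>x. B *v x) ` box l u)"
      by (subst emeasure_distr) (auto simp: pre)
    also have "ennreal \<bar>det A\<bar> * emeasure lborel ((\<lambda>x. B *v x) ` box l u) = ennreal (measure lebesgue (box l u))"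
      unfolding eB by (subst ennreal_mult'[symmetric]) (auto simp: dAB mult.assoc[symmetric])
    also have "measure lebesgue (box l u) = (\<Prod>b\<in>Basis. (u - l) \<bullet> b)"
      using le by (simp add: measure_lborel_box_eq)
    finally show "emeasure (density (distr lborel borel (\<lambda>y. A *v y)) (\<lambda>_. ennreal \<bar>det A\<bar>)) (box l u)
      = (\<Prod>b\<in>Basis. (u - l) \<bullet> b)" .
  qed simp
  then have "(\<integral>\<^sup>+x. h x \<partial>lborel) = (\<integral>\<^sup>+x. h x \<partial>density (distr lborel borel (\<lambda>y. A *v y)) (\<lambda>_. ennreal \<bar>det A\<bar>))"
    by simp
  also have "\<dots> = (\<integral>\<^sup>+x. ennreal \<bar>det A\<bar> * h x \<partial>distr lborel borel (\<lambda>y. A *v y))"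
    by (rule nn_integral_density) auto
  also have "\<dots> = ennreal \<bar>det A\<bar> * (\<integral>\<^sup>+x. h x \<partial>distr lborel borel (\<lambda>y. A *v y))"
    by (rule nn_integral_cmult) auto
  also have "(\<integral>\<^sup>+x. h x \<partial>distr lborel borel (\<lambda>y. A *v y)) = (\<integral>\<^sup>+y. h (A *v y) \<partial>lborel)"
    by (rule nn_integral_distr) auto
  finally show ?thesis .
qed

text \<open>Renaming coordinates along \<open>e\<close> preserves Lebesgue measure, and renaming
  rows and columns alike preserves the determinant, so the ordered case carries over.\<close>

lemma nn_integral_lborel_matrix:
  fixes A :: "real^'n^'n"
  assumes A: "det A \<noteq> 0" and [measurable]: "h \<in> borel_measurable borel"
  shows "(\<integral>\<^sup>+x. h x \<partial>lborel) = ennreal \<bar>det A\<bar> * (\<integral>\<^sup>+y. h (A *v y) \<partial>lborel)"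
proof -
  obtain e :: "'n \<Rightarrow> 'n ordered_copy" where e: "bij e"
    using finite_same_card_bij[of "UNIV :: 'n set" "UNIV :: 'n ordered_copy set"] by (auto simp: card_ordered_copy)
  define e' where "e' = inv_into UNIV e"
  have e': "bij e'" using e by (simp add: e'_def bij_imp_bij_inv)
  have ee: "e' (e i) = i" "e (e' k) = k" for i k
    using e by (simp_all add: e'_def bij_is_inj bij_is_surj surj_f_inv_f)
  define r where "r x = (\<chi> i. x $ e i)" for x :: "real^'n ordered_copy"
  define A' where "A' = (\<chi> k l. A $ e' k $ e' l)"
  have rm[measurable]: "r \<in> borel_measurable borel"
    unfolding r_def [abs_def] by (intro borel_measurable_continuous_onI continuous_on_vec_lambda continuous_intros)
  have [measurable]: "(\<lambda>y. A *v y) \<in> borel_measurable borel"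
    by (intro borel_measurable_continuous_onI linear_continuous_on matrix_vector_mul_bounded_linear)
  have int: "(\<integral>\<^sup>+x. g x \<partial>lborel) = (\<integral>\<^sup>+x. g (r x) \<partial>lborel)" if "g \<in> borel_measurable borel" for g :: "real^'n \<Rightarrow> ennreal"
    unfolding lborel_vec_reindex[OF e] r_def [abs_def, symmetric] using that by (intro nn_integral_distr) auto
  have rA: "r (A' *v y) = A *v r y" for y
  proof -
    have "(\<Sum>l\<in>UNIV. A $ i $ e' l * y $ l) = (\<Sum>j\<in>UNIV. A $ i $ j * y $ e j)" for i
      using sum.reindex_bij_betw[of e UNIV UNIV "\<lambda>l. A $ i $ e' l * y $ l"] e by (simp add: ee)
    then show ?thesis by (simp add: vec_eq_iff r_def A'_def matrix_vector_mult_def ee)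
  qed
  have dA: "det A' = det A" unfolding A'_def by (rule det_reindex[OF e'])
  have "(\<integral>\<^sup>+x. h x \<partial>lborel) = (\<integral>\<^sup>+x. h (r x) \<partial>lborel)" by (rule int) simp
  also have "\<dots> = ennreal \<bar>det A\<bar> * (\<integral>\<^sup>+y. h (r (A' *v y)) \<partial>lborel)"
    using A nn_integral_lborel_matrix_wellorder[of A' "\<lambda>x. h (r x)"] by (simp add: dA)
  also have "(\<integral>\<^sup>+y. h (r (A' *v y)) \<partial>lborel) = (\<integral>\<^sup>+y. h (A *v y) \<partial>lborel)"
    unfolding rA by (rule int[symmetric]) measurable
  finally show ?thesis .
qed

section \<open>The Gaussian integral over a strip\<close>

lemma norm_vec_power2: "(norm (v :: real^'n))\<^sup>2 = (\<Sum>i\<in>UNIV. (v $ i)\<^sup>2)"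
  by (simp add: norm_vec_def L2_set_def sum_nonneg)

lemma closed_strip:
  fixes B :: "real^'m^'n"
  shows "closed {x. \<forall>i\<in>I. \<bar>(B *v x) $ i\<bar> \<le> \<epsilon>}"
proof -
  have "{x. \<forall>i\<in>I. \<bar>(B *v x) $ i\<bar> \<le> \<epsilon>} = (\<Inter>i\<in>I. {x. \<bar>(B *v x) $ i\<bar> \<le> \<epsilon>})" by auto
  moreover have "closed {x. \<bar>(B *v x) $ i\<bar> \<le> \<epsilon>}" for i
    by (intro closed_Collect_le continuous_intros linear_continuous_on
        bounded_linear_compose[OF bounded_linear_vec_nth matrix_vector_mul_bounded_linear])
  ultimately show ?thesis by auto
qed

lemma prod_gauss_kernel: "(\<Prod>i\<in>UNIV. gauss_kernel ((x::real^'t) $ i)) = exp (- (pi / 4) * (norm x)\<^sup>2) / 2 ^ CARD('t)"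
  by (simp add: norm_vec_power2 gauss_kernel_def prod_dividef exp_sum sum_distrib_left sum_negf [symmetric])

text \<open>In the coordinates \<open>y = B *v x\<close> the strip is a product. There
  \<open>x\<close> splits orthogonally into a part \<open>x'\<close> determined by the coordinates
  in \<open>I\<close>, of length at most a constant times \<open>\<epsilon>\<close>, and a part
  \<open>z\<close> in the span of the orthonormal rows, whose squared length is the sum of the
  remaining squared coordinates. The first part costs a factor
  \<open>exp (- C * \<epsilon>\<^sup>2)\<close>; the rest is an exact product integral, with
  Jacobian \<open>1 / \<bar>det B\<bar>\<close>.\<close>

lemma gauss_strip_ge:
  fixes B :: "real^'t^'t"
  assumes B: "det B \<noteq> 0" and orth: "\<And>i j. j \<notin> I \<Longrightarrow> B $ j \<bullet> B $ i = (if i = j then 1 else 0)"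
  obtains C where "\<And>\<epsilon>. 0 < \<epsilon> \<Longrightarrow> ennreal (exp (- C * \<epsilon>\<^sup>2) * \<epsilon> ^ card I / \<bar>det B\<bar>)
    \<le> (\<integral>\<^sup>+x. indicator {x. \<forall>i\<in>I. \<bar>(B *v x) $ i\<bar> \<le> \<epsilon>} x * (\<Prod>i\<in>UNIV. ennreal (gauss_kernel (x $ i))) \<partial>lborel)"
proof -
  obtain A where AB: "B ** A = mat 1" "A ** B = mat 1"
    using B by (auto simp: invertible_det_nz [symmetric] invertible_def)
  have dA: "\<bar>det A\<bar> = 1 / \<bar>det B\<bar>" "det A \<noteq> 0"
  proof -
    have "det B * det A = 1" using AB(1) by (metis det_I det_mul)
    then have "\<bar>det B\<bar> * \<bar>det A\<bar> = 1" by (simp flip: abs_mult)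
    then show "\<bar>det A\<bar> = 1 / \<bar>det B\<bar>" "det A \<noteq> 0" using B by (auto simp: field_simps)
  qed
  have BA: "B *v (A *v y) = y" "A *v (B *v y) = y" for y
    using AB by (simp_all add: matrix_vector_mul_assoc)
  obtain K where K: "\<And>y. norm (A *v y) \<le> norm y * K" "0 \<le> K"
    using bounded_linear.nonneg_bounded[OF matrix_vector_mul_bounded_linear[of A]] by blast
  \<comment> \<open>\<open>K\<close> bounds the operator norm of \<open>A\<close>; the cardinality
    comes from estimating the norm of \<open>y'\<close> by the sum of its entries.\<close>
  define c where "c = (K * CARD('t))\<^sup>2"
  have key: "(norm (A *v y))\<^sup>2 \<le> c * \<epsilon>\<^sup>2 + (\<Sum>j\<in>-I. (y $ j)\<^sup>2)"
    if \<epsilon>: "0 < \<epsilon>" and y: "\<And>i. i \<in> I \<Longrightarrow> \<bar>y $ i\<bar> \<le> \<epsilon>" for y :: "real^'t" and \<epsilon>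
  proof -
    define y' :: "real^'t" where "y' = (\<chi> i. if i \<in> I then y $ i else 0)"
    define z where "z = (\<Sum>j\<in>-I. y $ j *\<^sub>R B $ j)"
    define x' where "x' = A *v y'"
    have Bz: "(B *v z) $ i = (if i \<in> I then 0 else y $ i)" for i
    proof -
      have "(B *v z) $ i = (\<Sum>j\<in>-I. y $ j * (B $ j \<bullet> B $ i))"
        by (simp add: z_def matrix_vector_mul_component inner_sum_right inner_commute)
      also have "\<dots> = (\<Sum>j\<in>-I. if j = i then y $ j else 0)"
        by (rule sum.cong) (auto simp: orth)
      finally show ?thesis by (simp add: sum.delta')
    qed
    have "B *v (x' + z) = y"
      by (simp add: vec_eq_iff matrix_vector_right_distrib x'_def BA Bz) (simp add: y'_def)
    then have Ay: "A *v y = x' + z" using BA(2)[of "x' + z"] by simp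
    have zi: "z \<bullet> v = (\<Sum>j\<in>-I. y $ j * (B *v v) $ j)" for v
      by (simp add: z_def inner_sum_left matrix_vector_mul_component)
    have xz: "z \<bullet> x' = 0" unfolding zi by (rule sum.neutral) (simp add: x'_def BA y'_def)
    have zz: "z \<bullet> z = (\<Sum>j\<in>-I. (y $ j)\<^sup>2)" unfolding zi by (rule sum.cong) (auto simp: Bz power2_eq_square)
    have "norm y' \<le> (\<Sum>i\<in>UNIV. \<bar>y' $ i\<bar>)" by (rule norm_le_l1_cart)
    also have "\<dots> \<le> (\<Sum>i\<in>(UNIV::'t set). \<epsilon>)"
      using y \<epsilon> by (intro sum_mono) (simp add: y'_def)
    finally have "norm y' \<le> CARD('t) * \<epsilon>" by simp
    then have "norm x' \<le> CARD('t) * \<epsilon> * K"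
      unfolding x'_def using K(1)[of y'] K(2) by (meson mult_right_mono order_trans)
    then have "(norm x')\<^sup>2 \<le> (CARD('t) * \<epsilon> * K)\<^sup>2" by (intro power_mono) auto
    also have "\<dots> = c * \<epsilon>\<^sup>2" by (simp add: c_def power_mult_distrib)
    finally have "(norm x')\<^sup>2 \<le> c * \<epsilon>\<^sup>2" .
    moreover have "(norm (A *v y))\<^sup>2 = (norm x')\<^sup>2 + z \<bullet> z"
      unfolding Ay power2_norm_eq_inner using xz by (simp add: inner_add_left inner_add_right inner_commute)
    ultimately show ?thesis by (simp add: zz)
  qed
  define C where "C = pi / 4 * c"
  show ?thesis
  proof (rule that[of C])
    fix \<epsilon> :: real assume \<epsilon>: "0 < \<epsilon>"
    \<comment> \<open>In the coordinates of \<open>I\<close> the Gaussian is replaced by its peak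
      value 1/2 on the interval, which then integrates to \<open>\<epsilon>\<close>; the loss is
      what \<open>exp (- C * \<epsilon>\<^sup>2)\<close> accounts for.\<close>
    define k where "k i = (\<lambda>s. if i \<in> I then ennreal (1 / 2) * indicator {- \<epsilon> .. \<epsilon>} s else ennreal (gauss_kernel s))" for i :: 't
    note [measurable] = sym_kernelD(7)[OF sym_kernel_gauss]
    have km[measurable]: "k i \<in> borel_measurable borel" for i unfolding k_def by measurable
    define K where "K = {x. \<forall>i\<in>I. \<bar>(B *v x) $ i\<bar> \<le> \<epsilon>}"
    define h where "h x = indicator K x * (\<Prod>i\<in>UNIV. ennreal (gauss_kernel (x $ i)))" for x
    have Km[measurable]: "K \<in> sets borel" unfolding K_def using closed_strip by (rule borel_closed)
    have [measurable]: "(\<lambda>x::real^'t. x $ i) \<in> borel_measurable borel" for i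
      by (intro borel_measurable_continuous_onI continuous_intros)
    have hm: "h \<in> borel_measurable borel" unfolding h_def [abs_def] by measurable
    have pt: "ennreal (exp (- C * \<epsilon>\<^sup>2)) * (\<Prod>i\<in>UNIV. k i (y $ i)) \<le> h (A *v y)" for y
    proof (cases "\<forall>i\<in>I. \<bar>y $ i\<bar> \<le> \<epsilon>")
      case True
      have g0: "0 \<le> gauss_kernel s" for s by (simp add: gauss_kernel_def)
      have "(\<Prod>i\<in>UNIV. k i (y $ i)) = (\<Prod>i\<in>UNIV. ennreal (if i \<in> I then 1 / 2 else gauss_kernel (y $ i)))"
        using True by (intro prod.cong refl) (auto simp: k_def indicator_def abs_le_iff minus_le_iff)
      also have "\<dots> = ennreal (\<Prod>i\<in>UNIV. if i \<in> I then 1 / 2 else gauss_kernel (y $ i))"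
        using g0 by (intro prod_ennreal) auto
      also have "(\<Prod>i\<in>UNIV. if i \<in> I then 1 / 2 else gauss_kernel (y $ i))
         = (\<Prod>i\<in>UNIV. exp (if i \<in> I then 0 else - (pi / 4) * (y $ i)\<^sup>2) / 2)"
        by (intro prod.cong) (auto simp: gauss_kernel_def)
      also have "\<dots> = exp (\<Sum>i\<in>UNIV. if i \<in> I then 0 else - (pi / 4) * (y $ i)\<^sup>2) / 2 ^ CARD('t)"
        by (simp add: prod_dividef exp_sum)
      also have "(\<Sum>i\<in>UNIV. if i \<in> I then 0 else - (pi / 4) * (y $ i)\<^sup>2) = - (pi / 4) * (\<Sum>i\<in>-I. (y $ i)\<^sup>2)"
        by (simp add: sum.If_cases sum_distrib_left sum_negf)
      finally have prodk: "(\<Prod>i\<in>UNIV. k i (y $ i)) = ennreal (exp (- (pi / 4) * (\<Sum>i\<in>-I. (y $ i)\<^sup>2)) / 2 ^ CARD('t))" .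
      have "A *v y \<in> K" using True by (simp add: K_def BA)
      then have "h (A *v y) = ennreal (exp (- (pi / 4) * (norm (A *v y))\<^sup>2) / 2 ^ CARD('t))"
        using g0 by (simp add: h_def prod_ennreal prod_gauss_kernel)
      moreover have "exp (- C * \<epsilon>\<^sup>2) * (exp (- (pi / 4) * (\<Sum>i\<in>-I. (y $ i)\<^sup>2)) / 2 ^ CARD('t))
         \<le> exp (- (pi / 4) * (norm (A *v y))\<^sup>2) / 2 ^ CARD('t)"
      proof -
        have "pi / 4 * (norm (A *v y))\<^sup>2 \<le> pi / 4 * (c * \<epsilon>\<^sup>2 + (\<Sum>j\<in>-I. (y $ j)\<^sup>2))"
          using key[OF \<epsilon>, of y] True by (intro mult_left_mono) auto
        then have "- C * \<epsilon>\<^sup>2 + - (pi / 4) * (\<Sum>i\<in>-I. (y $ i)\<^sup>2) \<le> - (pi / 4) * (norm (A *v y))\<^sup>2"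
          by (simp add: C_def algebra_simps)
        then have "exp (- C * \<epsilon>\<^sup>2 + - (pi / 4) * (\<Sum>i\<in>-I. (y $ i)\<^sup>2)) \<le> exp (- (pi / 4) * (norm (A *v y))\<^sup>2)"
          by (simp only: exp_le_cancel_iff)
        then show ?thesis unfolding exp_add times_divide_eq_right by (rule divide_right_mono) simp
      qed
      ultimately show ?thesis
        unfolding prodk by (simp only: ennreal_mult'[symmetric] exp_ge_zero ennreal_leI)
    next
      case False
      then obtain i where i: "i \<in> I" "\<not> \<bar>y $ i\<bar> \<le> \<epsilon>" by auto
      then have "k i (y $ i) = 0" by (auto simp: k_def indicator_def abs_le_iff)
      then have "\<exists>i\<in>UNIV. k i (y $ i) = 0" by blast
      then have "(\<Prod>i\<in>UNIV. k i (y $ i)) = 0" by (intro prod_zero) simp_all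
      then show ?thesis by (simp only: mult_zero_right zero_le)
    qed
    have ik: "(\<integral>\<^sup>+s. k i s \<partial>lborel) = ennreal (if i \<in> I then \<epsilon> else 1)" for i
    proof (cases "i \<in> I")
      case True
      have "(\<integral>\<^sup>+s. ennreal (1 / 2) * indicator {- \<epsilon> .. \<epsilon>} s \<partial>lborel) = ennreal (1 / 2) * ennreal (2 * \<epsilon>)"
        using \<epsilon> by (subst nn_integral_cmult_indicator) auto
      also have "\<dots> = ennreal \<epsilon>" by (subst ennreal_mult'[symmetric]) auto
      finally show ?thesis using True by (simp add: k_def)
    next
      case False
      have "(\<integral>\<^sup>+s. ennreal (gauss_kernel s) \<partial>lborel) = 1"
        using sym_kernelD[OF sym_kernel_gauss] by (subst nn_integral_eq_integral) auto
      then show ?thesis using False by (simp add: k_def)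
    qed
    have "ennreal (exp (- C * \<epsilon>\<^sup>2) * \<epsilon> ^ card I / \<bar>det B\<bar>) = ennreal \<bar>det A\<bar> * (ennreal (exp (- C * \<epsilon>\<^sup>2)) * ennreal (\<epsilon> ^ card I))"
      unfolding dA(1) using \<epsilon> by (simp add: ennreal_mult'[symmetric])
    also have "ennreal (\<epsilon> ^ card I) = (\<integral>\<^sup>+y. (\<Prod>i\<in>UNIV. k i (y $ i)) \<partial>lborel)"
      using \<epsilon> by (simp add: nn_integral_prod_vec ik prod_ennreal prod.If_cases)
    also have "ennreal (exp (- C * \<epsilon>\<^sup>2)) * (\<integral>\<^sup>+y. (\<Prod>i\<in>UNIV. k i (y $ i)) \<partial>lborel)
      = (\<integral>\<^sup>+y. ennreal (exp (- C * \<epsilon>\<^sup>2)) * (\<Prod>i\<in>UNIV. k i (y $ i)) \<partial>lborel)"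
      by (rule nn_integral_cmult[symmetric]) measurable
    also have "ennreal \<bar>det A\<bar> * \<dots> \<le> ennreal \<bar>det A\<bar> * (\<integral>\<^sup>+y. h (A *v y) \<partial>lborel)"
      by (intro mult_left_mono nn_integral_mono pt) auto
    also have "\<dots> = (\<integral>\<^sup>+x. h x \<partial>lborel)"
      by (rule nn_integral_lborel_matrix[symmetric, OF dA(2) hm])
    finally show "ennreal (exp (- C * \<epsilon>\<^sup>2) * \<epsilon> ^ card I / \<bar>det B\<bar>)
      \<le> (\<integral>\<^sup>+x. indicator {x. \<forall>i\<in>I. \<bar>(B *v x) $ i\<bar> \<le> \<epsilon>} x * (\<Prod>i\<in>UNIV. ennreal (gauss_kernel (x $ i))) \<partial>lborel)"
      unfolding h_def K_def .
  qed
qed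

text \<open>
  \<open>M\<close> and \<open>B\<close> share the rows in \<open>I\<close>; these are completed by integer vectors in \<open>M\<close>, as the
  pigeonhole argument needs, and by an orthonormal basis of their complement in \<open>B\<close>.
\<close>

lemma two_power_le_det:
  fixes B M :: "real^'t^'t"
  assumes M: "\<And>i j. M $ i $ j \<in> \<int>" "det M \<noteq> 0"
    and B: "det B \<noteq> 0" "\<And>i j. j \<notin> I \<Longrightarrow> B $ j \<bullet> B $ i = (if i = j then 1 else 0)"
    and MB: "\<And>i. i \<in> I \<Longrightarrow> M $ i = B $ i"
    and inj: "\<And>y :: real^'t. (\<And>i. y $ i \<in> {-1, 0, 1}) \<Longrightarrow> (\<And>i. i \<notin> S \<Longrightarrow> y $ i = 0) \<Longrightarrow>
      (\<And>i. i \<in> I \<Longrightarrow> B $ i \<bullet> y = 0) \<Longrightarrow> y = 0"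
  shows "2 ^ card S \<le> 2 ^ card I * \<bar>det B\<bar>"
proof -
  obtain C where C: "\<And>\<epsilon>. 0 < \<epsilon> \<Longrightarrow> ennreal (exp (- C * \<epsilon>\<^sup>2) * \<epsilon> ^ card I / \<bar>det B\<bar>)
    \<le> (\<integral>\<^sup>+x. indicator {x. \<forall>i\<in>I. \<bar>(B *v x) $ i\<bar> \<le> \<epsilon>} x * (\<Prod>i\<in>UNIV. ennreal (gauss_kernel (x $ i))) \<partial>lborel)"
    using gauss_strip_ge[OF B] by blast
  have MBv: "(M *v x) $ i = (B *v x) $ i" if "i \<in> I" for i x
    using MB[OF that] by (simp add: matrix_vector_mul_component)
  have inj': "y = 0" if "\<And>i. y $ i \<in> {-1, 0, 1}" "\<And>i. i \<notin> S \<Longrightarrow> y $ i = 0"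
      "\<And>i. i \<in> I \<Longrightarrow> (M *v y) $ i = 0" for y :: "real^'t"
    using that inj[of y] MBv by (simp add: matrix_vector_mul_component)
  have main: "exp (- C * \<epsilon>\<^sup>2) * 2 ^ card S \<le> 2 ^ card I * \<bar>det B\<bar>" if \<epsilon>: "0 < \<epsilon>" for \<epsilon>
  proof -
    define K where "K = {x. \<forall>i\<in>I. \<bar>(B *v x) $ i\<bar> \<le> \<epsilon>}"
    have K': "K = {x. \<forall>i\<in>I. \<bar>(M *v x) $ i\<bar> \<le> \<epsilon>}" by (auto simp: K_def MBv)
    have Km: "K \<in> sets borel" unfolding K_def using closed_strip by (rule borel_closed)
    have Kc: "convex K"
    proof (rule convexI)
      fix x y :: "real^'t" and u v :: real
      assume *: "x \<in> K" "y \<in> K" "0 \<le> u" "0 \<le> v" "u + v = 1"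
      have "\<bar>u * (B *v x) $ i + v * (B *v y) $ i\<bar> \<le> \<epsilon>" if "i \<in> I" for i
      proof -
        have "\<bar>u * (B *v x) $ i + v * (B *v y) $ i\<bar> \<le> u * \<bar>(B *v x) $ i\<bar> + v * \<bar>(B *v y) $ i\<bar>"
          using * by (metis abs_mult abs_of_nonneg abs_triangle_ineq)
        also have "\<dots> \<le> u * \<epsilon> + v * \<epsilon>" using * that by (intro add_mono mult_left_mono) (auto simp: K_def)
        also have "\<dots> = \<epsilon>" using * by (simp flip: distrib_right)
        finally show ?thesis .
      qed
      then show "u *\<^sub>R x + v *\<^sub>R y \<in> K"
        by (simp add: K_def matrix_vector_right_distrib matrix_vector_mult_scaleR)
    qed
    have Ks: "- x \<in> K" if "x \<in> K" for x
    proof -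
      have "B *v (- x) = - (B *v x)" using matrix_vector_mult_scaleR[of B "-1" x] by simp
      then show ?thesis using that by (simp add: K_def)
    qed
    have "ennreal (exp (- C * \<epsilon>\<^sup>2) * \<epsilon> ^ card I / \<bar>det B\<bar>)
       \<le> ennreal (1 / 2 ^ card S) * emeasure lborel (K \<inter> {x. \<forall>i. \<bar>x $ i\<bar> < (if i \<in> S then 1 else 1 / 2)})"
      by (rule order_trans[OF C[OF \<epsilon>] gauss_le_box_section[OF Km Kc Ks, unfolded K_def], folded K_def])
    also have "\<dots> \<le> ennreal (1 / 2 ^ card S) * ennreal ((2 * \<epsilon>) ^ card I)"
      unfolding K' using \<epsilon> by (intro mult_left_mono measure_strip_le[OF M inj']) auto
    also have "\<dots> = ennreal (1 / 2 ^ card S * (2 * \<epsilon>) ^ card I)" by (rule ennreal_mult'[symmetric]) simp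
    finally have "exp (- C * \<epsilon>\<^sup>2) * \<epsilon> ^ card I / \<bar>det B\<bar> \<le> 1 / 2 ^ card S * (2 * \<epsilon>) ^ card I"
      using \<epsilon> by (subst (asm) ennreal_le_iff) auto
    then have "exp (- C * \<epsilon>\<^sup>2) * 2 ^ card S * \<epsilon> ^ card I \<le> 2 ^ card I * \<bar>det B\<bar> * \<epsilon> ^ card I"
      using B(1) by (simp add: field_simps power_mult_distrib)
    then show ?thesis using \<epsilon> by (simp add: mult_le_cancel_right)
  qed
  \<comment> \<open>The powers of \<open>\<epsilon>\<close> having cancelled, only a factor tending
    to 1 still depends on it.\<close>
  have "((\<lambda>\<epsilon>. exp (- C * \<epsilon>\<^sup>2) * 2 ^ card S) \<longlongrightarrow> exp (- C * 0\<^sup>2) * 2 ^ card S) (at_right 0)"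
    by (intro tendsto_intros)
  then have "((\<lambda>\<epsilon>. exp (- C * \<epsilon>\<^sup>2) * 2 ^ card S) \<longlongrightarrow> 2 ^ card S) (at_right 0)" by simp
  then show ?thesis
  proof (rule tendsto_upperbound)
    show "\<forall>\<^sub>F \<epsilon> in at_right 0. exp (- C * \<epsilon>\<^sup>2) * 2 ^ card S \<le> 2 ^ card I * \<bar>det B\<bar>"
      by (rule eventually_at_rightI[of 0 1]) (use main in simp_all)
  qed simp
qed

section \<open>Hadamard's inequality, lattice bases and minimal supports\<close>

text \<open>One step replaces row \<open>k\<close> by its component orthogonal to all other rows,
  which keeps the determinant and does not increase the norm. Projecting against all rows, not only
  those already treated, is what makes the rows of \<open>F\<close> orthogonal to every other row
  and keeps this true in later steps.\<close>

lemma exists_orthogonal_rows: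
  fixes A :: "real^'n^'n"
  assumes "finite F"
  shows "\<exists>A' :: real^'n^'n. det A' = det A \<and> (\<forall>i. norm (A' $ i) \<le> norm (A $ i)) \<and>
    (\<forall>i\<in>F. \<forall>j. i \<noteq> j \<longrightarrow> A' $ i \<bullet> A' $ j = 0)"
  using assms
proof (induction F rule: finite_induct)
  case empty
  show ?case by (intro exI[of _ A]) simp
next
  case (insert k F)
  then obtain A' :: "real^'n^'n" where A': "det A' = det A" "\<And>i. norm (A' $ i) \<le> norm (A $ i)"
    "\<And>i j. i \<in> F \<Longrightarrow> i \<noteq> j \<Longrightarrow> A' $ i \<bullet> A' $ j = 0"
    by metis
  define T where "T = {row j A' |j. j \<noteq> k}"
  obtain y z where yz: "y \<in> span T" "\<And>w. w \<in> span T \<Longrightarrow> orthogonal z w" "A' $ k = y + z"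
    using orthogonal_subspace_decomp_exists[of T "A' $ k"] by blast
  define A'' where "A'' = (\<chi> i. if i = k then z else A' $ i)"
  have "- y \<in> vec.span T" using yz(1) by (simp add: span_vec_eq span_neg)
  from det_row_span[OF this[unfolded T_def]]
  have "det (\<chi> i. if i = k then row k A' + - y else row i A') = det A'" .
  moreover have "(\<chi> i. if i = k then row k A' + - y else row i A') = A''"
    using yz(3) by (simp add: A''_def row_def vec_eq_iff)
  ultimately have "det A'' = det A'" by simp
  moreover have zw: "z \<bullet> A' $ j = 0" if "j \<noteq> k" for j
  proof -
    have "A' $ j = row j A'" by (simp add: row_def vec_eq_iff)
    then have "A' $ j \<in> span T" using that by (intro span_base) (auto simp: T_def)
    then show ?thesis using yz(2) by (simp add: orthogonal_def)
  qed
  moreover have "norm z \<le> norm (A' $ k)"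
  proof -
    have "z \<bullet> y = 0" using yz(1,2) by (simp add: orthogonal_def)
    then have "(norm (A' $ k))\<^sup>2 = (norm y)\<^sup>2 + (norm z)\<^sup>2"
      unfolding yz(3) power2_norm_eq_inner by (simp add: inner_add_left inner_add_right inner_commute)
    then have "(norm z)\<^sup>2 \<le> (norm (A' $ k))\<^sup>2" by simp
    then show ?thesis by (rule power2_le_imp_le) simp
  qed
  ultimately show ?case
    using A' by (intro exI[of _ A'']) (auto simp: A''_def inner_commute intro: order_trans)
qed

lemma Hadamard_inequality:
  fixes A :: "real^'n^'n"
  shows "\<bar>det A\<bar> \<le> (\<Prod>i\<in>UNIV. norm (A $ i))"
proof -
  obtain A' :: "real^'n^'n" where A': "det A' = det A" "\<And>i. norm (A' $ i) \<le> norm (A $ i)"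
    "\<And>i j. i \<noteq> j \<Longrightarrow> A' $ i \<bullet> A' $ j = 0"
    using exists_orthogonal_rows[of UNIV A] by auto
  have e: "(A' ** transpose A') $ i $ j = A' $ i \<bullet> A' $ j" for i j
    by (simp add: matrix_matrix_mult_def transpose_def inner_vec_def)
  have "(det A)\<^sup>2 = det (A' ** transpose A')"
    by (simp add: det_mul det_transpose A'(1) power2_eq_square)
  also have "\<dots> = (\<Prod>i\<in>UNIV. A' $ i \<bullet> A' $ i)"
    by (subst det_diagonal) (simp_all add: e A'(3))
  also have "\<dots> = (\<Prod>i\<in>UNIV. norm (A' $ i))\<^sup>2"
    by (simp add: prod_power_distrib power2_norm_eq_inner)
  finally have "\<bar>det A\<bar> = (\<Prod>i\<in>UNIV. norm (A' $ i))"
    by (metis abs_of_nonneg norm_ge_zero power2_eq_iff_nonneg power2_abs abs_ge_zero prod_nonneg)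
  also have "\<dots> \<le> (\<Prod>i\<in>UNIV. norm (A $ i))" by (intro prod_mono) (simp add: A'(2))
  finally show ?thesis .
qed

section \<open>Bases of integer lattices\<close>

lemma set_lattice_basis_subset:
  assumes "is_lattice_basis G vs"
  shows "set vs \<subseteq> G"
proof
  fix u assume "u \<in> set vs"
  then obtain j where j: "j < length vs" "u = vs ! j" by (auto simp: in_set_conv_nth)
  define c :: "nat \<Rightarrow> int" where "c i = (if i = j then 1 else 0)" for i
  have "(\<Sum>i<length vs. of_int (c i) *\<^sub>R vs ! i) = (\<Sum>i<length vs. if i = j then vs ! i else 0)"
    by (intro sum.cong) (auto simp: c_def)
  also have "\<dots> = u" using j by simp
  finally have "\<exists>c :: nat \<Rightarrow> int. u = (\<Sum>i<length vs. of_int (c i) *\<^sub>R vs ! i) \<and> True" by blast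
  moreover have "G = {\<Sum>i<length vs. of_int (c i) *\<^sub>R vs ! i | c :: nat \<Rightarrow> int. True}"
    using assms by (simp only: is_lattice_basis_def)
  ultimately show "u \<in> G" by (simp only: mem_Collect_eq)
qed

lemma subgroup_of_int_scaleR:
  assumes "\<And>u v. u \<in> G \<Longrightarrow> v \<in> G \<Longrightarrow> u - v \<in> (G :: 'a::real_vector set)" "v \<in> G"
  shows "of_int q *\<^sub>R v \<in> G"
proof -
  have 0: "0 \<in> G" using assms(1)[OF assms(2,2)] by simp
  have neg: "- u \<in> G" if "u \<in> G" for u using assms(1)[OF 0 that] by simp
  have add: "u + w \<in> G" if "u \<in> G" "w \<in> G" for u w using assms(1)[OF that(1) neg[OF that(2)]] by simp
  have nat: "real n *\<^sub>R v \<in> G" for n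
    by (induction n) (auto simp: 0 algebra_simps intro: add assms(2))
  show ?thesis
    using nat[of "nat q"] neg[OF nat[of "nat (- q)"]] by (cases "0 \<le> q") auto
qed

text \<open>A Hermite-style construction, by induction on the coordinates \<open>T\<close> that may
  be nonzero. The \<open>k\<close>-th coordinates of \<open>G\<close> form a subgroup of the
  integers; an element \<open>w\<close> attaining its least positive member \<open>d\<close>,
  together with a basis of the part \<open>G'\<close> with vanishing \<open>k\<close>-th coordinate,
  is a basis of \<open>G\<close>.\<close>

lemma exists_lattice_basis_aux:
  fixes G :: "(real^'n) set"
  assumes "finite T" and "0 \<in> G" and "\<And>u v. u \<in> G \<Longrightarrow> v \<in> G \<Longrightarrow> u - v \<in> G"
    and "\<And>v i. v \<in> G \<Longrightarrow> v $ i \<in> \<int>" and "\<And>v i. v \<in> G \<Longrightarrow> i \<notin> T \<Longrightarrow> v $ i = 0"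
  shows "\<exists>vs. is_lattice_basis G vs"
  using assms
proof (induction T arbitrary: G rule: finite_induct)
  case empty
  have "G = {0}" using empty.prems by (auto simp: vec_eq_iff)
  then have "is_lattice_basis G []" by (auto simp: is_lattice_basis_def independent_empty)
  then show ?case by blast
next
  case (insert k T)
  show ?case
  proof (cases "\<forall>v\<in>G. v $ k = 0")
    case True
    have "v $ i = 0" if "v \<in> G" "i \<notin> T" for v i
      using that True insert.prems(4)[of v i] by (cases "i = k") auto
    then show ?thesis using insert.IH[of G] insert.prems by blast
  next
    case False
    define P where "P n \<longleftrightarrow> n > 0 \<and> (\<exists>v\<in>G. v $ k = real n)" for n :: nat
    have "\<exists>n. P n"
    proof -
      obtain v where v: "v \<in> G" "v $ k \<noteq> 0" using False by auto
      obtain m where m: "v $ k = of_int m" using insert.prems(3)[OF v(1), of k] by (elim Ints_cases)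
      have "- v \<in> G" using insert.prems(2)[OF insert.prems(1) v(1)] by simp
      then have "\<exists>u\<in>G. u $ k = real (nat \<bar>m\<bar>)"
        using v(1) m by (cases "0 \<le> m") (auto intro: bexI[of _ v] bexI[of _ "- v"])
      then show ?thesis using v m by (intro exI[of _ "nat \<bar>m\<bar>"]) (auto simp: P_def)
    qed
    define d where "d = (LEAST n. P n)"
    have "P d" unfolding d_def by (rule LeastI_ex) fact
    then obtain w where w: "w \<in> G" "w $ k = real d" and d: "d > 0" by (auto simp: P_def)
    have dmin: "d \<le> n" if "P n" for n unfolding d_def using that by (rule Least_le)
    define G' where "G' = {v\<in>G. v $ k = 0}"
    have "v $ i = 0" if "v \<in> G'" "i \<notin> T" for v i
      using that insert.prems(4)[of v i] by (cases "i = k") (auto simp: G'_def)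
    moreover have "0 \<in> G'" "\<And>u v. u \<in> G' \<Longrightarrow> v \<in> G' \<Longrightarrow> u - v \<in> G'" "\<And>v i. v \<in> G' \<Longrightarrow> v $ i \<in> \<int>"
      using insert.prems(1-3) by (auto simp: G'_def)
    ultimately obtain vs where vs: "is_lattice_basis G' vs" using insert.IH[of G'] by blast
    have gen: "G' = {\<Sum>i<length vs. of_int (c i) *\<^sub>R vs ! i | c :: nat \<Rightarrow> int. True}"
      using vs by (simp add: is_lattice_basis_def)
    have sub: "set vs \<subseteq> G'" using vs by (rule set_lattice_basis_subset)
    \<comment> \<open>The hyperplane contains the span of \<open>vs\<close> but not
      \<open>w\<close>, which gives independence.\<close>
    have "span (set vs) \<subseteq> {v. v $ k = 0}"
      using sub by (intro span_minimal) (auto simp: G'_def subspace_def)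
    then have wn: "w \<notin> span (set vs)" using w d by auto
    have sc: "of_int q *\<^sub>R v \<in> G" if "v \<in> G" for q v
      using subgroup_of_int_scaleR[OF insert.prems(2) that] .
    have "is_lattice_basis G (w # vs)"
      unfolding is_lattice_basis_def
    proof (intro conjI)
      show "distinct (w # vs)" using vs wn span_base by (auto simp: is_lattice_basis_def)
      show "independent (set (w # vs))" using vs wn by (simp add: is_lattice_basis_def independent_insert)
      have expand: "(\<Sum>i<length (w # vs). of_int (c i) *\<^sub>R (w # vs) ! i)
        = of_int (c 0) *\<^sub>R w + (\<Sum>i<length vs. of_int (c (Suc i)) *\<^sub>R vs ! i)" for c :: "nat \<Rightarrow> int"
        by (simp only: list.size add_Suc_right add_0_right sum.lessThan_Suc_shift nth_Cons_0 nth_Cons_Suc)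
      show "G = {\<Sum>i<length (w # vs). of_int (c i) *\<^sub>R (w # vs) ! i | c :: nat \<Rightarrow> int. True}"
      proof (intro equalityI subsetI)
        fix v assume v: "v \<in> G"
        obtain m where m: "v $ k = of_int m" using insert.prems(3)[OF v, of k] by (elim Ints_cases)
        \<comment> \<open>Division with remainder: subtracting \<open>q\<close> times
          \<open>w\<close> leaves the remainder modulo \<open>d\<close> as \<open>k\<close>-th
          coordinate, which minimality of \<open>d\<close> forces to be 0.\<close>
        define q where "q = m div int d"
        define u where "u = v - of_int q *\<^sub>R w"
        have u: "u \<in> G" unfolding u_def using insert.prems(2)[OF v sc[OF w(1)]] .
        have uk: "u $ k = of_int (m mod int d)"
        proof -
          have "m mod int d = m - q * int d" by (simp add: q_def minus_div_mult_eq_mod)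
          then show ?thesis by (simp add: u_def m w)
        qed
        have "m mod int d = 0"
        proof (rule ccontr)
          assume "m mod int d \<noteq> 0"
          then have pos: "m mod int d > 0" using d pos_mod_sign[of "int d" m] by linarith
          then have "P (nat (m mod int d))" unfolding P_def using u uk by (simp, intro bexI[of _ u]) simp_all
          then have "d \<le> nat (m mod int d)" by (rule dmin)
          moreover have "m mod int d < int d" using d by simp
          ultimately show False using pos by linarith
        qed
        then have "u \<in> G'" using u uk by (simp add: G'_def)
        then obtain c :: "nat \<Rightarrow> int" where c: "u = (\<Sum>i<length vs. of_int (c i) *\<^sub>R vs ! i)"
          unfolding gen by blast
        have "v = (\<Sum>i<length (w # vs). of_int (case_nat q c i) *\<^sub>R (w # vs) ! i)"
          unfolding expand by (simp add: c[symmetric] u_def)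
        then show "v \<in> {\<Sum>i<length (w # vs). of_int (c i) *\<^sub>R (w # vs) ! i | c :: nat \<Rightarrow> int. True}" by blast
      next
        fix v assume "v \<in> {\<Sum>i<length (w # vs). of_int (c i) *\<^sub>R (w # vs) ! i | c :: nat \<Rightarrow> int. True}"
        then obtain c :: "nat \<Rightarrow> int" where "v = of_int (c 0) *\<^sub>R w + (\<Sum>i<length vs. of_int (c (Suc i)) *\<^sub>R vs ! i)"
          unfolding expand by blast
        moreover have "(\<Sum>i<length vs. of_int (c (Suc i)) *\<^sub>R vs ! i) \<in> G"
        proof -
          have "(\<Sum>i<length vs. of_int (c (Suc i)) *\<^sub>R vs ! i) \<in> G'" unfolding gen
            by (rule CollectI, rule exI[of _ "\<lambda>i. c (Suc i)"]) simp
          then show ?thesis by (simp add: G'_def)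
        qed
        moreover have "a + b \<in> G" if "a \<in> G" "b \<in> G" for a b
          using insert.prems(2)[OF that(1) insert.prems(2)[OF insert.prems(1) that(2)]] by simp
        ultimately show "v \<in> G" using sc[OF w(1)] by blast
      qed
    qed
    then show ?thesis by blast
  qed
qed

text \<open>Ensures that the \<open>SOME\<close> in \<open>lattice_det\<close> picks an actual basis
  of \<open>Lat x\<close>.\<close>

lemma exists_lattice_basis:
  fixes G :: "(real^'n) set"
  assumes "0 \<in> G" and "\<And>u v. u \<in> G \<Longrightarrow> v \<in> G \<Longrightarrow> u - v \<in> G" and "\<And>v i. v \<in> G \<Longrightarrow> v $ i \<in> \<int>"
  shows "\<exists>vs. is_lattice_basis G vs"
proof (rule exists_lattice_basis_aux)
  show "finite (UNIV :: 'n set)" by simp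
  show "0 \<in> G" by fact
  show "u - v \<in> G" if "u \<in> G" "v \<in> G" for u v using that by (rule assms(2))
  show "v $ i \<in> \<int>" if "v \<in> G" for v i using that by (rule assms(3))
qed simp

lemma lattice_subset_span_basis:
  assumes "is_lattice_basis G vs"
  shows "G \<subseteq> span (set vs)"
proof
  fix v assume "v \<in> G"
  then obtain c :: "nat \<Rightarrow> int" where "v = (\<Sum>i<length vs. of_int (c i) *\<^sub>R vs ! i)"
    using assms unfolding is_lattice_basis_def by blast
  then show "v \<in> span (set vs)" by (simp only:, intro span_sum span_scale span_base nth_mem) simp
qed

section \<open>Supports of sparsest representations\<close>

lemma finite_norm0_image: "finite (norm0 ` (A :: (int^'t::finite) set))"
proof (rule finite_subset)
  show "norm0 ` A \<subseteq> {..CARD('t)}" by (auto simp: norm0_def intro: card_mono)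
qed simp

text \<open>\<open>l\<close> is a sparsest representation of a vector attaining the maximum in
  \<open>M0\<close>. Both extrema are attained since \<open>norm0\<close> takes finitely many
  values.\<close>

lemma exists_minimal_support:
  fixes x :: "'t::finite \<Rightarrow> int^'d"
  obtains l where "\<And>i. 0 \<le> l $ i" "card {i. l $ i \<noteq> 0} = M0 x"
    "\<And>l'. (\<And>i. 0 \<le> l' $ i) \<Longrightarrow> int_comb x l' = int_comb x l \<Longrightarrow> M0 x \<le> card {i. l' $ i \<noteq> 0}"
proof -
  have m0: "m0 x b \<in> norm0 ` PX x b" if "b \<in> Sg x" for b
  proof -
    have "PX x b \<noteq> {}" using that by (auto simp: Sg_def PX_def)
    then show ?thesis unfolding m0_def using finite_norm0_image by (intro Min_in) auto
  qed
  have "m0 x ` Sg x \<subseteq> norm0 ` (UNIV :: (int^'t) set)"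
  proof (rule image_subsetI)
    fix b assume "b \<in> Sg x"
    then show "m0 x b \<in> norm0 ` (UNIV :: (int^'t) set)" using m0[of b] by auto
  qed
  then have fin: "finite (m0 x ` Sg x)" by (rule finite_subset) (rule finite_norm0_image)
  have "int_comb x 0 \<in> Sg x"
    unfolding Sg_def by (rule CollectI, rule exI[of _ 0]) simp
  then have "M0 x \<in> m0 x ` Sg x" unfolding M0_def using fin by (intro Max_in) auto
  then obtain b where b: "b \<in> Sg x" "M0 x = m0 x b" by auto
  obtain l where l: "l \<in> PX x b" "m0 x b = norm0 l" using m0[OF b(1)] by auto
  show ?thesis
  proof (rule that[of l])
    show "0 \<le> l $ i" for i using l by (simp add: PX_def)
    show "card {i. l $ i \<noteq> 0} = M0 x" using l b by (simp add: norm0_def)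
    fix l' :: "int^'t" assume "\<And>i. 0 \<le> l' $ i" "int_comb x l' = int_comb x l"
    then have "l' \<in> PX x b" using l by (simp add: PX_def)
    then have "m0 x b \<le> norm0 l'" unfolding m0_def by (intro Min_le finite_norm0_image) auto
    then show "M0 x \<le> card {i. l' $ i \<noteq> 0}" using b by (simp add: norm0_def)
  qed
qed

lemma int_comb_nth: "int_comb x l $ j = (\<Sum>i\<in>UNIV. l $ i * x i $ j)"
  unfolding int_comb_def sum_component vector_smult_component ..

lemma column_Wmat_inner: "column j (Wmat x) \<bullet> y = (\<Sum>i\<in>UNIV. of_int (x i $ j) * y $ i)"
  unfolding column_def Wmat_def inner_vec_def vec_lambda_beta inner_real_def ..

lemma exists_support_no_relation:
  fixes x :: "'t::finite \<Rightarrow> int^'d"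
  obtains S where "card S = M0 x"
    "\<And>y :: real^'t. (\<And>i. y $ i \<in> {-1, 0, 1}) \<Longrightarrow> (\<And>i. i \<notin> S \<Longrightarrow> y $ i = 0) \<Longrightarrow>
      (\<And>j. column j (Wmat x) \<bullet> y = 0) \<Longrightarrow> y = 0"
proof (rule exists_minimal_support[of x])
  fix l :: "int^'t"
  assume l: "\<And>i. 0 \<le> l $ i" "card {i. l $ i \<noteq> 0} = M0 x"
    "\<And>l'. (\<And>i. 0 \<le> l' $ i) \<Longrightarrow> int_comb x l' = int_comb x l \<Longrightarrow> M0 x \<le> card {i. l' $ i \<noteq> 0}"
  define S where "S = {i. l $ i \<noteq> 0}"
  \<comment> \<open>Only relations with an entry 1 are excluded here, since the multiple to subtract
    is determined by those entries; the sign is dealt with at the end by passing to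
    \<open>- y\<close>.\<close>
  have no_pos: "\<not> (\<exists>i. y $ i = 1)"
    if y: "\<And>i. y $ i \<in> {-1, 0, 1}" "\<And>i. i \<notin> S \<Longrightarrow> y $ i = 0" "\<And>j. column j (Wmat x) \<bullet> y = 0" for y :: "real^'t"
  proof
    assume ex: "\<exists>i. y $ i = 1"
    define z :: "int^'t" where "z = (\<chi> i. \<lfloor>y $ i\<rfloor>)"
    have fl: "\<lfloor>- 1 :: real\<rfloor> = - 1" by (rule floor_unique) auto
    have zy: "of_int (z $ i) = y $ i" for i
      using y(1)[of i] by (auto simp: z_def fl simp del: of_int_floor_cancel)
    have z1: "z $ i \<in> {-1, 0, 1}" for i using y(1)[of i] by (auto simp: z_def fl)
    \<comment> \<open>The largest multiple of \<open>z\<close> that can be subtracted without a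
      negative entry: entries with \<open>z $ i = -1\<close> grow, and the minimum over those with
      \<open>z $ i = 1\<close> makes the entry at \<open>m\<close> vanish.\<close>
    define k where "k = Min ((\<lambda>i. l $ i) ` {i. z $ i = 1})"
    obtain i0 where "y $ i0 = 1" using ex by blast
    then have "z $ i0 = 1" by (simp add: z_def)
    then have ne: "{i. z $ i = 1} \<noteq> {}" by blast
    have "k \<in> (\<lambda>i. l $ i) ` {i. z $ i = 1}" unfolding k_def using ne by (intro Min_in) auto
    then obtain m where m: "z $ m = 1" "l $ m = k" by auto
    have kle: "k \<le> l $ i" if "z $ i = 1" for i unfolding k_def using that by (intro Min_le) auto
    have k0: "0 \<le> k" using l(1)[of m] m by simp
    define l' where "l' = (\<chi> i. l $ i - k * z $ i)"
    have l'0: "0 \<le> l' $ i" for i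
      using z1[of i] l(1)[of i] kle[of i] k0 by (auto simp: l'_def)
    have "int_comb x l' = int_comb x l"
    proof -
      have "(\<Sum>i\<in>UNIV. z $ i * x i $ j) = 0" for j
      proof -
        have "real_of_int (\<Sum>i\<in>UNIV. z $ i * x i $ j) = column j (Wmat x) \<bullet> y"
          by (simp add: column_Wmat_inner zy mult.commute)
        then have "real_of_int (\<Sum>i\<in>UNIV. z $ i * x i $ j) = of_int 0" by (simp only: y(3) of_int_0)
        then show ?thesis by (simp only: of_int_eq_iff)
      qed
      then have "(\<Sum>i\<in>UNIV. l' $ i * x i $ j) = (\<Sum>i\<in>UNIV. l $ i * x i $ j)" for j
        by (simp add: l'_def left_diff_distrib sum_subtractf mult.assoc sum_distrib_left[symmetric])
      then show ?thesis by (simp add: vec_eq_iff int_comb_nth)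
    qed
    then have le: "M0 x \<le> card {i. l' $ i \<noteq> 0}" using l(3) l'0 by blast
    have "i \<in> S" if "l' $ i \<noteq> 0" for i
    proof (rule ccontr)
      assume "i \<notin> S"
      then have "z $ i = 0" "l $ i = 0" using y(2)[of i] by (auto simp: S_def z_def)
      then show False using that by (simp add: l'_def)
    qed
    moreover have "l' $ m = 0" using m by (simp add: l'_def)
    moreover have "m \<in> S"
    proof (rule ccontr)
      assume "m \<notin> S"
      then show False using y(2)[of m] zy[of m] m by simp
    qed
    ultimately have "{i. l' $ i \<noteq> 0} \<subset> S" by auto
    then have "card {i. l' $ i \<noteq> 0} < card S" by (intro psubset_card_mono) auto
    then show False using le l(2) by (simp add: S_def)
  qed
  show ?thesis
  proof (rule that[of S])
    show "card S = M0 x" using l(2) by (simp add: S_def)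
    fix y :: "real^'t"
    assume y: "\<And>i. y $ i \<in> {-1, 0, 1}" "\<And>i. i \<notin> S \<Longrightarrow> y $ i = 0" "\<And>j. column j (Wmat x) \<bullet> y = 0"
    have "\<not> (\<exists>i. (- y) $ i = 1)"
    proof (rule no_pos)
      show "(- y) $ i \<in> {-1, 0, 1}" for i using y(1)[of i] by auto
    qed (use y in auto)
    then have "y $ i = 0" for i using y(1)[of i] no_pos[OF y] by auto
    then show "y = 0" by (simp add: vec_eq_iff)
  qed
qed

section \<open>Gram determinants\<close>

lemma det_mat_reindex:
  fixes A :: "'a::comm_ring_1^'n^'n"
  assumes e: "bij_betw e {0..<CARD('n)} UNIV"
  shows "Determinant.det (Matrix.mat CARD('n) CARD('n) (\<lambda>(i, j). A $ e i $ e j)) = det A"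
proof -
  have "Determinant.det (Matrix.mat CARD('n) CARD('n) (\<lambda>(i, j). A $ e i $ e j))
    = (\<Sum>p | p permutes {0..<CARD('n)}. of_int (sign p) * (\<Prod>i\<in>{0..<CARD('n)}. A $ e i $ e (p i)))"
    unfolding Determinant.det_def
    by (auto intro!: sum.cong prod.cong arg_cong2[where f = "(*)"] dest: permutes_in_image)
  also have "\<dots> = det A"
    unfolding det_def by (rule sum_permutes_reindex[OF e, where a = "\<lambda>i j. A $ i $ j"]) simp
  finally show ?thesis .
qed

text \<open>Orthonormal vectors orthogonal to \<open>vs\<close> only add an identity block. This
  lets the Gram determinant of fewer than \<open>CARD('n)\<close> vectors be read as the squared
  determinant of a square matrix.\<close>

lemma det_gram_append_orthonormal:
  assumes on: "\<And>i j. i < length us \<Longrightarrow> j < length us \<Longrightarrow> us ! i \<bullet> us ! j = (if i = j then 1 else 0)"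
    and orth: "\<And>u v. u \<in> set us \<Longrightarrow> v \<in> set vs \<Longrightarrow> u \<bullet> v = 0"
  shows "Determinant.det (gram (vs @ us)) = Determinant.det (gram vs)"
proof -
  let ?r = "length vs" and ?m = "length us"
  have "gram (vs @ us) = four_block_mat (gram vs) (0\<^sub>m ?r ?m) (0\<^sub>m ?m ?r) (1\<^sub>m ?m)"
  proof (rule eq_matI)
    fix i j assume "i < dim_row (four_block_mat (gram vs) (0\<^sub>m ?r ?m) (0\<^sub>m ?m ?r) (1\<^sub>m ?m))"
      "j < dim_col (four_block_mat (gram vs) (0\<^sub>m ?r ?m) (0\<^sub>m ?m ?r) (1\<^sub>m ?m))"
    then have ij: "i < ?r + ?m" "j < ?r + ?m" by (auto simp: gram_def)
    have o1: "vs ! i \<bullet> us ! (j - ?r) = 0" if "i < ?r" "\<not> j < ?r"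
      using that ij orth[of "us ! (j - ?r)" "vs ! i"] by (auto simp: inner_commute)
    have o2: "us ! (i - ?r) \<bullet> vs ! j = 0" if "\<not> i < ?r" "j < ?r"
      using that ij orth[of "us ! (i - ?r)" "vs ! j"] by auto
    show "gram (vs @ us) $$ (i, j) = four_block_mat (gram vs) (0\<^sub>m ?r ?m) (0\<^sub>m ?m ?r) (1\<^sub>m ?m) $$ (i, j)"
      using ij o1 o2 on[of "i - ?r" "j - ?r"] by (auto simp: gram_def nth_append)
  qed (auto simp: gram_def)
  moreover have "Determinant.det (four_block_mat (gram vs) (0\<^sub>m ?r ?m) (0\<^sub>m ?m ?r) (1\<^sub>m ?m))
    = Determinant.det (gram vs) * Determinant.det (1\<^sub>m ?m)"
    by (rule det_four_block_mat_lower_left_zero) (auto simp: gram_def)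
  ultimately show ?thesis by simp
qed

text \<open>The \<open>k\<close>-th vector becomes row \<open>e k\<close>. Using one enumeration
  \<open>e\<close> for two lists with a common prefix places the common vectors in the same
  rows.\<close>

definition matrix_of_list :: "(nat \<Rightarrow> 'n) \<Rightarrow> (real^'n) list \<Rightarrow> real^'n^'n" where
  "matrix_of_list e zs = (\<chi> i. zs ! inv_into {0..<CARD('n)} e i)"

lemma matrix_of_list_nth:
  fixes zs :: "(real^'n) list"
  assumes "bij_betw e {0..<CARD('n)} UNIV" "k < CARD('n)"
  shows "matrix_of_list e zs $ e k = zs ! k"
  using assms by (simp add: matrix_of_list_def bij_betw_inv_into_left)

lemma det_matrix_of_list_nz:
  fixes zs :: "(real^'n) list"
  assumes e: "bij_betw e {0..<CARD('n)} UNIV" and "length zs = CARD('n)" and sp: "span (set zs) = UNIV"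
  shows "det (matrix_of_list e zs) \<noteq> 0"
proof -
  have "set zs \<subseteq> rows (matrix_of_list e zs)"
  proof
    fix z assume "z \<in> set zs"
    then obtain k where "k < CARD('n)" "z = zs ! k" using assms by (auto simp: in_set_conv_nth)
    then have "z = row (e k) (matrix_of_list e zs)"
      using matrix_of_list_nth[OF e, of k zs] by (simp add: row_def)
    then show "z \<in> rows (matrix_of_list e zs)" by (auto simp: rows_def)
  qed
  then have "span (rows (matrix_of_list e zs)) = UNIV" using sp span_mono by blast
  then have "invertible (matrix_of_list e zs)"
    by (simp add: invertible_left_inverse matrix_left_invertible_span_rows)
  then show ?thesis by (simp add: invertible_det_nz)
qed

lemma det_matrix_of_list_power2:
  fixes zs :: "(real^'n) list"
  assumes e: "bij_betw e {0..<CARD('n)} UNIV" and len: "length zs = CARD('n)"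
  shows "(det (matrix_of_list e zs))\<^sup>2 = Determinant.det (gram zs)"
proof -
  define B where "B = matrix_of_list e zs"
  have "(B ** transpose B) $ i $ j = B $ i \<bullet> B $ j" for i j
    by (simp add: matrix_matrix_mult_def transpose_def inner_vec_def)
  then have "gram zs = Matrix.mat CARD('n) CARD('n) (\<lambda>(i, j). (B ** transpose B) $ e i $ e j)"
    unfolding gram_def len by (intro eq_matI) (simp_all add: B_def matrix_of_list_nth[OF e])
  then have "Determinant.det (gram zs) = det (B ** transpose B)"
    using det_mat_reindex[OF e] by simp
  then show ?thesis by (simp add: B_def det_mul det_transpose power2_eq_square)
qed

text \<open>The standard basis vectors are integral, and some of them complete \<open>V\<close> to a
  basis.\<close>

lemma exists_integer_completion:
  fixes V :: "(real^'n) set"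
  assumes "independent V" and ints: "\<And>v i. v \<in> V \<Longrightarrow> v $ i \<in> \<int>"
  obtains ws where "length ws = CARD('n) - card V" "span (V \<union> set ws) = UNIV" "\<And>w i. w \<in> set ws \<Longrightarrow> w $ i \<in> \<int>"
proof -
  obtain W where W: "V \<subseteq> W" "W \<subseteq> V \<union> Basis" "independent W" "V \<union> Basis \<subseteq> span W"
    using maximal_independent_subset_extend[of V "V \<union> Basis"] assms(1) by auto
  have sW: "span W = UNIV"
    using W(4) span_mono[of Basis "span W"] by (auto simp: span_span)
  have fin: "finite W" "finite V" using W(3) assms(1) by (auto intro: independent_imp_finite)
  have "card W = CARD('n)" using dim_eq_card[of W UNIV] W(3) sW by (simp add: dim_UNIV)
  obtain ws where ws: "set ws = W - V" "distinct ws" using finite_distinct_list[of "W - V"] fin by auto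
  show ?thesis
  proof (rule that[of ws])
    have "length ws = card (W - V)" using ws distinct_card by metis
    then show "length ws = CARD('n) - card V" using \<open>card W = CARD('n)\<close> W(1) fin by (simp add: card_Diff_subset)
    show "span (V \<union> set ws) = UNIV" using ws W(1) sW by (simp add: Un_absorb1)
    fix w i assume "w \<in> set ws"
    then have "w \<in> Basis" using ws W(2) by auto
    then show "w $ i \<in> \<int>" by (auto simp: Basis_vec_def axis_def)
  qed
qed

lemma exists_orthonormal_completion:
  fixes V :: "(real^'n) set"
  assumes "independent V"
  obtains us where "length us = CARD('n) - card V" "span (V \<union> set us) = UNIV"
    "\<And>i j. i < length us \<Longrightarrow> j < length us \<Longrightarrow> us ! i \<bullet> us ! j = (if i = j then 1 else 0)"
    "\<And>u v. u \<in> set us \<Longrightarrow> v \<in> V \<Longrightarrow> u \<bullet> v = 0"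
proof -
  define C where "C = {y \<in> UNIV. \<forall>x\<in>span V. orthogonal x y}"
  have "subspace C" by (auto simp: C_def subspace_def orthogonal_def inner_add_right)
  then obtain U where U: "U \<subseteq> C" "pairwise orthogonal U" "\<And>u. u \<in> U \<Longrightarrow> norm u = 1"
    "independent U" "card U = dim C" "span U = C"
    using orthonormal_basis_subspace by metis
  have "dim C + dim (span V) = dim (UNIV :: (real^'n) set)"
    unfolding C_def by (rule dim_subspace_orthogonal_to_vectors) auto
  then have cU: "card U = CARD('n) - card V"
    using U(5) dim_eq_card_independent[OF assms] by simp
  obtain us where us: "set us = U" "distinct us"
    using finite_distinct_list[OF independent_imp_finite[OF U(4)]] by auto
  show ?thesis
  proof (rule that[of us])
    show "length us = CARD('n) - card V" using cU us distinct_card by metis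
    show "span (V \<union> set us) = UNIV"
    proof (intro equalityI subsetI UNIV_I)
      fix x :: "real^'n"
      obtain y z where yz: "y \<in> span V" "\<And>w. w \<in> span V \<Longrightarrow> orthogonal z w" "x = y + z"
        using orthogonal_subspace_decomp_exists[of V x] by blast
      have "z \<in> C" using yz(2) by (simp add: C_def orthogonal_commute)
      then have "z \<in> span U" using U(6) by simp
      then show "x \<in> span (V \<union> set us)"
        unfolding yz(3) using yz(1) us(1) by (meson span_add span_mono subsetD sup_ge1 sup_ge2)
    qed
    show "us ! i \<bullet> us ! j = (if i = j then 1 else 0)" if "i < length us" "j < length us" for i j
    proof (cases "i = j")
      case True
      have "norm (us ! i) = 1" using U(3) us that by auto
      then show ?thesis using True by (simp add: norm_eq_1)
    next
      case False
      then have "us ! i \<noteq> us ! j" using us(2) that by (simp add: nth_eq_iff_index_eq)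
      then have "orthogonal (us ! i) (us ! j)" using U(2) us that by (auto simp: pairwise_def)
      then show ?thesis using False by (simp add: orthogonal_def)
    qed
    show "u \<bullet> v = 0" if "u \<in> set us" "v \<in> V" for u v
    proof -
      have "u \<in> C" using that us U(1) by auto
      then have "orthogonal v u" using span_base[OF that(2)] by (simp add: C_def)
      then show ?thesis by (simp add: orthogonal_def inner_commute)
    qed
  qed
qed

text \<open>The common setting of both bounds: \<open>vs\<close> is a lattice basis for the first
  and a list of truncated columns of \<open>W\<close> for the second.\<close>

locale independent_list =
  fixes vs :: "(real^'n) list"
  assumes dist: "distinct vs" and indep: "independent (set vs)"
begin

lemma length_le: "length vs \<le> CARD('n)"
  using independent_card_le[OF indep] distinct_card[OF dist] by simp

lemma orthonormal_matrix:
  obtains B :: "real^'n^'n" and e where "bij_betw e {0..<CARD('n)} UNIV"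
    "\<And>k. k < length vs \<Longrightarrow> B $ e k = vs ! k"
    "\<And>i j. j \<notin> e ` {0..<length vs} \<Longrightarrow> B $ j \<bullet> B $ i = (if i = j then 1 else 0)"
    "det B \<noteq> 0" "\<bar>det B\<bar> = sqrt (Determinant.det (gram vs))"
proof -
  have cv: "card (set vs) = length vs" using dist by (rule distinct_card)
  obtain us where us: "length us = CARD('n) - length vs" "span (set vs \<union> set us) = UNIV"
    "\<And>i j. i < length us \<Longrightarrow> j < length us \<Longrightarrow> us ! i \<bullet> us ! j = (if i = j then 1 else 0)"
    "\<And>u v. u \<in> set us \<Longrightarrow> v \<in> set vs \<Longrightarrow> u \<bullet> v = 0"
    using exists_orthonormal_completion[OF indep] unfolding cv by metis
  obtain e :: "nat \<Rightarrow> 'n" where e: "bij_betw e {0..<CARD('n)} UNIV"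
    using ex_bij_betw_nat_finite[of "UNIV :: 'n set"] by auto
  define B where "B = matrix_of_list e (vs @ us)"
  have len: "length (vs @ us) = CARD('n)" using us(1) length_le by simp
  have Be: "B $ e k = (vs @ us) ! k" if "k < CARD('n)" for k
    unfolding B_def by (rule matrix_of_list_nth[OF e that])
  show ?thesis
  proof (rule that[OF e, of B])
    show "B $ e k = vs ! k" if "k < length vs" for k
      using Be[of k] that length_le by (simp add: nth_append)
    show "det B \<noteq> 0" unfolding B_def by (rule det_matrix_of_list_nz[OF e len]) (use us(2) in simp)
    have "(det B)\<^sup>2 = Determinant.det (gram vs)"
      unfolding B_def det_matrix_of_list_power2[OF e len] by (rule det_gram_append_orthonormal) (use us in auto)
    then show "\<bar>det B\<bar> = sqrt (Determinant.det (gram vs))" by (metis real_sqrt_abs)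
    fix i j assume j: "j \<notin> e ` {0..<length vs}"
    have "i \<in> e ` {0..<CARD('n)}" "j \<in> e ` {0..<CARD('n)}" using e by (simp_all add: bij_betw_def)
    then obtain k l where "k \<in> {0..<CARD('n)}" "j = e k" "l \<in> {0..<CARD('n)}" "i = e l"
      by blast
    then have kl: "k < CARD('n)" "j = e k" "l < CARD('n)" "i = e l" by simp_all
    have k: "\<not> k < length vs" using j kl by auto
    have eq: "i = j \<longleftrightarrow> l = k" using e kl by (auto simp: bij_betw_def inj_on_def)
    have "k - length vs < length us" using k kl us(1) by auto
    moreover have "(vs @ us) ! k = us ! (k - length vs)" using k by (simp add: nth_append)
    moreover have "us ! (k - length vs) \<bullet> (vs @ us) ! l = (if l = k then 1 else 0)"
    proof (cases "l < length vs")
      case True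
      then show ?thesis using us(4) k calculation by (auto simp: nth_append)
    next
      case False
      have "l - length vs < length us" using False kl us(1) by auto
      then show ?thesis using False k calculation us(3)[of "k - length vs" "l - length vs"] by (auto simp: nth_append)
    qed
    ultimately show "B $ j \<bullet> B $ i = (if i = j then 1 else 0)"
      using Be[of k] Be[of l] kl eq by simp
  qed
qed

lemma two_power_le_sqrt_gram:
  assumes ints: "\<And>v i. v \<in> set vs \<Longrightarrow> v $ i \<in> \<int>"
    and inj: "\<And>y :: real^'n. (\<And>i. y $ i \<in> {-1, 0, 1}) \<Longrightarrow> (\<And>i. i \<notin> S \<Longrightarrow> y $ i = 0) \<Longrightarrow>
      (\<And>v. v \<in> set vs \<Longrightarrow> v \<bullet> y = 0) \<Longrightarrow> y = 0"
  shows "2 ^ card S \<le> 2 ^ length vs * sqrt (Determinant.det (gram vs))"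
proof (rule orthonormal_matrix)
  fix B :: "real^'n^'n" and e
  assume B: "bij_betw e {0..<CARD('n)} UNIV"
    "\<And>k. k < length vs \<Longrightarrow> B $ e k = vs ! k"
    "\<And>i j. j \<notin> e ` {0..<length vs} \<Longrightarrow> B $ j \<bullet> B $ i = (if i = j then 1 else 0)"
    "det B \<noteq> 0" "\<bar>det B\<bar> = sqrt (Determinant.det (gram vs))"
  obtain ws where ws: "length ws = CARD('n) - length vs" "span (set vs \<union> set ws) = UNIV"
    "\<And>w i. w \<in> set ws \<Longrightarrow> w $ i \<in> \<int>"
    using exists_integer_completion[OF indep ints] unfolding distinct_card[OF dist] by metis
  \<comment> \<open>The completion may be crude: the pigeonhole bound asks only that
    \<open>det M\<close> be nonzero, while the determinant in the final estimate is that of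
    \<open>B\<close>.\<close>
  define M where "M = matrix_of_list e (vs @ ws)"
  have len: "length (vs @ ws) = CARD('n)" using ws(1) length_le by simp
  have Me: "M $ e k = (vs @ ws) ! k" if "k < CARD('n)" for k
    unfolding M_def by (rule matrix_of_list_nth[OF B(1) that])
  define I where "I = e ` {0..<length vs}"
  have "inj_on e {0..<length vs}"
    using B(1) length_le by (auto simp: bij_betw_def intro: inj_on_subset)
  then have cI: "card I = length vs" by (simp add: I_def card_image)
  have "2 ^ card S \<le> 2 ^ card I * \<bar>det B\<bar>"
  proof (rule two_power_le_det[of M, OF _ _ B(4)])
    show "det M \<noteq> 0" unfolding M_def by (rule det_matrix_of_list_nz[OF B(1) len]) (use ws(2) in simp)
    fix i j
    have "i \<in> e ` {0..<CARD('n)}" using B(1) by (simp add: bij_betw_def)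
    then obtain k where "k \<in> {0..<CARD('n)}" "i = e k" by blast
    then have k: "k < CARD('n)" "i = e k" by simp_all
    have "(vs @ ws) ! k \<in> set (vs @ ws)" using k len by (metis nth_mem)
    then show "M $ i $ j \<in> \<int>" using ints ws(3) Me[OF k(1)] k(2) by auto
  next
    show "B $ j \<bullet> B $ i = (if i = j then 1 else 0)" if "j \<notin> I" for i j
      using B(3) that by (simp add: I_def)
    show "M $ i = B $ i" if "i \<in> I" for i
      using that Me B(2) length_le by (auto simp: I_def nth_append)
    fix y :: "real^'n"
    assume y: "\<And>i. y $ i \<in> {-1, 0, 1}" "\<And>i. i \<notin> S \<Longrightarrow> y $ i = 0" "\<And>i. i \<in> I \<Longrightarrow> B $ i \<bullet> y = 0"
    have "v \<bullet> y = 0" if v: "v \<in> set vs" for v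
    proof -
      obtain k where "k < length vs" "v = vs ! k" using v by (auto simp: in_set_conv_nth)
      then show ?thesis using y(3)[of "e k"] B(2)[of k] by (simp add: I_def)
    qed
    then show "y = 0" using inj y(1,2) by blast
  qed
  then show ?thesis by (simp add: cI B(5))
qed

text \<open>Hadamard's inequality for the completed matrix, whose additional rows are unit
  vectors.\<close>

lemma sqrt_gram_le:
  assumes le: "\<And>v. v \<in> set vs \<Longrightarrow> norm v \<le> c"
  shows "sqrt (Determinant.det (gram vs)) \<le> c ^ length vs"
proof (rule orthonormal_matrix)
  fix B :: "real^'n^'n" and e
  assume B: "bij_betw e {0..<CARD('n)} UNIV"
    "\<And>k. k < length vs \<Longrightarrow> B $ e k = vs ! k"
    "\<And>i j. j \<notin> e ` {0..<length vs} \<Longrightarrow> B $ j \<bullet> B $ i = (if i = j then 1 else 0)"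
    "det B \<noteq> 0" "\<bar>det B\<bar> = sqrt (Determinant.det (gram vs))"
  define I where "I = e ` {0..<length vs}"
  have "inj_on e {0..<length vs}"
    using B(1) length_le by (auto simp: bij_betw_def intro: inj_on_subset)
  then have cI: "card I = length vs" by (simp add: I_def card_image)
  have "norm (B $ i) \<le> (if i \<in> I then c else 1)" for i
  proof (cases "i \<in> I")
    case True
    then obtain k where "k < length vs" "i = e k" by (auto simp: I_def)
    then show ?thesis using True B(2)[of k] le by simp
  next
    case False
    then have "B $ i \<bullet> B $ i = 1" using B(3)[of i i] by (simp add: I_def)
    then show ?thesis using False by (simp add: norm_eq_1[symmetric])
  qed
  then have "(\<Prod>i\<in>UNIV. norm (B $ i)) \<le> (\<Prod>i\<in>UNIV. if i \<in> I then c else 1)" by (intro prod_mono) auto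
  also have "\<dots> = c ^ length vs" by (simp add: prod.If_cases cI)
  finally show ?thesis using Hadamard_inequality[of B] B(5) by simp
qed

end

section \<open>The two bounds on \<open>M0\<close>\<close>

lemma M0_le_rank:
  fixes x :: "'t::finite \<Rightarrow> int^'d::finite"
  shows "int (M0 x) \<le> int (rank (Wmat x)) + \<lfloor>log 2 (Hdet x)\<rfloor>"
proof (rule exists_support_no_relation[of x])
  fix S
  assume S: "card S = M0 x" "\<And>y :: real^'t. (\<And>i. y $ i \<in> {-1, 0, 1}) \<Longrightarrow> (\<And>i. i \<notin> S \<Longrightarrow> y $ i = 0) \<Longrightarrow>
      (\<And>j. column j (Wmat x) \<bullet> y = 0) \<Longrightarrow> y = 0"
  have "\<exists>vs. is_lattice_basis (Lat x) vs"
    by (rule exists_lattice_basis) (auto simp: Lat_def span_zero intro: span_diff)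
  then have vs: "is_lattice_basis (Lat x) (SOME vs. is_lattice_basis (Lat x) vs)" by (rule someI_ex)
  define vs where "vs = (SOME vs. is_lattice_basis (Lat x) vs)"
  have bas: "is_lattice_basis (Lat x) vs" using vs by (simp add: vs_def)
  have H: "Hdet x = sqrt (Determinant.det (gram vs))" by (simp add: Hdet_def lattice_det_def vs_def)
  interpret independent_list vs
    using bas by unfold_locales (auto simp: is_lattice_basis_def)
  have sub: "set vs \<subseteq> Lat x" by (rule set_lattice_basis_subset[OF bas])
  have colL: "columns (Wmat x) \<subseteq> Lat x"
  proof
    fix c assume c: "c \<in> columns (Wmat x)"
    then obtain j where "c = column j (Wmat x)" by (auto simp: columns_def)
    then have "c $ i \<in> \<int>" for i by (simp add: column_def Wmat_def)
    then show "c \<in> Lat x" using span_base[OF c] by (simp add: Lat_def)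
  qed
  have cols: "columns (Wmat x) \<subseteq> span (set vs)"
    using colL lattice_subset_span_basis[OF bas] by (rule subset_trans)
  \<comment> \<open>The columns of \<open>W\<close> are themselves lattice points, so the lattice
    spans the whole column space; its basis therefore has \<open>rank (Wmat x)\<close>
    elements.\<close>
  have "span (set vs) = span (columns (Wmat x))"
  proof
    show "span (set vs) \<subseteq> span (columns (Wmat x))" using sub by (intro span_minimal) (auto simp: Lat_def)
    show "span (columns (Wmat x)) \<subseteq> span (set vs)" using cols by (intro span_minimal) auto
  qed
  then have rk: "rank (Wmat x) = length vs"
    using dim_eq_card[OF _ indep] distinct_card[OF dist] by (simp add: column_rank_def)
  have le: "2 ^ card S \<le> 2 ^ length vs * Hdet x"
    unfolding H
  proof (rule two_power_le_sqrt_gram)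
    show "v $ i \<in> \<int>" if "v \<in> set vs" for v i using that sub by (auto simp: Lat_def)
    fix y :: "real^'t"
    assume y: "\<And>i. y $ i \<in> {-1, 0, 1}" "\<And>i. i \<notin> S \<Longrightarrow> y $ i = 0" "\<And>v. v \<in> set vs \<Longrightarrow> v \<bullet> y = 0"
    have "subspace {v. v \<bullet> y = 0}" by (auto simp: subspace_def inner_add_left)
    then have "span (set vs) \<subseteq> {v. v \<bullet> y = 0}" using y(3) by (intro span_minimal) auto
    then have "column j (Wmat x) \<bullet> y = 0" for j using cols by (auto simp: columns_def)
    then show "y = 0" using S(2) y(1,2) by blast
  qed
  \<comment> \<open>Positivity of the determinant is read off from the estimate, whose left side is
    positive; the logarithm needs it.\<close>
  then have Hpos: "Hdet x > 0"
  proof -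
    have "(0 :: real) < 2 ^ card S" by simp
    also note le
    finally show ?thesis by (simp add: zero_less_mult_iff)
  qed
  have "log 2 (2 ^ card S) \<le> log 2 (2 ^ length vs * Hdet x)"
    using le Hpos by (subst log_le_cancel_iff) auto
  then have "real (card S) \<le> real (length vs) + log 2 (Hdet x)"
    using Hpos by (simp add: log_mult log_nat_power)
  \<comment> \<open>The left side is an integer, so the floor may be taken on the right.\<close>
  then have "int (card S) - int (length vs) \<le> \<lfloor>log 2 (Hdet x)\<rfloor>"
    by (simp add: le_floor_iff)
  then show ?thesis by (simp add: S(1) rk)
qed

text \<open>Resolves an inequality with \<open>s\<close> on both sides. For
  \<open>u = s / d\<close>, replacing \<open>sqrt s\<close> by \<open>sqrt d\<close> costs
  \<open>d * log 2 u / 2\<close>, which is at most \<open>s / 2\<close> and can be absorbed on the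
  left; this is the origin of the factor 2 in the second bound.\<close>

lemma le_double_of_le_log:
  fixes s d M :: real
  assumes "0 < d" "0 < s" "0 < M" "s \<le> d * log 2 (2 * sqrt s * M)"
  shows "s \<le> 2 * d * log 2 (2 * sqrt d * M)"
proof -
  define u where "u = s / d"
  have u: "u > 0" using assms by (simp add: u_def)
  have su: "s = d * u" using assms by (simp add: u_def)
  have lu: "log 2 u \<le> u"
  proof -
    \<comment> \<open>The tangent to the logarithm at 2 is sharp enough: with
      \<open>ln 2 \<le> 1\<close> it leaves \<open>u / 2\<close>, and \<open>ln 2\<close> exceeds
      1/2.\<close>
    have "ln (u / 2) \<le> u / 2 - 1" using u by (intro ln_le_minus_one) simp
    then have "ln u \<le> u / 2 - 1 + ln 2" using u by (simp add: ln_div)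
    also have "\<dots> \<le> u * (1 / 2)" using ln_le_minus_one[of 2] by simp
    also have "\<dots> \<le> u * ln 2" using u ln2_ge_two_thirds by (intro mult_left_mono) auto
    finally show ?thesis by (simp add: log_def divide_le_eq)
  qed
  have "2 * sqrt s * M = 2 * sqrt d * M * sqrt u" by (simp add: su real_sqrt_mult)
  then have "log 2 (2 * sqrt s * M) = log 2 (2 * sqrt d * M) + log 2 u / 2"
    using assms u by (simp add: log_mult powr_half_sqrt [symmetric] log_powr)
  then have "s \<le> d * log 2 (2 * sqrt d * M) + d * (log 2 u / 2)"
    using assms(4) by (simp add: distrib_left)
  also have "d * (log 2 u / 2) \<le> d * (u / 2)" using lu assms by (intro mult_left_mono) auto
  also have "d * (u / 2) = s / 2" by (simp add: su)
  finally show ?thesis by simp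
qed

lemma abs_le_linf_set:
  fixes X :: "(int^'d::finite) set"
  assumes "finite X" "v \<in> X"
  shows "\<bar>v $ j\<bar> \<le> linf_set X"
proof -
  have "\<bar>v $ j\<bar> \<le> linf v" unfolding linf_def by (intro Max_ge) auto
  also have "\<dots> \<le> linf_set X" unfolding linf_set_def using assms by (intro Max_ge) auto
  finally show ?thesis .
qed

text \<open>The columns of \<open>W\<close> are truncated to \<open>S\<close> so that their norms
  are at most \<open>sqrt s * m\<close> with \<open>s = card S\<close>, independently of the number
  of vectors in \<open>X\<close>. The relations supported on \<open>S\<close> stay the same. The
  price is an \<open>s\<close> inside the logarithm, removed by
  \<open>le_double_of_le_log\<close>.\<close>

lemma M0_le_linf:
  fixes x :: "'t::finite \<Rightarrow> int^'d::finite"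
  assumes nz: "0 \<notin> range x"
  defines "m \<equiv> real_of_int (linf_set (range x))"
  shows "real (M0 x) \<le> 2 * real CARD('d) * log 2 (2 * sqrt (real CARD('d)) * m)"
proof (rule exists_support_no_relation[of x])
  fix S
  assume S: "card S = M0 x" "\<And>y :: real^'t. (\<And>i. y $ i \<in> {-1, 0, 1}) \<Longrightarrow> (\<And>i. i \<notin> S \<Longrightarrow> y $ i = 0) \<Longrightarrow>
      (\<And>j. column j (Wmat x) \<bullet> y = 0) \<Longrightarrow> y = 0"
  have entry: "\<bar>real_of_int (x i $ j)\<bar> \<le> m" for i j
  proof -
    have "\<bar>x i $ j\<bar> \<le> linf_set (range x)" by (rule abs_le_linf_set) auto
    then have "real_of_int \<bar>x i $ j\<bar> \<le> m" unfolding m_def by (simp only: of_int_le_iff)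
    then show ?thesis by simp
  qed
  have m1: "m \<ge> 1"
  proof -
    \<comment> \<open>An arbitrary index: index types are nonempty, and a nonzero integer vector has
      an entry of absolute value at least 1.\<close>
    have "x undefined \<noteq> 0" using nz by (metis rangeI)
    then obtain j where "x undefined $ j \<noteq> 0" by (auto simp: vec_eq_iff)
    then have "real_of_int 1 \<le> of_int \<bar>x undefined $ j\<bar>" by (subst of_int_le_iff) auto
    then show ?thesis using entry[of undefined j] by simp
  qed
  define d where "d = real CARD('d)"
  have d1: "d \<ge> 1" by (simp add: d_def Suc_le_eq)
  show ?thesis
  \<comment> \<open>Without a positive \<open>s\<close> the logarithm of
    \<open>2 * sqrt s * m\<close> carries no information; then only the right-hand side being
    nonnegative is to be checked.\<close>
  proof (cases "card S = 0")
    case True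
    have "1 \<le> sqrt d" using d1 by simp
    then have "1 * 1 \<le> sqrt d * m" using m1 by (intro mult_mono) auto
    then have "1 \<le> 2 * sqrt d * m" by linarith
    then have "0 \<le> log 2 (2 * sqrt d * m)" by (intro zero_le_log_cancel_iff[THEN iffD2]) linarith+
    then show ?thesis using True S(1) d1 by (simp add: d_def)
  next
    case False
    define s where "s = real (card S)"
    have s1: "s \<ge> 1" using False unfolding s_def by linarith
    define c :: "'d \<Rightarrow> real^'t" where "c j = (\<chi> i. if i \<in> S then of_int (x i $ j) else 0)" for j
    \<comment> \<open>Truncated columns may coincide or be dependent, so a maximal independent
      subset is taken; it has at most \<open>d\<close> elements and the same orthogonal
      vectors.\<close>
    obtain V where V: "V \<subseteq> range c" "independent V" "range c \<subseteq> span V"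
      using maximal_independent_subset[of "range c"] by blast
    have finV: "finite V" using V(1) by (rule finite_subset) simp
    obtain vs where vs: "set vs = V" "distinct vs" using finite_distinct_list[OF finV] by auto
    interpret independent_list vs using vs V(2) by unfold_locales auto
    have "length vs = card V" using vs distinct_card by metis
    also have "\<dots> \<le> card (range c)" using V(1) by (intro card_mono) auto
    also have "\<dots> \<le> CARD('d)" by (rule card_image_le) simp
    finally have rd: "real (length vs) \<le> d" by (simp add: d_def)
    have inner: "c j \<bullet> y = column j (Wmat x) \<bullet> y" if "\<And>i. i \<notin> S \<Longrightarrow> y $ i = 0" for y :: "real^'t" and j
      unfolding column_Wmat_inner unfolding inner_vec_def inner_real_def
      by (intro sum.cong refl) (auto simp: c_def that)
    have "2 ^ card S \<le> 2 ^ length vs * sqrt (Determinant.det (gram vs))"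
    proof (rule two_power_le_sqrt_gram)
      show "v $ i \<in> \<int>" if "v \<in> set vs" for v i using that vs V(1) by (auto simp: c_def)
      fix y :: "real^'t"
      assume y: "\<And>i. y $ i \<in> {-1, 0, 1}" "\<And>i. i \<notin> S \<Longrightarrow> y $ i = 0" "\<And>v. v \<in> set vs \<Longrightarrow> v \<bullet> y = 0"
      have "subspace {v. v \<bullet> y = 0}" by (auto simp: subspace_def inner_add_left)
      then have "span V \<subseteq> {v. v \<bullet> y = 0}" using y(3) vs by (intro span_minimal) auto
      then have "c j \<bullet> y = 0" for j using V(3) by auto
      then have "column j (Wmat x) \<bullet> y = 0" for j using inner[OF y(2)] by simp
      then show "y = 0" using S(2) y(1,2) by blast
    qed
    also have "sqrt (Determinant.det (gram vs)) \<le> (sqrt s * m) ^ length vs"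
    proof (rule sqrt_gram_le)
      fix v assume "v \<in> set vs"
      then obtain j where j: "v = c j" using vs V(1) by auto
      have "(norm v)\<^sup>2 = (\<Sum>i\<in>UNIV. (c j $ i)\<^sup>2)" by (simp add: j norm_vec_power2)
      also have "\<dots> \<le> (\<Sum>i\<in>UNIV. if i \<in> S then m\<^sup>2 else 0)"
      proof (rule sum_mono)
        fix i show "(c j $ i)\<^sup>2 \<le> (if i \<in> S then m\<^sup>2 else 0)"
          using entry[of i j] m1 by (auto simp: c_def abs_le_square_iff[symmetric])
      qed
      also have "\<dots> = s * m\<^sup>2" by (simp add: s_def sum.If_cases)
      also have "\<dots> = (sqrt s * m)\<^sup>2" using s1 by (simp add: power_mult_distrib)
      finally show "norm v \<le> sqrt s * m" by (rule power2_le_imp_le) (use s1 m1 in simp)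
    qed
    finally have "2 ^ card S \<le> (2 * sqrt s * m) ^ length vs"
      by (simp add: power_mult_distrib mult.assoc)
    define L where "L = log 2 (2 * sqrt s * m)"
    have ge1: "1 \<le> 2 * sqrt s * m"
    proof -
      have "1 * 1 \<le> sqrt s * m" using s1 m1 by (intro mult_mono) auto
      then show ?thesis by simp
    qed
    then have pos: "0 < 2 * sqrt s * m" by linarith
    \<comment> \<open>Nonnegativity of \<open>L\<close> is what permits replacing
      \<open>length vs\<close> by the larger \<open>d\<close>.\<close>
    have L0: "0 \<le> L" unfolding L_def using ge1 by (intro zero_le_log_cancel_iff[THEN iffD2]) linarith+
    have "log 2 (2 ^ card S) \<le> log 2 ((2 * sqrt s * m) ^ length vs)"
      using \<open>2 ^ card S \<le> (2 * sqrt s * m) ^ length vs\<close> zero_less_power[OF pos]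
      by (subst log_le_cancel_iff) simp_all
    then have "s \<le> real (length vs) * L"
      using pos by (simp add: log_nat_power s_def L_def)
    also have "\<dots> \<le> d * L" using rd L0 by (rule mult_right_mono)
    finally have "s \<le> 2 * d * log 2 (2 * sqrt d * m)"
      unfolding L_def using d1 s1 m1 by (intro le_double_of_le_log) auto
    then show ?thesis by (simp add: s_def d_def S(1))
  qed
qed

theorem theorem1:
  fixes X :: "(int ^ 'd::finite) set" and x :: "'t::finite \<Rightarrow> int ^ 'd"
  assumes "bij_betw x UNIV X" and "0 \<notin> X"
  shows "int (M0 x) \<le> int (rank (Wmat x)) + \<lfloor>log 2 (Hdet x)\<rfloor> \<and>
    int (M0 x) \<le> \<lfloor>2 * real CARD('d) * log 2 (2 * sqrt (real CARD('d)) * real_of_int (linf_set X))\<rfloor>"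
proof -
  have X: "X = range x" using assms(1) by (simp add: bij_betw_def)
  show ?thesis
    using M0_le_rank[of x] M0_le_linf[of x] assms(2) unfolding X by (simp add: le_floor_iff)
qed

end
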